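(* Let $k$ be a field and let $\mathcal M$ be a $k$-linear abelian semisimple (left) module category over a fusion category $\mathcal C$. If $M$ is a generator of $\mathcal M$, then $A=\underline{\operatorname{Hom}}(M,M)$ is a semisimple algebra in $\mathcal C$, and the functor $G=\bullet\otimes_AM:\mathrm{Mod}_{\mathcal C}(A)\to\mathcal M$ is a quasi-inverse to the equivalence $F=\underline{\operatorname{Hom}}(M,\bullet):\mathcal M\to\mathrm{Mod}_{\mathcal C}(A)$. Moreover, if $V\in\mathcal M$ and $U\in\mathrm{Mod}_{\mathcal C}(A)$, then: 1. $\underline{\operatorname{Hom}}(M,V)\otimes_AM\cong V$ as objects of $\mathcal M$, and $U\cong\underline{\operatorname{Hom}}(M,U\otimes_AM)$ as right $A$-modules in $\mathcal C$. 2. $V$ is a simple object of $\mathcal M$ if and only if $\underline{\operatorname{Hom}}(M,V)$ is a simple object of $\mathrm{Mod}_{\mathcal C}(A)$. 3. $U$ is a simple object of $\mathrm{Mod}_{\mathcal C}(A)$ if and only if $U\otimes_AM$ is a simple object of $\mathcal M$.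
   Context: A fusion category is a $k$-linear semisimple rigid monoidal category with finite dimensional Hom spaces, finitely many isomorphism classes of simple objects and simple unit object. $(\mathcal M,\otimes,a)$ denotes the module category with module associativity isomorphism $a$. For $M_1,M_2\in\mathcal M$, the internal Hom $\underline{\operatorname{Hom}}(M_1,M_2)\in\mathcal C$ is the object representing $X\mapsto\operatorname{Hom}_{\mathcal M}(X\otimes M_1,M_2)$; it always exists here. The evaluation $ev_{M_1,M_2}:\underline{\operatorname{Hom}}(M_1,M_2)\otimes M_1\to M_2$ corresponds to the identity of $\underline{\operatorname{Hom}}(M_1,M_2)$, and the composition $\mu_{M_1,M_2,M_3}:\underline{\operatorname{Hom}}(M_2,M_3)\otimes\underline{\operatorname{Hom}}(M_1,M_2)\to\underline{\operatorname{Hom}}(M_1,M_3)$ corresponds to $ev_{M_2,M_3}\circ(id\otimes ev_{M_1,M_2})\circ a$. Thus $A=\underline{\operatorname{Hom}}(M,M)$ is an algebra in $\mathcal C$ with product $\mu_{M,M,M}$, $\underline{\operatorname{Hom}}(M,V)$ is a right $A$-module in $\mathcal C$ via $\mu_{M,M,V}$, and $(M,ev_{M,M})$ is a left $A$-module in $\mathcal M$. $\mathrm{Mod}_{\mathcal C}(A)$ is the category of right $A$-modules in $\mathcal C$; $A$ is semisimple if this category is semisimple. For a right $A$-module $(U,q)$ in $\mathcal C$ and a left $A$-module $(M,p)$ in $\mathcal M$, $U\otimes_AM\in\mathcal M$ is the cokernel of $q\otimes id_M-(id_U\otimes p)\circ a_{U,A,M}:(U\otimes A)\otimes M\to U\otimes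 M$. An object $M$ generates $\mathcal M$ if for every $N\in\mathcal M$ there are $X\in\mathcal C$ and an epimorphism $X\otimes M\to N$. *)

theory Defs
  imports "HOL-Algebra.Module"
begin

section \<open>Categories\<close>

record ('o, 'a) cat =
  Obj :: "'o set"
  Arr :: "'a set"
  Dom :: "'a \<Rightarrow> 'o"
  Cod :: "'a \<Rightarrow> 'o"
  Id :: "'o \<Rightarrow> 'a"
  Comp :: "'a \<Rightarrow> 'a \<Rightarrow> 'a"  (infixr "\<cdot>\<index>" 65)

definition hom_set :: "('o, 'a, 'z) cat_scheme \<Rightarrow> 'o \<Rightarrow> 'o \<Rightarrow> 'a set" where
  "hom_set C x y = {f \<in> Arr C. Dom C f = x \<and> Cod C f = y}"

locale category =
  fixes C :: "('o, 'a, 'z) cat_scheme"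
  assumes Dom_Obj: "f \<in> Arr C \<Longrightarrow> Dom C f \<in> Obj C"
    and Cod_Obj: "f \<in> Arr C \<Longrightarrow> Cod C f \<in> Obj C"
    and Id_hom: "x \<in> Obj C \<Longrightarrow> Id C x \<in> hom_set C x x"
    and Comp_hom: "\<lbrakk> f \<in> hom_set C x y; g \<in> hom_set C y z \<rbrakk> \<Longrightarrow> g \<cdot>\<^bsub>C\<^esub> f \<in> hom_set C x z"
    and Comp_Id_left: "f \<in> hom_set C x y \<Longrightarrow> Id C y \<cdot>\<^bsub>C\<^esub> f = f"
    and Comp_Id_right: "f \<in> hom_set C x y \<Longrightarrow> f \<cdot>\<^bsub>C\<^esub> Id C x = f"
    and Comp_assoc: "\<lbrakk> f \<in> hom_set C w x; g \<in> hom_set C x y; h \<in> hom_set C y z \<rbrakk>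
      \<Longrightarrow> (h \<cdot>\<^bsub>C\<^esub> g) \<cdot>\<^bsub>C\<^esub> f = h \<cdot>\<^bsub>C\<^esub> (g \<cdot>\<^bsub>C\<^esub> f)"

definition inverse_arrows :: "('o, 'a, 'z) cat_scheme \<Rightarrow> 'a \<Rightarrow> 'a \<Rightarrow> bool" where
  "inverse_arrows C f g \<longleftrightarrow> f \<in> Arr C \<and> g \<in> hom_set C (Cod C f) (Dom C f) \<and>
     g \<cdot>\<^bsub>C\<^esub> f = Id C (Dom C f) \<and> f \<cdot>\<^bsub>C\<^esub> g = Id C (Cod C f)"

definition iso_arrow :: "('o, 'a, 'z) cat_scheme \<Rightarrow> 'a \<Rightarrow> bool" where
  "iso_arrow C f \<longleftrightarrow> (\<exists>g. inverse_arrows C f g)"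

definition inverse_arrow :: "('o, 'a, 'z) cat_scheme \<Rightarrow> 'a \<Rightarrow> 'a" where
  "inverse_arrow C f = (THE g. inverse_arrows C f g)"

definition isomorphic :: "('o, 'a, 'z) cat_scheme \<Rightarrow> 'o \<Rightarrow> 'o \<Rightarrow> bool" where
  "isomorphic C x y \<longleftrightarrow> x \<in> Obj C \<and> y \<in> Obj C \<and> (\<exists>f \<in> hom_set C x y. iso_arrow C f)"

definition mono_arrow :: "('o, 'a, 'z) cat_scheme \<Rightarrow> 'a \<Rightarrow> bool" where
  "mono_arrow C f \<longleftrightarrow> f \<in> Arr C \<and>
     (\<forall>x \<in> Obj C. \<forall>g \<in> hom_set C x (Dom C f). \<forall>h \<in> hom_set C x (Dom C f).
        f \<cdot>\<^bsub>C\<^esub> g = f \<cdot>\<^bsub>C\<^esub> h \<longrightarrow> g = h)"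

definition epi_arrow :: "('o, 'a, 'z) cat_scheme \<Rightarrow> 'a \<Rightarrow> bool" where
  "epi_arrow C f \<longleftrightarrow> f \<in> Arr C \<and>
     (\<forall>y \<in> Obj C. \<forall>g \<in> hom_set C (Cod C f) y. \<forall>h \<in> hom_set C (Cod C f) y.
        g \<cdot>\<^bsub>C\<^esub> f = h \<cdot>\<^bsub>C\<^esub> f \<longrightarrow> g = h)"

definition zero_object :: "('o, 'a, 'z) cat_scheme \<Rightarrow> 'o \<Rightarrow> bool" where
  "zero_object C z \<longleftrightarrow> z \<in> Obj C \<and>
     (\<forall>x \<in> Obj C. (\<exists>!f. f \<in> hom_set C z x) \<and> (\<exists>!f. f \<in> hom_set C x z))"

definition simple_object :: "('o, 'a, 'z) cat_scheme \<Rightarrow> 'o \<Rightarrow> bool" where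
  "simple_object C x \<longleftrightarrow> x \<in> Obj C \<and> \<not> zero_object C x \<and>
     (\<forall>y \<in> Obj C. \<forall>f \<in> hom_set C y x. mono_arrow C f \<longrightarrow> zero_object C y \<or> iso_arrow C f)"

record ('o, 'a, 'p, 'b) funct =
  FObj :: "'o \<Rightarrow> 'p"
  FArr :: "'a \<Rightarrow> 'b"

definition id_funct :: "('o, 'a, 'o, 'a) funct" where
  "id_funct = \<lparr>FObj = \<lambda>x. x, FArr = \<lambda>f. f\<rparr>"

definition comp_funct ::
  "('p, 'b, 'q, 'c) funct \<Rightarrow> ('o, 'a, 'p, 'b) funct \<Rightarrow> ('o, 'a, 'q, 'c) funct" where
  "comp_funct G F = \<lparr>FObj = \<lambda>x. FObj G (FObj F x), FArr = \<lambda>f. FArr G (FArr F f)\<rparr>"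

definition natural_iso ::
  "('o, 'a, 'z) cat_scheme \<Rightarrow> ('p, 'b, 'y) cat_scheme \<Rightarrow>
   ('o, 'a, 'p, 'b) funct \<Rightarrow> ('o, 'a, 'p, 'b) funct \<Rightarrow> ('o \<Rightarrow> 'b) \<Rightarrow> bool" where
  "natural_iso C D F G \<eta> \<longleftrightarrow>
     (\<forall>x \<in> Obj C. \<eta> x \<in> hom_set D (FObj F x) (FObj G x) \<and> iso_arrow D (\<eta> x)) \<and>
     (\<forall>f \<in> Arr C. FArr G f \<cdot>\<^bsub>D\<^esub> \<eta> (Dom C f) = \<eta> (Cod C f) \<cdot>\<^bsub>D\<^esub> FArr F f)"

definition naturally_isomorphic ::
  "('o, 'a, 'z) cat_scheme \<Rightarrow> ('p, 'b, 'y) cat_scheme \<Rightarrow>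
   ('o, 'a, 'p, 'b) funct \<Rightarrow> ('o, 'a, 'p, 'b) funct \<Rightarrow> bool" where
  "naturally_isomorphic C D F G \<longleftrightarrow> (\<exists>\<eta>. natural_iso C D F G \<eta>)"


section \<open>Linear, abelian and semisimple categories\<close>

record ('k, 'o, 'a) lin_cat = "('o, 'a) cat" +
  Zero_arr :: "'o \<Rightarrow> 'o \<Rightarrow> 'a"
  Add_arr :: "'a \<Rightarrow> 'a \<Rightarrow> 'a"
  Smult_arr :: "'k \<Rightarrow> 'a \<Rightarrow> 'a"

text \<open>
  A module record of the library also has multiplicative components; \<^locale>\<open>module\<close> puts no
  conditions on them and they are left unspecified here.
\<close>

definition hom_space ::
  "('k, 'o, 'a, 'z) lin_cat_scheme \<Rightarrow> 'o \<Rightarrow> 'o \<Rightarrow> ('k, 'a) module" where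
  "hom_space C x y =
     \<lparr>carrier = hom_set C x y, mult = undefined, one = undefined,
      zero = Zero_arr C x y, add = Add_arr C, smult = Smult_arr C\<rparr>"

locale linear_category = field K + category C
  for K :: "('k, 'r) ring_scheme" (structure) and C :: "('k, 'o, 'a, 'z) lin_cat_scheme" +
  assumes hom_module: "\<lbrakk> x \<in> Obj C; y \<in> Obj C \<rbrakk> \<Longrightarrow> module K (hom_space C x y)"
    and Comp_add_left: "\<lbrakk> f \<in> hom_set C x y; g \<in> hom_set C y z; h \<in> hom_set C y z \<rbrakk>
      \<Longrightarrow> Add_arr C g h \<cdot>\<^bsub>C\<^esub> f = Add_arr C (g \<cdot>\<^bsub>C\<^esub> f) (h \<cdot>\<^bsub>C\<^esub> f)"
    and Comp_add_right: "\<lbrakk> f \<in> hom_set C x y; g \<in> hom_set C x y; h \<in> hom_set C y z \<rbrakk>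
      \<Longrightarrow> h \<cdot>\<^bsub>C\<^esub> Add_arr C f g = Add_arr C (h \<cdot>\<^bsub>C\<^esub> f) (h \<cdot>\<^bsub>C\<^esub> g)"
    and Comp_smult_left: "\<lbrakk> c \<in> carrier K; f \<in> hom_set C x y; g \<in> hom_set C y z \<rbrakk>
      \<Longrightarrow> Smult_arr C c g \<cdot>\<^bsub>C\<^esub> f = Smult_arr C c (g \<cdot>\<^bsub>C\<^esub> f)"
    and Comp_smult_right: "\<lbrakk> c \<in> carrier K; f \<in> hom_set C x y; g \<in> hom_set C y z \<rbrakk>
      \<Longrightarrow> g \<cdot>\<^bsub>C\<^esub> Smult_arr C c f = Smult_arr C c (g \<cdot>\<^bsub>C\<^esub> f)"

definition fin_dim_hom ::
  "('k, 'r) ring_scheme \<Rightarrow> ('k, 'o, 'a, 'z) lin_cat_scheme \<Rightarrow> 'o \<Rightarrow> 'o \<Rightarrow> bool" where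
  "fin_dim_hom K C x y \<longleftrightarrow>
     (\<exists>B. finite B \<and> B \<subseteq> hom_set C x y \<and>
        (\<forall>f \<in> hom_set C x y. \<exists>c \<in> B \<rightarrow> carrier K.
           f = (\<Oplus>\<^bsub>hom_space C x y\<^esub>b \<in> B. Smult_arr C (c b) b)))"

definition is_kernel :: "('k, 'o, 'a, 'z) lin_cat_scheme \<Rightarrow> 'a \<Rightarrow> 'a \<Rightarrow> bool" where
  "is_kernel C f i \<longleftrightarrow> f \<in> Arr C \<and> i \<in> Arr C \<and> Cod C i = Dom C f \<and>
     f \<cdot>\<^bsub>C\<^esub> i = Zero_arr C (Dom C i) (Cod C f) \<and>
     (\<forall>x \<in> Obj C. \<forall>h \<in> hom_set C x (Dom C f). f \<cdot>\<^bsub>C\<^esub> h = Zero_arr C x (Cod C f) \<longrightarrow>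
        (\<exists>!u. u \<in> hom_set C x (Dom C i) \<and> i \<cdot>\<^bsub>C\<^esub> u = h))"

definition is_cokernel :: "('k, 'o, 'a, 'z) lin_cat_scheme \<Rightarrow> 'a \<Rightarrow> 'a \<Rightarrow> bool" where
  "is_cokernel C f p \<longleftrightarrow> f \<in> Arr C \<and> p \<in> Arr C \<and> Dom C p = Cod C f \<and>
     p \<cdot>\<^bsub>C\<^esub> f = Zero_arr C (Dom C f) (Cod C p) \<and>
     (\<forall>y \<in> Obj C. \<forall>h \<in> hom_set C (Cod C f) y. h \<cdot>\<^bsub>C\<^esub> f = Zero_arr C (Dom C f) y \<longrightarrow>
        (\<exists>!u. u \<in> hom_set C (Cod C p) y \<and> u \<cdot>\<^bsub>C\<^esub> p = h))"

definition cokernel_arrow :: "('k, 'o, 'a, 'z) lin_cat_scheme \<Rightarrow> 'a \<Rightarrow> 'a" where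
  "cokernel_arrow C f = (SOME p. is_cokernel C f p)"

definition direct_sum :: "('k, 'o, 'a, 'z) lin_cat_scheme \<Rightarrow> nat \<Rightarrow> (nat \<Rightarrow> 'o) \<Rightarrow> 'o \<Rightarrow> bool" where
  "direct_sum C n S x \<longleftrightarrow> x \<in> Obj C \<and> (\<forall>i<n. S i \<in> Obj C) \<and>
     (\<exists>\<iota> \<pi>. (\<forall>i<n. \<iota> i \<in> hom_set C (S i) x \<and> \<pi> i \<in> hom_set C x (S i)) \<and>
        (\<forall>i<n. \<forall>j<n. \<pi> i \<cdot>\<^bsub>C\<^esub> \<iota> j = (if i = j then Id C (S i) else Zero_arr C (S j) (S i))) \<and>
        (\<Oplus>\<^bsub>hom_space C x x\<^esub>i \<in> {..<n}. \<iota> i \<cdot>\<^bsub>C\<^esub> \<pi> i) = Id C x)"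

locale abelian_category = linear_category K C
  for K :: "('k, 'r) ring_scheme" (structure) and C :: "('k, 'o, 'a, 'z) lin_cat_scheme" +
  assumes ex_zero_object: "\<exists>z. zero_object C z"
    and ex_direct_sum: "\<lbrakk> x \<in> Obj C; y \<in> Obj C \<rbrakk>
      \<Longrightarrow> \<exists>s. direct_sum C 2 (\<lambda>i. if i = 0 then x else y) s"
    and ex_kernel: "f \<in> Arr C \<Longrightarrow> \<exists>i. is_kernel C f i"
    and ex_cokernel: "f \<in> Arr C \<Longrightarrow> \<exists>p. is_cokernel C f p"
    and mono_is_kernel: "mono_arrow C i \<Longrightarrow> \<exists>f. is_kernel C f i"
    and epi_is_cokernel: "epi_arrow C p \<Longrightarrow> \<exists>f. is_cokernel C f p"

text \<open>Every object is a finite direct sum of simple objects; the empty sum (a zero object) is allowed.\<close>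

locale semisimple_category = abelian_category K C
  for K :: "('k, 'r) ring_scheme" (structure) and C :: "('k, 'o, 'a, 'z) lin_cat_scheme" +
  assumes sum_of_simples: "x \<in> Obj C
      \<Longrightarrow> \<exists>n S. (\<forall>i<n. simple_object C (S i)) \<and> direct_sum C n S x"

locale linear_functor = C: linear_category K C + D: linear_category K D
  for K :: "('k, 'r) ring_scheme" (structure)
    and C :: "('k, 'o, 'a, 'z) lin_cat_scheme" and D :: "('k, 'p, 'b, 'y) lin_cat_scheme" +
  fixes F :: "('o, 'a, 'p, 'b) funct"
  assumes FObj_Obj: "x \<in> Obj C \<Longrightarrow> FObj F x \<in> Obj D"
    and FArr_hom: "f \<in> hom_set C x y \<Longrightarrow> FArr F f \<in> hom_set D (FObj F x) (FObj F y)"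
    and FArr_Id: "x \<in> Obj C \<Longrightarrow> FArr F (Id C x) = Id D (FObj F x)"
    and FArr_Comp: "\<lbrakk> f \<in> hom_set C x y; g \<in> hom_set C y z \<rbrakk>
      \<Longrightarrow> FArr F (g \<cdot>\<^bsub>C\<^esub> f) = FArr F g \<cdot>\<^bsub>D\<^esub> FArr F f"
    and FArr_add: "\<lbrakk> f \<in> hom_set C x y; g \<in> hom_set C x y \<rbrakk>
      \<Longrightarrow> FArr F (Add_arr C f g) = Add_arr D (FArr F f) (FArr F g)"
    and FArr_smult: "\<lbrakk> c \<in> carrier K; f \<in> hom_set C x y \<rbrakk>
      \<Longrightarrow> FArr F (Smult_arr C c f) = Smult_arr D c (FArr F f)"

definition quasi_inverse ::
  "('k, 'r) ring_scheme \<Rightarrow> ('k, 'o, 'a, 'z) lin_cat_scheme \<Rightarrow> ('k, 'p, 'b, 'y) lin_cat_scheme \<Rightarrow>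
   ('o, 'a, 'p, 'b) funct \<Rightarrow> ('p, 'b, 'o, 'a) funct \<Rightarrow> bool" where
  "quasi_inverse K C D F G \<longleftrightarrow> linear_functor K C D F \<and> linear_functor K D C G \<and>
     naturally_isomorphic C C (comp_funct G F) id_funct \<and>
     naturally_isomorphic D D (comp_funct F G) id_funct"

definition cat_equivalence ::
  "('k, 'r) ring_scheme \<Rightarrow> ('k, 'o, 'a, 'z) lin_cat_scheme \<Rightarrow> ('k, 'p, 'b, 'y) lin_cat_scheme \<Rightarrow>
   ('o, 'a, 'p, 'b) funct \<Rightarrow> bool" where
  "cat_equivalence K C D F \<longleftrightarrow> (\<exists>G. quasi_inverse K C D F G)"


section \<open>Fusion categories\<close>

record ('k, 'o, 'a) mon_cat = "('k, 'o, 'a) lin_cat" +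
  TenO :: "'o \<Rightarrow> 'o \<Rightarrow> 'o"  (infixr "\<otimes>\<^sub>o\<index>" 75)
  TenA :: "'a \<Rightarrow> 'a \<Rightarrow> 'a"  (infixr "\<otimes>\<^sub>a\<index>" 75)
  UnitO :: 'o
  Assoc :: "'o \<Rightarrow> 'o \<Rightarrow> 'o \<Rightarrow> 'a"
  LUnit :: "'o \<Rightarrow> 'a"
  RUnit :: "'o \<Rightarrow> 'a"

text \<open>
  \<^term>\<open>Assoc C x y z\<close> goes from \<open>(x \<otimes> y) \<otimes> z\<close> to \<open>x \<otimes> (y \<otimes> z)\<close>.
\<close>

locale linear_monoidal_category = linear_category K C
  for K :: "('k, 'r) ring_scheme" (structure) and C :: "('k, 'o, 'a, 'z) mon_cat_scheme" +
  assumes TenO_Obj: "\<lbrakk> x \<in> Obj C; y \<in> Obj C \<rbrakk> \<Longrightarrow> x \<otimes>\<^sub>o\<^bsub>C\<^esub> y \<in> Obj C"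
    and UnitO_Obj: "UnitO C \<in> Obj C"
    and TenA_hom: "\<lbrakk> f \<in> hom_set C x y; g \<in> hom_set C v w \<rbrakk>
      \<Longrightarrow> f \<otimes>\<^sub>a\<^bsub>C\<^esub> g \<in> hom_set C (x \<otimes>\<^sub>o\<^bsub>C\<^esub> v) (y \<otimes>\<^sub>o\<^bsub>C\<^esub> w)"
    and TenA_Id: "\<lbrakk> x \<in> Obj C; y \<in> Obj C \<rbrakk>
      \<Longrightarrow> Id C x \<otimes>\<^sub>a\<^bsub>C\<^esub> Id C y = Id C (x \<otimes>\<^sub>o\<^bsub>C\<^esub> y)"
    and TenA_Comp: "\<lbrakk> f \<in> hom_set C x y; g \<in> hom_set C y z; f' \<in> hom_set C x' y'; g' \<in> hom_set C y' z' \<rbrakk>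
      \<Longrightarrow> (g \<cdot>\<^bsub>C\<^esub> f) \<otimes>\<^sub>a\<^bsub>C\<^esub> (g' \<cdot>\<^bsub>C\<^esub> f') = (g \<otimes>\<^sub>a\<^bsub>C\<^esub> g') \<cdot>\<^bsub>C\<^esub> (f \<otimes>\<^sub>a\<^bsub>C\<^esub> f')"
    and TenA_add_left: "\<lbrakk> f \<in> hom_set C x y; g \<in> hom_set C x y; h \<in> hom_set C v w \<rbrakk>
      \<Longrightarrow> Add_arr C f g \<otimes>\<^sub>a\<^bsub>C\<^esub> h = Add_arr C (f \<otimes>\<^sub>a\<^bsub>C\<^esub> h) (g \<otimes>\<^sub>a\<^bsub>C\<^esub> h)"
    and TenA_add_right: "\<lbrakk> f \<in> hom_set C x y; g \<in> hom_set C v w; h \<in> hom_set C v w \<rbrakk>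
      \<Longrightarrow> f \<otimes>\<^sub>a\<^bsub>C\<^esub> Add_arr C g h = Add_arr C (f \<otimes>\<^sub>a\<^bsub>C\<^esub> g) (f \<otimes>\<^sub>a\<^bsub>C\<^esub> h)"
    and TenA_smult_left: "\<lbrakk> c \<in> carrier K; f \<in> hom_set C x y; g \<in> hom_set C v w \<rbrakk>
      \<Longrightarrow> Smult_arr C c f \<otimes>\<^sub>a\<^bsub>C\<^esub> g = Smult_arr C c (f \<otimes>\<^sub>a\<^bsub>C\<^esub> g)"
    and TenA_smult_right: "\<lbrakk> c \<in> carrier K; f \<in> hom_set C x y; g \<in> hom_set C v w \<rbrakk>
      \<Longrightarrow> f \<otimes>\<^sub>a\<^bsub>C\<^esub> Smult_arr C c g = Smult_arr C c (f \<otimes>\<^sub>a\<^bsub>C\<^esub> g)"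
    and Assoc_hom: "\<lbrakk> x \<in> Obj C; y \<in> Obj C; z \<in> Obj C \<rbrakk>
      \<Longrightarrow> Assoc C x y z \<in> hom_set C ((x \<otimes>\<^sub>o\<^bsub>C\<^esub> y) \<otimes>\<^sub>o\<^bsub>C\<^esub> z) (x \<otimes>\<^sub>o\<^bsub>C\<^esub> (y \<otimes>\<^sub>o\<^bsub>C\<^esub> z))"
    and Assoc_iso: "\<lbrakk> x \<in> Obj C; y \<in> Obj C; z \<in> Obj C \<rbrakk> \<Longrightarrow> iso_arrow C (Assoc C x y z)"
    and Assoc_natural: "\<lbrakk> f \<in> hom_set C x x'; g \<in> hom_set C y y'; h \<in> hom_set C z z' \<rbrakk>
      \<Longrightarrow> Assoc C x' y' z' \<cdot>\<^bsub>C\<^esub> ((f \<otimes>\<^sub>a\<^bsub>C\<^esub> g) \<otimes>\<^sub>a\<^bsub>C\<^esub> h) = (f \<otimes>\<^sub>a\<^bsub>C\<^esub> (g \<otimes>\<^sub>a\<^bsub>C\<^esub> h)) \<cdot>\<^bsub>C\<^esub> Assoc C x y z"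
    and LUnit_hom: "x \<in> Obj C \<Longrightarrow> LUnit C x \<in> hom_set C (UnitO C \<otimes>\<^sub>o\<^bsub>C\<^esub> x) x"
    and LUnit_iso: "x \<in> Obj C \<Longrightarrow> iso_arrow C (LUnit C x)"
    and LUnit_natural: "f \<in> hom_set C x y
      \<Longrightarrow> LUnit C y \<cdot>\<^bsub>C\<^esub> (Id C (UnitO C) \<otimes>\<^sub>a\<^bsub>C\<^esub> f) = f \<cdot>\<^bsub>C\<^esub> LUnit C x"
    and RUnit_hom: "x \<in> Obj C \<Longrightarrow> RUnit C x \<in> hom_set C (x \<otimes>\<^sub>o\<^bsub>C\<^esub> UnitO C) x"
    and RUnit_iso: "x \<in> Obj C \<Longrightarrow> iso_arrow C (RUnit C x)"
    and RUnit_natural: "f \<in> hom_set C x y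
      \<Longrightarrow> RUnit C y \<cdot>\<^bsub>C\<^esub> (f \<otimes>\<^sub>a\<^bsub>C\<^esub> Id C (UnitO C)) = f \<cdot>\<^bsub>C\<^esub> RUnit C x"
    and pentagon: "\<lbrakk> w \<in> Obj C; x \<in> Obj C; y \<in> Obj C; z \<in> Obj C \<rbrakk>
      \<Longrightarrow> Assoc C w x (y \<otimes>\<^sub>o\<^bsub>C\<^esub> z) \<cdot>\<^bsub>C\<^esub> Assoc C (w \<otimes>\<^sub>o\<^bsub>C\<^esub> x) y z =
          (Id C w \<otimes>\<^sub>a\<^bsub>C\<^esub> Assoc C x y z) \<cdot>\<^bsub>C\<^esub> Assoc C w (x \<otimes>\<^sub>o\<^bsub>C\<^esub> y) z \<cdot>\<^bsub>C\<^esub>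
            (Assoc C w x y \<otimes>\<^sub>a\<^bsub>C\<^esub> Id C z)"
    and triangle: "\<lbrakk> x \<in> Obj C; y \<in> Obj C \<rbrakk>
      \<Longrightarrow> (Id C x \<otimes>\<^sub>a\<^bsub>C\<^esub> LUnit C y) \<cdot>\<^bsub>C\<^esub> Assoc C x (UnitO C) y = RUnit C x \<otimes>\<^sub>a\<^bsub>C\<^esub> Id C y"

text \<open>
  \<open>y\<close> is a left dual of \<open>x\<close> (equivalently, \<open>x\<close> is a right dual of \<open>y\<close>) with evaluation \<open>e\<close> and
  coevaluation \<open>d\<close>.
\<close>

definition dual_pair ::
  "('k, 'o, 'a, 'z) mon_cat_scheme \<Rightarrow> 'o \<Rightarrow> 'o \<Rightarrow> 'a \<Rightarrow> 'a \<Rightarrow> bool" where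
  "dual_pair C y x e d \<longleftrightarrow> x \<in> Obj C \<and> y \<in> Obj C \<and>
     e \<in> hom_set C (y \<otimes>\<^sub>o\<^bsub>C\<^esub> x) (UnitO C) \<and> d \<in> hom_set C (UnitO C) (x \<otimes>\<^sub>o\<^bsub>C\<^esub> y) \<and>
     RUnit C x \<cdot>\<^bsub>C\<^esub> (Id C x \<otimes>\<^sub>a\<^bsub>C\<^esub> e) \<cdot>\<^bsub>C\<^esub> Assoc C x y x \<cdot>\<^bsub>C\<^esub> (d \<otimes>\<^sub>a\<^bsub>C\<^esub> Id C x) \<cdot>\<^bsub>C\<^esub>
       inverse_arrow C (LUnit C x) = Id C x \<and>
     LUnit C y \<cdot>\<^bsub>C\<^esub> (e \<otimes>\<^sub>a\<^bsub>C\<^esub> Id C y) \<cdot>\<^bsub>C\<^esub> inverse_arrow C (Assoc C y x y) \<cdot>\<^bsub>C\<^esub>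
       (Id C y \<otimes>\<^sub>a\<^bsub>C\<^esub> d) \<cdot>\<^bsub>C\<^esub> inverse_arrow C (RUnit C y) = Id C y"

locale fusion_category = semisimple_category K C + linear_monoidal_category K C
  for K :: "('k, 'r) ring_scheme" (structure) and C :: "('k, 'o, 'a, 'z) mon_cat_scheme" +
  assumes fin_dim: "\<lbrakk> x \<in> Obj C; y \<in> Obj C \<rbrakk> \<Longrightarrow> fin_dim_hom K C x y"
    and finite_simples:
      "finite ({x. simple_object C x} // {(x, y). isomorphic C x y})"
    and simple_unit: "simple_object C (UnitO C)"
    and left_dual: "x \<in> Obj C \<Longrightarrow> \<exists>y e d. dual_pair C y x e d"
    and right_dual: "x \<in> Obj C \<Longrightarrow> \<exists>y e d. dual_pair C x y e d"


section \<open>Module categories\<close>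

record ('k, 'o, 'a, 'p, 'b) mod_cat = "('k, 'p, 'b) lin_cat" +
  ActO :: "'o \<Rightarrow> 'p \<Rightarrow> 'p"  (infixr "\<rhd>\<^sub>o\<index>" 75)
  ActA :: "'a \<Rightarrow> 'b \<Rightarrow> 'b"  (infixr "\<rhd>\<^sub>a\<index>" 75)
  MAssoc :: "'o \<Rightarrow> 'o \<Rightarrow> 'p \<Rightarrow> 'b"
  MUnit :: "'p \<Rightarrow> 'b"

locale module_category = C: linear_monoidal_category K C + M: linear_category K \<M>
  for K :: "('k, 'r) ring_scheme" (structure)
    and C :: "('k, 'o, 'a, 'z) mon_cat_scheme"
    and \<M> :: "('k, 'o, 'a, 'p, 'b, 'y) mod_cat_scheme" +
  assumes ActO_Obj: "\<lbrakk> x \<in> Obj C; m \<in> Obj \<M> \<rbrakk> \<Longrightarrow> x \<rhd>\<^sub>o\<^bsub>\<M>\<^esub> m \<in> Obj \<M>"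
    and ActA_hom: "\<lbrakk> f \<in> hom_set C x y; h \<in> hom_set \<M> m n \<rbrakk>
      \<Longrightarrow> f \<rhd>\<^sub>a\<^bsub>\<M>\<^esub> h \<in> hom_set \<M> (x \<rhd>\<^sub>o\<^bsub>\<M>\<^esub> m) (y \<rhd>\<^sub>o\<^bsub>\<M>\<^esub> n)"
    and ActA_Id: "\<lbrakk> x \<in> Obj C; m \<in> Obj \<M> \<rbrakk>
      \<Longrightarrow> Id C x \<rhd>\<^sub>a\<^bsub>\<M>\<^esub> Id \<M> m = Id \<M> (x \<rhd>\<^sub>o\<^bsub>\<M>\<^esub> m)"
    and ActA_Comp: "\<lbrakk> f \<in> hom_set C x y; g \<in> hom_set C y z; h \<in> hom_set \<M> l m; i \<in> hom_set \<M> m n \<rbrakk>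
      \<Longrightarrow> (g \<cdot>\<^bsub>C\<^esub> f) \<rhd>\<^sub>a\<^bsub>\<M>\<^esub> (i \<cdot>\<^bsub>\<M>\<^esub> h) = (g \<rhd>\<^sub>a\<^bsub>\<M>\<^esub> i) \<cdot>\<^bsub>\<M>\<^esub> (f \<rhd>\<^sub>a\<^bsub>\<M>\<^esub> h)"
    and ActA_add_left: "\<lbrakk> f \<in> hom_set C x y; g \<in> hom_set C x y; h \<in> hom_set \<M> m n \<rbrakk>
      \<Longrightarrow> Add_arr C f g \<rhd>\<^sub>a\<^bsub>\<M>\<^esub> h = Add_arr \<M> (f \<rhd>\<^sub>a\<^bsub>\<M>\<^esub> h) (g \<rhd>\<^sub>a\<^bsub>\<M>\<^esub> h)"
    and ActA_add_right: "\<lbrakk> f \<in> hom_set C x y; h \<in> hom_set \<M> m n; i \<in> hom_set \<M> m n \<rbrakk>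
      \<Longrightarrow> f \<rhd>\<^sub>a\<^bsub>\<M>\<^esub> Add_arr \<M> h i = Add_arr \<M> (f \<rhd>\<^sub>a\<^bsub>\<M>\<^esub> h) (f \<rhd>\<^sub>a\<^bsub>\<M>\<^esub> i)"
    and ActA_smult_left: "\<lbrakk> c \<in> carrier K; f \<in> hom_set C x y; h \<in> hom_set \<M> m n \<rbrakk>
      \<Longrightarrow> Smult_arr C c f \<rhd>\<^sub>a\<^bsub>\<M>\<^esub> h = Smult_arr \<M> c (f \<rhd>\<^sub>a\<^bsub>\<M>\<^esub> h)"
    and ActA_smult_right: "\<lbrakk> c \<in> carrier K; f \<in> hom_set C x y; h \<in> hom_set \<M> m n \<rbrakk>
      \<Longrightarrow> f \<rhd>\<^sub>a\<^bsub>\<M>\<^esub> Smult_arr \<M> c h = Smult_arr \<M> c (f \<rhd>\<^sub>a\<^bsub>\<M>\<^esub> h)"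
    and MAssoc_hom: "\<lbrakk> x \<in> Obj C; y \<in> Obj C; m \<in> Obj \<M> \<rbrakk>
      \<Longrightarrow> MAssoc \<M> x y m \<in> hom_set \<M> ((x \<otimes>\<^sub>o\<^bsub>C\<^esub> y) \<rhd>\<^sub>o\<^bsub>\<M>\<^esub> m) (x \<rhd>\<^sub>o\<^bsub>\<M>\<^esub> (y \<rhd>\<^sub>o\<^bsub>\<M>\<^esub> m))"
    and MAssoc_iso: "\<lbrakk> x \<in> Obj C; y \<in> Obj C; m \<in> Obj \<M> \<rbrakk> \<Longrightarrow> iso_arrow \<M> (MAssoc \<M> x y m)"
    and MAssoc_natural: "\<lbrakk> f \<in> hom_set C x x'; g \<in> hom_set C y y'; h \<in> hom_set \<M> m m' \<rbrakk>
      \<Longrightarrow> MAssoc \<M> x' y' m' \<cdot>\<^bsub>\<M>\<^esub> ((f \<otimes>\<^sub>a\<^bsub>C\<^esub> g) \<rhd>\<^sub>a\<^bsub>\<M>\<^esub> h) = (f \<rhd>\<^sub>a\<^bsub>\<M>\<^esub> (g \<rhd>\<^sub>a\<^bsub>\<M>\<^esub> h)) \<cdot>\<^bsub>\<M>\<^esub> MAssoc \<M> x y m"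
    and MUnit_hom: "m \<in> Obj \<M> \<Longrightarrow> MUnit \<M> m \<in> hom_set \<M> (UnitO C \<rhd>\<^sub>o\<^bsub>\<M>\<^esub> m) m"
    and MUnit_iso: "m \<in> Obj \<M> \<Longrightarrow> iso_arrow \<M> (MUnit \<M> m)"
    and MUnit_natural: "h \<in> hom_set \<M> m n
      \<Longrightarrow> MUnit \<M> n \<cdot>\<^bsub>\<M>\<^esub> (Id C (UnitO C) \<rhd>\<^sub>a\<^bsub>\<M>\<^esub> h) = h \<cdot>\<^bsub>\<M>\<^esub> MUnit \<M> m"
    and module_pentagon: "\<lbrakk> x \<in> Obj C; y \<in> Obj C; z \<in> Obj C; m \<in> Obj \<M> \<rbrakk>
      \<Longrightarrow> MAssoc \<M> x y (z \<rhd>\<^sub>o\<^bsub>\<M>\<^esub> m) \<cdot>\<^bsub>\<M>\<^esub> MAssoc \<M> (x \<otimes>\<^sub>o\<^bsub>C\<^esub> y) z m =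
          (Id C x \<rhd>\<^sub>a\<^bsub>\<M>\<^esub> MAssoc \<M> y z m) \<cdot>\<^bsub>\<M>\<^esub> MAssoc \<M> x (y \<otimes>\<^sub>o\<^bsub>C\<^esub> z) m \<cdot>\<^bsub>\<M>\<^esub>
            (Assoc C x y z \<rhd>\<^sub>a\<^bsub>\<M>\<^esub> Id \<M> m)"
    and module_triangle: "\<lbrakk> x \<in> Obj C; m \<in> Obj \<M> \<rbrakk>
      \<Longrightarrow> (Id C x \<rhd>\<^sub>a\<^bsub>\<M>\<^esub> MUnit \<M> m) \<cdot>\<^bsub>\<M>\<^esub> MAssoc \<M> x (UnitO C) m = RUnit C x \<rhd>\<^sub>a\<^bsub>\<M>\<^esub> Id \<M> m"

definition generates ::
  "('k, 'o, 'a, 'z) mon_cat_scheme \<Rightarrow> ('k, 'o, 'a, 'p, 'b, 'y) mod_cat_scheme \<Rightarrow> 'p \<Rightarrow> bool" where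
  "generates C \<M> M \<longleftrightarrow> M \<in> Obj \<M> \<and>
     (\<forall>N \<in> Obj \<M>. \<exists>X \<in> Obj C. \<exists>f \<in> hom_set \<M> (X \<rhd>\<^sub>o\<^bsub>\<M>\<^esub> M) N. epi_arrow \<M> f)"


section \<open>Algebras and their modules\<close>

record ('o, 'a) alg =
  ACarr :: 'o
  AMult :: 'a
  AUnit :: 'a

definition algebra_in :: "('k, 'o, 'a, 'z) mon_cat_scheme \<Rightarrow> ('o, 'a) alg \<Rightarrow> bool" where
  "algebra_in C A \<longleftrightarrow> ACarr A \<in> Obj C \<and>
     AMult A \<in> hom_set C (ACarr A \<otimes>\<^sub>o\<^bsub>C\<^esub> ACarr A) (ACarr A) \<and>
     AUnit A \<in> hom_set C (UnitO C) (ACarr A) \<and>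
     AMult A \<cdot>\<^bsub>C\<^esub> (AMult A \<otimes>\<^sub>a\<^bsub>C\<^esub> Id C (ACarr A)) =
       AMult A \<cdot>\<^bsub>C\<^esub> (Id C (ACarr A) \<otimes>\<^sub>a\<^bsub>C\<^esub> AMult A) \<cdot>\<^bsub>C\<^esub> Assoc C (ACarr A) (ACarr A) (ACarr A) \<and>
     AMult A \<cdot>\<^bsub>C\<^esub> (AUnit A \<otimes>\<^sub>a\<^bsub>C\<^esub> Id C (ACarr A)) = LUnit C (ACarr A) \<and>
     AMult A \<cdot>\<^bsub>C\<^esub> (Id C (ACarr A) \<otimes>\<^sub>a\<^bsub>C\<^esub> AUnit A) = RUnit C (ACarr A)"

definition right_module ::
  "('k, 'o, 'a, 'z) mon_cat_scheme \<Rightarrow> ('o, 'a) alg \<Rightarrow> 'o \<times> 'a \<Rightarrow> bool" where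
  "right_module C A = (\<lambda>(U, q). U \<in> Obj C \<and> q \<in> hom_set C (U \<otimes>\<^sub>o\<^bsub>C\<^esub> ACarr A) U \<and>
     q \<cdot>\<^bsub>C\<^esub> (q \<otimes>\<^sub>a\<^bsub>C\<^esub> Id C (ACarr A)) =
       q \<cdot>\<^bsub>C\<^esub> (Id C U \<otimes>\<^sub>a\<^bsub>C\<^esub> AMult A) \<cdot>\<^bsub>C\<^esub> Assoc C U (ACarr A) (ACarr A) \<and>
     q \<cdot>\<^bsub>C\<^esub> (Id C U \<otimes>\<^sub>a\<^bsub>C\<^esub> AUnit A) = RUnit C U)"

text \<open>
  The category \<open>Mod\<^sub>C(A)\<close> of right modules. An arrow is a triple of source module, underlying
  arrow of \<^term>\<open>C\<close> and target module, since the underlying arrow does not determine the modules.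
\<close>

definition Mod_cat ::
  "('k, 'o, 'a, 'z) mon_cat_scheme \<Rightarrow> ('o, 'a) alg \<Rightarrow>
   ('k, 'o \<times> 'a, ('o \<times> 'a) \<times> 'a \<times> ('o \<times> 'a)) lin_cat" where
  "Mod_cat C A =
     \<lparr>Obj = {S. right_module C A S},
      Arr = {(S, f, T). right_module C A S \<and> right_module C A T \<and>
               f \<in> hom_set C (fst S) (fst T) \<and>
               f \<cdot>\<^bsub>C\<^esub> snd S = snd T \<cdot>\<^bsub>C\<^esub> (f \<otimes>\<^sub>a\<^bsub>C\<^esub> Id C (ACarr A))},
      Dom = \<lambda>(S, f, T). S,
      Cod = \<lambda>(S, f, T). T,
      Id = \<lambda>S. (S, Id C (fst S), S),
      Comp = \<lambda>(T', g, R) (S, f, T). (S, g \<cdot>\<^bsub>C\<^esub> f, R),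
      Zero_arr = \<lambda>S T. (S, Zero_arr C (fst S) (fst T), T),
      Add_arr = \<lambda>(S, f, T) (S', g, T'). (S, Add_arr C f g, T),
      Smult_arr = \<lambda>c (S, f, T). (S, Smult_arr C c f, T)\<rparr>"

definition semisimple_algebra ::
  "('k, 'r) ring_scheme \<Rightarrow> ('k, 'o, 'a, 'z) mon_cat_scheme \<Rightarrow> ('o, 'a) alg \<Rightarrow> bool" where
  "semisimple_algebra K C A \<longleftrightarrow> algebra_in C A \<and> semisimple_category K (Mod_cat C A)"

text \<open>
  For a right module \<open>(U, q)\<close> in \<^term>\<open>C\<close> and a left module \<open>(N, p)\<close> in \<^term>\<open>\<M>\<close>, the projection
  \<open>U \<otimes> N \<rightarrow> U \<otimes>\<^sub>A N\<close> is a chosen cokernel; the object \<open>U \<otimes>\<^sub>A N\<close> is its codomain.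
\<close>

definition rel_tensor_proj ::
  "('k, 'o, 'a, 'p, 'b, 'y) mod_cat_scheme \<Rightarrow> ('k, 'o, 'a, 'z) mon_cat_scheme \<Rightarrow> ('o, 'a) alg \<Rightarrow>
   'p \<times> 'b \<Rightarrow> 'o \<times> 'a \<Rightarrow> 'b" where
  "rel_tensor_proj \<M> C A = (\<lambda>(N, p) (U, q). cokernel_arrow \<M>
     ((q \<rhd>\<^sub>a\<^bsub>\<M>\<^esub> Id \<M> N)
       \<ominus>\<^bsub>hom_space \<M> ((U \<otimes>\<^sub>o\<^bsub>C\<^esub> ACarr A) \<rhd>\<^sub>o\<^bsub>\<M>\<^esub> N) (U \<rhd>\<^sub>o\<^bsub>\<M>\<^esub> N)\<^esub>
      ((Id C U \<rhd>\<^sub>a\<^bsub>\<M>\<^esub> p) \<cdot>\<^bsub>\<M>\<^esub> MAssoc \<M> U (ACarr A) N)))"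

definition rel_tensor ::
  "('k, 'o, 'a, 'p, 'b, 'y) mod_cat_scheme \<Rightarrow> ('k, 'o, 'a, 'z) mon_cat_scheme \<Rightarrow> ('o, 'a) alg \<Rightarrow>
   'p \<times> 'b \<Rightarrow> 'o \<times> 'a \<Rightarrow> 'p" where
  "rel_tensor \<M> C A L S = Cod \<M> (rel_tensor_proj \<M> C A L S)"

definition rel_tensor_funct ::
  "('k, 'o, 'a, 'p, 'b, 'y) mod_cat_scheme \<Rightarrow> ('k, 'o, 'a, 'z) mon_cat_scheme \<Rightarrow> ('o, 'a) alg \<Rightarrow>
   'p \<times> 'b \<Rightarrow> ('o \<times> 'a, ('o \<times> 'a) \<times> 'a \<times> ('o \<times> 'a), 'p, 'b) funct" where
  "rel_tensor_funct \<M> C A L =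
     \<lparr>FObj = rel_tensor \<M> C A L,
      FArr = \<lambda>(S, f, T). THE g. g \<in> hom_set \<M> (rel_tensor \<M> C A L S) (rel_tensor \<M> C A L T) \<and>
        g \<cdot>\<^bsub>\<M>\<^esub> rel_tensor_proj \<M> C A L S = rel_tensor_proj \<M> C A L T \<cdot>\<^bsub>\<M>\<^esub> (f \<rhd>\<^sub>a\<^bsub>\<M>\<^esub> Id \<M> (fst L))\<rparr>"


section \<open>Internal Homs\<close>

text \<open>
  \<open>H\<close> and \<open>\<phi>\<close> represent the functor \<open>X \<mapsto> Hom(X \<otimes> M\<^sub>1, M\<^sub>2)\<close> on \<^term>\<open>C\<close>: \<open>\<phi> X\<close> is a bijection from
  \<open>Hom(X, H)\<close> onto \<open>Hom(X \<otimes> M\<^sub>1, M\<^sub>2)\<close>, natural in \<open>X\<close>. (Linearity of \<open>\<phi> X\<close> is automatic by Yoneda.)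
\<close>

definition represents_internal_hom ::
  "('k, 'o, 'a, 'z) mon_cat_scheme \<Rightarrow> ('k, 'o, 'a, 'p, 'b, 'y) mod_cat_scheme \<Rightarrow>
   'p \<Rightarrow> 'p \<Rightarrow> 'o \<Rightarrow> ('o \<Rightarrow> 'a \<Rightarrow> 'b) \<Rightarrow> bool" where
  "represents_internal_hom C \<M> M1 M2 H \<phi> \<longleftrightarrow> H \<in> Obj C \<and>
     (\<forall>X \<in> Obj C. bij_betw (\<phi> X) (hom_set C X H) (hom_set \<M> (X \<rhd>\<^sub>o\<^bsub>\<M>\<^esub> M1) M2)) \<and>
     (\<forall>X \<in> Obj C. \<forall>Y \<in> Obj C. \<forall>f \<in> hom_set C X Y. \<forall>g \<in> hom_set C Y H.
        \<phi> X (g \<cdot>\<^bsub>C\<^esub> f) = \<phi> Y g \<cdot>\<^bsub>\<M>\<^esub> (f \<rhd>\<^sub>a\<^bsub>\<M>\<^esub> Id \<M> M1))"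

text \<open>
  A choice of internal Homs for all pairs of objects: \<^term>\<open>IHom I M1 M2\<close> is the representing
  object and \<^term>\<open>Rep I M1 M2\<close> the representing natural bijection.
\<close>

record ('o, 'a, 'p, 'b) ihoms =
  IHom :: "'p \<Rightarrow> 'p \<Rightarrow> 'o"
  Rep :: "'p \<Rightarrow> 'p \<Rightarrow> 'o \<Rightarrow> 'a \<Rightarrow> 'b"

definition internal_homs ::
  "('k, 'o, 'a, 'z) mon_cat_scheme \<Rightarrow> ('k, 'o, 'a, 'p, 'b, 'y) mod_cat_scheme \<Rightarrow>
   ('o, 'a, 'p, 'b) ihoms \<Rightarrow> bool" where
  "internal_homs C \<M> I \<longleftrightarrow> (\<forall>M1 \<in> Obj \<M>. \<forall>M2 \<in> Obj \<M>.
     represents_internal_hom C \<M> M1 M2 (IHom I M1 M2) (Rep I M1 M2))"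

text \<open>The arrow \<open>X \<rightarrow> IHom I M\<^sub>1 M\<^sub>2\<close> corresponding to \<open>f : X \<otimes> M\<^sub>1 \<rightarrow> M\<^sub>2\<close>.\<close>

definition ihom_transpose ::
  "('k, 'o, 'a, 'z) mon_cat_scheme \<Rightarrow> ('o, 'a, 'p, 'b) ihoms \<Rightarrow> 'p \<Rightarrow> 'p \<Rightarrow> 'o \<Rightarrow> 'b \<Rightarrow> 'a" where
  "ihom_transpose C I M1 M2 X f = the_inv_into (hom_set C X (IHom I M1 M2)) (Rep I M1 M2 X) f"

definition ihom_ev ::
  "('k, 'o, 'a, 'z) mon_cat_scheme \<Rightarrow> ('o, 'a, 'p, 'b) ihoms \<Rightarrow> 'p \<Rightarrow> 'p \<Rightarrow> 'b" where
  "ihom_ev C I M1 M2 = Rep I M1 M2 (IHom I M1 M2) (Id C (IHom I M1 M2))"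

definition ihom_mu ::
  "('k, 'o, 'a, 'z) mon_cat_scheme \<Rightarrow> ('k, 'o, 'a, 'p, 'b, 'y) mod_cat_scheme \<Rightarrow>
   ('o, 'a, 'p, 'b) ihoms \<Rightarrow> 'p \<Rightarrow> 'p \<Rightarrow> 'p \<Rightarrow> 'a" where
  "ihom_mu C \<M> I M1 M2 M3 =
     ihom_transpose C I M1 M3 (IHom I M2 M3 \<otimes>\<^sub>o\<^bsub>C\<^esub> IHom I M1 M2)
       (ihom_ev C I M2 M3 \<cdot>\<^bsub>\<M>\<^esub> (Id C (IHom I M2 M3) \<rhd>\<^sub>a\<^bsub>\<M>\<^esub> ihom_ev C I M1 M2) \<cdot>\<^bsub>\<M>\<^esub>
          MAssoc \<M> (IHom I M2 M3) (IHom I M1 M2) M1)"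

text \<open>The unit of the algebra corresponds to the unit constraint \<open>1 \<otimes> M \<rightarrow> M\<close>.\<close>

definition ihom_alg ::
  "('k, 'o, 'a, 'z) mon_cat_scheme \<Rightarrow> ('k, 'o, 'a, 'p, 'b, 'y) mod_cat_scheme \<Rightarrow>
   ('o, 'a, 'p, 'b) ihoms \<Rightarrow> 'p \<Rightarrow> ('o, 'a) alg" where
  "ihom_alg C \<M> I M =
     \<lparr>ACarr = IHom I M M, AMult = ihom_mu C \<M> I M M M,
      AUnit = ihom_transpose C I M M (UnitO C) (MUnit \<M> M)\<rparr>"

definition ihom_module ::
  "('k, 'o, 'a, 'z) mon_cat_scheme \<Rightarrow> ('k, 'o, 'a, 'p, 'b, 'y) mod_cat_scheme \<Rightarrow>
   ('o, 'a, 'p, 'b) ihoms \<Rightarrow> 'p \<Rightarrow> 'p \<Rightarrow> 'o \<times> 'a" where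
  "ihom_module C \<M> I M V = (IHom I M V, ihom_mu C \<M> I M M V)"

definition ihom_funct ::
  "('k, 'o, 'a, 'z) mon_cat_scheme \<Rightarrow> ('k, 'o, 'a, 'p, 'b, 'y) mod_cat_scheme \<Rightarrow>
   ('o, 'a, 'p, 'b) ihoms \<Rightarrow> 'p \<Rightarrow> ('p, 'b, 'o \<times> 'a, ('o \<times> 'a) \<times> 'a \<times> ('o \<times> 'a)) funct" where
  "ihom_funct C \<M> I M =
     \<lparr>FObj = ihom_module C \<M> I M,
      FArr = \<lambda>h. (ihom_module C \<M> I M (Dom \<M> h),
                  ihom_transpose C I M (Cod \<M> h) (IHom I M (Dom \<M> h))
                    (h \<cdot>\<^bsub>\<M>\<^esub> ihom_ev C I M (Dom \<M> h)),
                  ihom_module C \<M> I M (Cod \<M> h))\<rparr>"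

end

theory Submission
  imports Defs
begin

text \<open>
  The functor \<open>\<bullet> \<otimes> M : C \<rightarrow> \<M>\<close> has the right adjoint \<open>H = Hom(M, \<bullet>)\<close>, and rigidity of \<open>C\<close> identifies the
  monad \<open>X \<mapsto> H (X \<otimes> M)\<close> of this adjunction with \<open>X \<mapsto> X \<otimes> A\<close>, whose algebras are the right
  \<open>A\<close>-modules. The theorem says that the adjunction is monadic, and it holds because in a semisimple
  category cokernels are absolute, that is, preserved by every additive functor.

  The source of all splittings is von Neumann regularity: in a semisimple category every arrow \<open>f\<close> has
  some \<open>g\<close> with \<open>f g f = f\<close> (\<open>semisimple_von_neumann_regular\<close>, by Gaussian elimination with Schur's
  lemma). In particular epimorphisms split, so a generator \<open>M\<close> makes every \<open>V\<close> a retract of some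
  \<open>X \<otimes> M\<close>.

  Rigidity enters through the arrows \<open>act X : (X \<otimes> A) \<otimes> M \<rightarrow> X \<otimes> M\<close>: every arrow
  \<open>Y \<otimes> M \<rightarrow> X \<otimes> M\<close> is \<open>act X \<cdot> (t \<otimes> M)\<close> for exactly one \<open>t : Y \<rightarrow> X \<otimes> A\<close> (\<open>act_surj\<close>, \<open>act_inj\<close>). The
  proof transposes along a duality twice, in \<open>\<M>\<close> and in \<open>C\<close> as a module category over itself.

  Counit: the evaluation \<open>H V \<otimes> M \<rightarrow> V\<close> is a cokernel of the difference of the two actions of \<open>A\<close>
  (\<open>ev_coequalizer\<close>), hence \<open>H V \<otimes>\<^sub>A M \<cong> V\<close>. A retraction of \<open>X \<otimes> M\<close> onto \<open>V\<close> lifts to one of \<open>X \<otimes> A\<close>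
  onto \<open>H V\<close>, and this splits the fork. Unit: for a right module \<open>(U, q)\<close> the transpose
  \<open>\<eta> : U \<rightarrow> H (U \<otimes>\<^sub>A M)\<close> of the projection is invertible (\<open>eta_iso\<close>). Regularity of the difference of
  the actions splits the projection, and lifting the splitting along \<open>act U\<close> gives the inverse of
  \<open>\<eta>\<close>. In effect \<open>H\<close> preserves the cokernel that presents \<open>U \<otimes>\<^sub>A M\<close>.

  Finally, semisimplicity of the module category is transported along the equivalence
  (\<open>quasi_inverse_semisimple\<close>). For this, being abelian is reduced to regularity and the splitting of
  idempotents, and simplicity of an object to the absence of nontrivial idempotent endomorphisms
  (\<open>simple_object_iff_idempotents\<close>), and these conditions pass through an equivalence directly. The
  last reduction also gives the statements about simple objects.
\<close>

section \<open>Composition and inverses\<close>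

lemma in_hom_iff: "f \<in> hom_set C x y \<longleftrightarrow> f \<in> Arr C \<and> Dom C f = x \<and> Cod C f = y"
  by (simp add: hom_set_def)

context category
begin

abbreviation comp (infixr "\<star>" 65) where "g \<star> f \<equiv> Comp C g f"
abbreviation Hom where "Hom \<equiv> hom_set C"

lemma Id_simps [simp]:
  assumes "x \<in> Obj C"
  shows "Id C x \<in> Arr C" "Dom C (Id C x) = x" "Cod C (Id C x) = x"
  using Id_hom[OF assms] by (auto simp: in_hom_iff)

lemma Dom_Cod_Obj [simp]:
  assumes "f \<in> Arr C"
  shows "Dom C f \<in> Obj C" "Cod C f \<in> Obj C"
  using assms Dom_Obj Cod_Obj by auto

lemma Comp_simps [simp]:
  assumes "f \<in> Arr C" "g \<in> Arr C" "Cod C f = Dom C g"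
  shows "g \<star> f \<in> Arr C" "Dom C (g \<star> f) = Dom C f" "Cod C (g \<star> f) = Cod C g"
  using Comp_hom[of f "Dom C f" "Cod C f" g "Cod C g"] assms by (auto simp: in_hom_iff)

lemma Comp_assoc_simp [simp]:
  assumes "f \<in> Arr C" "g \<in> Arr C" "h \<in> Arr C" "Cod C f = Dom C g" "Cod C g = Dom C h"
  shows "(h \<star> g) \<star> f = h \<star> g \<star> f"
  using assms by (intro Comp_assoc) (auto simp: in_hom_iff)

lemma Comp_Id_simps [simp]:
  shows "\<lbrakk>f \<in> Arr C; Cod C f = x\<rbrakk> \<Longrightarrow> Id C x \<star> f = f"
    and "\<lbrakk>f \<in> Arr C; Dom C f = x\<rbrakk> \<Longrightarrow> f \<star> Id C x = f"
  by (auto intro: Comp_Id_left Comp_Id_right simp: in_hom_iff)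

text \<open>
  An equation between two composites may be applied in front of a longer composite; in
  right-associated form this needs a rule.
\<close>

lemma Comp_eq_prefix:
  assumes "g \<star> f = g' \<star> f'"
    and "f \<in> Arr C" "g \<in> Arr C" "Cod C f = Dom C g"
    and "f' \<in> Arr C" "g' \<in> Arr C" "Cod C f' = Dom C g'"
    and "h \<in> Arr C" "Cod C h = Dom C f" "Cod C h = Dom C f'"
  shows "g \<star> f \<star> h = g' \<star> f' \<star> h"
  using assms by (metis Comp_assoc_simp)

lemma Comp_eq_prefix1:
  assumes "g \<star> f = k"
    and "f \<in> Arr C" "g \<in> Arr C" "Cod C f = Dom C g" "h \<in> Arr C" "Cod C h = Dom C f"
  shows "g \<star> f \<star> h = k \<star> h"
  using assms by (metis Comp_assoc_simp)

lemma inverse_arrows_unique: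
  assumes "inverse_arrows C f g" "inverse_arrows C f h"
  shows "g = h"
proof -
  have "g \<star> f \<star> h = (g \<star> f) \<star> h"
    using assms by (subst Comp_assoc_simp) (auto simp: inverse_arrows_def in_hom_iff)
  then show ?thesis
    using assms by (auto simp: inverse_arrows_def in_hom_iff)
qed

lemma inverse_arrows_inverse_arrow: "iso_arrow C f \<Longrightarrow> inverse_arrows C f (inverse_arrow C f)"
  unfolding iso_arrow_def inverse_arrow_def
  by (metis inverse_arrows_unique theI')

lemma iso_arrow_Arr: "iso_arrow C f \<Longrightarrow> f \<in> Arr C"
  by (auto simp: iso_arrow_def inverse_arrows_def)

lemma inverse_arrow_simps [simp]:
  assumes "iso_arrow C f"
  shows "inverse_arrow C f \<in> Arr C" "Dom C (inverse_arrow C f) = Cod C f"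
    "Cod C (inverse_arrow C f) = Dom C f"
    "inverse_arrow C f \<star> f = Id C (Dom C f)" "f \<star> inverse_arrow C f = Id C (Cod C f)"
  using inverse_arrows_inverse_arrow[OF assms] by (auto simp: inverse_arrows_def in_hom_iff)

lemma inverse_arrow_cancel [simp]:
  assumes "iso_arrow C f" "g \<in> Arr C"
  shows "Cod C g = Dom C f \<Longrightarrow> inverse_arrow C f \<star> f \<star> g = g"
    and "Cod C g = Cod C f \<Longrightarrow> f \<star> inverse_arrow C f \<star> g = g"
  using assms iso_arrow_Arr[OF assms(1)] by (auto simp flip: Comp_assoc_simp)

lemma iso_arrowI:
  assumes "f \<in> Arr C" "g \<in> Arr C" "Dom C g = Cod C f" "Cod C g = Dom C f"
    and "g \<star> f = Id C (Dom C f)" "f \<star> g = Id C (Cod C f)"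
  shows "iso_arrow C f"
  using assms by (auto simp: iso_arrow_def inverse_arrows_def in_hom_iff)

lemma iso_arrow_inverse [simp]: "iso_arrow C f \<Longrightarrow> iso_arrow C (inverse_arrow C f)"
  by (rule iso_arrowI[where g = f]) (auto simp: iso_arrow_Arr)

lemma iso_arrow_Id [simp]: "x \<in> Obj C \<Longrightarrow> iso_arrow C (Id C x)"
  by (rule iso_arrowI[where g = "Id C x"]) auto

lemma iso_arrow_Comp [simp]:
  assumes "iso_arrow C f" "iso_arrow C g" "Cod C f = Dom C g"
  shows "iso_arrow C (g \<star> f)"
  using assms
  by (intro iso_arrowI[where g = "inverse_arrow C f \<star> inverse_arrow C g"])
     (auto simp: iso_arrow_Arr)

lemma iso_cancel_left:
  assumes "iso_arrow C f" "f \<star> g = f \<star> h"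
    and "g \<in> Arr C" "h \<in> Arr C" "Cod C g = Dom C f" "Cod C h = Dom C f"
  shows "g = h"
  using assms by (metis inverse_arrow_cancel(1))

lemma iso_cancel_right:
  assumes "iso_arrow C f" "g \<star> f = h \<star> f"
    and "g \<in> Arr C" "h \<in> Arr C" "Dom C g = Cod C f" "Dom C h = Cod C f"
  shows "g = h"
proof -
  have "(g \<star> f) \<star> inverse_arrow C f = (h \<star> f) \<star> inverse_arrow C f"
    using assms(2) by simp
  then show ?thesis
    using assms(1,3-) by (simp add: iso_arrow_Arr)
qed

lemma inverse_square:
  assumes "iso_arrow C a" "iso_arrow C b" "f \<in> Arr C" "g \<in> Arr C"
    and "Dom C f = Dom C a" "Cod C f = Dom C b" "Dom C g = Cod C a" "Cod C g = Cod C b"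
    and eq: "g \<star> a = b \<star> f"
  shows "f \<star> inverse_arrow C a = inverse_arrow C b \<star> g"
proof -
  note [simp] = assms(1-8) iso_arrow_Arr
  have "f \<star> inverse_arrow C a = inverse_arrow C b \<star> (b \<star> f) \<star> inverse_arrow C a"
    by simp
  also have "\<dots> = inverse_arrow C b \<star> g"
    unfolding eq[symmetric] by simp
  finally show ?thesis .
qed

lemma isomorphicI: "\<lbrakk>f \<in> Hom x y; iso_arrow C f\<rbrakk> \<Longrightarrow> isomorphic C x y"
  by (auto simp: isomorphic_def in_hom_iff)

end


section \<open>Hom spaces\<close>

lemma hom_space_simps [simp]:
  "carrier (hom_space C x y) = hom_set C x y" "zero (hom_space C x y) = Zero_arr C x y"
  "add (hom_space C x y) = Add_arr C" "smult (hom_space C x y) = Smult_arr C"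
  by (simp_all add: hom_space_def)

lemma additive_zero:
  assumes "abelian_group G" "abelian_group H" "h \<in> carrier G \<rightarrow> carrier H"
    and "\<And>x y. \<lbrakk>x \<in> carrier G; y \<in> carrier G\<rbrakk> \<Longrightarrow> h (x \<oplus>\<^bsub>G\<^esub> y) = h x \<oplus>\<^bsub>H\<^esub> h y"
  shows "h \<zero>\<^bsub>G\<^esub> = \<zero>\<^bsub>H\<^esub>"
proof -
  interpret G: abelian_group G by fact
  interpret H: abelian_group H by fact
  have "h \<zero>\<^bsub>G\<^esub> \<oplus>\<^bsub>H\<^esub> h \<zero>\<^bsub>G\<^esub> = h \<zero>\<^bsub>G\<^esub>"
    using assms(4)[of "\<zero>\<^bsub>G\<^esub>" "\<zero>\<^bsub>G\<^esub>"] by simp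
  moreover have "h \<zero>\<^bsub>G\<^esub> \<in> carrier H"
    using assms(3) by auto
  ultimately show ?thesis
    by (metis H.add.r_cancel_one')
qed

lemma additive_finsum:
  assumes "abelian_group G" "abelian_group H" "h \<in> carrier G \<rightarrow> carrier H"
    and "\<And>x y. \<lbrakk>x \<in> carrier G; y \<in> carrier G\<rbrakk> \<Longrightarrow> h (x \<oplus>\<^bsub>G\<^esub> y) = h x \<oplus>\<^bsub>H\<^esub> h y"
    and "finite A" "f \<in> A \<rightarrow> carrier G"
  shows "h (\<Oplus>\<^bsub>G\<^esub>i\<in>A. f i) = (\<Oplus>\<^bsub>H\<^esub>i\<in>A. h (f i))"
proof -
  interpret G: abelian_group G by fact
  interpret H: abelian_group H by fact
  show ?thesis
    using assms(5,6)
  proof (induction A rule: finite_induct)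
    case empty
    show ?case
      using additive_zero[OF assms(1-4)] by simp
  next
    case (insert a A)
    then show ?case
      using assms(3,4) by (subst G.finsum_insert H.finsum_insert; auto simp: Pi_iff)+
  qed
qed

context linear_category
begin

lemma hom_abelian_group: "\<lbrakk>x \<in> Obj C; y \<in> Obj C\<rbrakk> \<Longrightarrow> abelian_group (hom_space C x y)"
  using hom_module by (auto simp: module_def)

lemma Zero_arr_simps [simp]:
  assumes "x \<in> Obj C" "y \<in> Obj C"
  shows "Zero_arr C x y \<in> Arr C" "Dom C (Zero_arr C x y) = x" "Cod C (Zero_arr C x y) = y"
  using abelian_groupE(2)[OF hom_abelian_group[OF assms]] by (auto simp: in_hom_iff)

lemma Add_arr_simps [simp]:
  assumes "f \<in> Arr C" "g \<in> Arr C" "Dom C f = Dom C g" "Cod C f = Cod C g"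
  shows "Add_arr C f g \<in> Arr C" "Dom C (Add_arr C f g) = Dom C g" "Cod C (Add_arr C f g) = Cod C g"
proof -
  interpret G: abelian_group "hom_space C (Dom C g) (Cod C g)"
    using assms by (intro hom_abelian_group) auto
  have "Add_arr C f g \<in> Hom (Dom C g) (Cod C g)"
    using assms G.a_closed[of f g] by (auto simp: in_hom_iff)
  then show "Add_arr C f g \<in> Arr C" "Dom C (Add_arr C f g) = Dom C g"
    "Cod C (Add_arr C f g) = Cod C g"
    by (auto simp: in_hom_iff)
qed

lemma Smult_arr_simps [simp]:
  assumes "c \<in> carrier K" "f \<in> Arr C"
  shows "Smult_arr C c f \<in> Arr C" "Dom C (Smult_arr C c f) = Dom C f"
    "Cod C (Smult_arr C c f) = Cod C f"
proof -
  interpret G: module K "hom_space C (Dom C f) (Cod C f)"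
    using assms by (intro hom_module) auto
  have "Smult_arr C c f \<in> Hom (Dom C f) (Cod C f)"
    using assms G.smult_closed[of c f] by (auto simp: in_hom_iff)
  then show "Smult_arr C c f \<in> Arr C" "Dom C (Smult_arr C c f) = Dom C f"
    "Cod C (Smult_arr C c f) = Cod C f"
    by (auto simp: in_hom_iff)
qed

lemma Comp_Add:
  assumes "f \<in> Arr C" "g \<in> Arr C" "h \<in> Arr C" "Dom C f = Dom C g" "Cod C f = Cod C g"
  shows "Cod C h = Dom C g \<Longrightarrow> Add_arr C f g \<star> h = Add_arr C (f \<star> h) (g \<star> h)"
    and "Dom C h = Cod C g \<Longrightarrow> h \<star> Add_arr C f g = Add_arr C (h \<star> f) (h \<star> g)"
  using assms Comp_add_left[of h "Dom C h" "Cod C h" f "Cod C g" g]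
    Comp_add_right[of f "Dom C g" "Cod C g" g h "Cod C h"] by (auto simp: in_hom_iff)

lemma Comp_Smult:
  assumes "f \<in> Arr C" "g \<in> Arr C" "Cod C f = Dom C g" "c \<in> carrier K"
  shows "Smult_arr C c g \<star> f = Smult_arr C c (g \<star> f)"
    and "g \<star> Smult_arr C c f = Smult_arr C c (g \<star> f)"
  using assms Comp_smult_left[of c f "Dom C f" "Cod C f" g "Cod C g"]
    Comp_smult_right[of c f "Dom C f" "Cod C f" g "Cod C g"] by (auto simp: in_hom_iff)

lemma Comp_Zero [simp]:
  assumes "f \<in> Arr C" "x \<in> Obj C"
  shows "Cod C f = y \<Longrightarrow> Zero_arr C y x \<star> f = Zero_arr C (Dom C f) x"
    and "Dom C f = y \<Longrightarrow> f \<star> Zero_arr C x y = Zero_arr C x (Cod C f)"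
proof -
  show "Zero_arr C y x \<star> f = Zero_arr C (Dom C f) x" if "Cod C f = y"
    using additive_zero[of "hom_space C y x" "hom_space C (Dom C f) x" "\<lambda>g. g \<star> f"] assms that
    by (auto simp: hom_abelian_group Comp_Add in_hom_iff)
  show "f \<star> Zero_arr C x y = Zero_arr C x (Cod C f)" if "Dom C f = y"
    using additive_zero[of "hom_space C x y" "hom_space C x (Cod C f)" "\<lambda>g. f \<star> g"] assms that
    by (auto simp: hom_abelian_group Comp_Add in_hom_iff)
qed

lemma Add_Zero [simp]:
  assumes "f \<in> Arr C" "Dom C f = x" "Cod C f = y"
  shows "Add_arr C (Zero_arr C x y) f = f" "Add_arr C f (Zero_arr C x y) = f"
proof -
  interpret G: abelian_group "hom_space C x y"
    using assms by (intro hom_abelian_group) auto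
  show "Add_arr C (Zero_arr C x y) f = f" "Add_arr C f (Zero_arr C x y) = f"
    using assms G.l_zero[of f] G.r_zero[of f] by (auto simp: in_hom_iff)
qed

lemma Add_commute: "\<lbrakk>f \<in> Hom x y; g \<in> Hom x y\<rbrakk> \<Longrightarrow> Add_arr C f g = Add_arr C g f"
  using abelian_groupE(4)[OF hom_abelian_group[of x y], of f g] by (auto simp: in_hom_iff)

lemma Add_cancel_right:
  assumes "Add_arr C f h = Add_arr C g h"
    and "f \<in> Hom x y" "g \<in> Hom x y" "h \<in> Hom x y"
  shows "f = g"
proof -
  interpret G: abelian_group "hom_space C x y"
    using assms by (intro hom_abelian_group) (auto simp: in_hom_iff)
  show ?thesis
    using assms G.add.right_cancel[of h f g] by simp
qed

lemma Add_minus: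
  assumes "f \<in> Hom x y" "g \<in> Hom x y"
  shows "f \<ominus>\<^bsub>hom_space C x y\<^esub> g \<in> Hom x y" "Add_arr C (f \<ominus>\<^bsub>hom_space C x y\<^esub> g) g = f"
proof -
  interpret G: abelian_group "hom_space C x y"
    using assms by (intro hom_abelian_group) (auto simp: in_hom_iff)
  show "f \<ominus>\<^bsub>hom_space C x y\<^esub> g \<in> Hom x y"
    using assms G.minus_closed[of f g] by simp
  then show "Add_arr C (f \<ominus>\<^bsub>hom_space C x y\<^esub> g) g = f"
    using assms by (metis G.add.inv_solve_right' G.minus_eq hom_space_simps(1,3))
qed

text \<open>
  Complements replace negatives below: \<open>1 - g f\<close> appears as an arrow \<open>a\<close> with \<open>a + g f = 1\<close>.
\<close>

lemma Add_solve:
  assumes "f \<in> Hom x y" "g \<in> Hom x y"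
  obtains h where "h \<in> Hom x y" "Add_arr C h g = f"
  using Add_minus[OF assms] that by blast

lemma Comp_minus_eq_Zero_iff:
  assumes "f \<in> Hom x y" "g \<in> Hom x y" "h \<in> Hom y z"
  shows "h \<star> (f \<ominus>\<^bsub>hom_space C x y\<^esub> g) = Zero_arr C x z \<longleftrightarrow> h \<star> f = h \<star> g"
proof -
  define d where "d = f \<ominus>\<^bsub>hom_space C x y\<^esub> g"
  have d: "d \<in> Hom x y" "f = Add_arr C d g"
    using Add_minus[OF assms(1,2)] by (simp_all add: d_def)
  have hf: "h \<star> f = Add_arr C (h \<star> d) (h \<star> g)"
    using assms(2,3) d by (auto simp: in_hom_iff Comp_Add)
  have z: "h \<star> g = Add_arr C (Zero_arr C x z) (h \<star> g)"
    using assms by (auto simp: in_hom_iff)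
  have "h \<star> f = h \<star> g \<longleftrightarrow> h \<star> d = Zero_arr C x z"
    unfolding hf using z
    by (metis Add_cancel_right[of "h \<star> d" "h \<star> g" "Zero_arr C x z" x z] Comp_hom assms d(1)
        abelian_groupE(2)[OF hom_abelian_group] Dom_Cod_Obj in_hom_iff hom_space_simps(1,2))
  then show ?thesis
    by (simp add: d_def)
qed

lemma Comp_finsum:
  assumes "finite A" "f \<in> A \<rightarrow> Hom x y" "x \<in> Obj C" "y \<in> Obj C"
  shows "h \<in> Hom y z \<Longrightarrow>
      h \<star> (\<Oplus>\<^bsub>hom_space C x y\<^esub>i\<in>A. f i) = (\<Oplus>\<^bsub>hom_space C x z\<^esub>i\<in>A. h \<star> f i)"
    and "h \<in> Hom z x \<Longrightarrow>
      (\<Oplus>\<^bsub>hom_space C x y\<^esub>i\<in>A. f i) \<star> h = (\<Oplus>\<^bsub>hom_space C z y\<^esub>i\<in>A. f i \<star> h)"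
proof -
  assume h: "h \<in> Hom y z"
  show "h \<star> (\<Oplus>\<^bsub>hom_space C x y\<^esub>i\<in>A. f i) = (\<Oplus>\<^bsub>hom_space C x z\<^esub>i\<in>A. h \<star> f i)"
    using assms h
    by (intro additive_finsum hom_abelian_group) (auto simp: in_hom_iff Comp_Add)
next
  assume h: "h \<in> Hom z x"
  show "(\<Oplus>\<^bsub>hom_space C x y\<^esub>i\<in>A. f i) \<star> h = (\<Oplus>\<^bsub>hom_space C z y\<^esub>i\<in>A. f i \<star> h)"
    using assms h
    by (intro additive_finsum hom_abelian_group) (auto simp: in_hom_iff Comp_Add)
qed

lemma finsum_cong_hom:
  assumes "\<And>i. i \<in> A \<Longrightarrow> f i = g i" "g \<in> A \<rightarrow> Hom x y" "x \<in> Obj C" "y \<in> Obj C"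
  shows "(\<Oplus>\<^bsub>hom_space C x y\<^esub>i\<in>A. f i) = (\<Oplus>\<^bsub>hom_space C x y\<^esub>i\<in>A. g i)"
proof -
  interpret G: abelian_group "hom_space C x y"
    using assms by (intro hom_abelian_group)
  show ?thesis
    using assms by (intro G.finsum_cong') (auto simp: Pi_iff)
qed

lemma finsum_Zero:
  assumes "\<And>i. i \<in> A \<Longrightarrow> f i = Zero_arr C x y" "x \<in> Obj C" "y \<in> Obj C"
  shows "(\<Oplus>\<^bsub>hom_space C x y\<^esub>i\<in>A. f i) = Zero_arr C x y"
proof -
  interpret G: abelian_group "hom_space C x y"
    using assms by (intro hom_abelian_group)
  show ?thesis
    using G.add.finprod_one_eqI[of A f] assms(1) by simp
qed

lemma zero_object_iff: "zero_object C z \<longleftrightarrow> z \<in> Obj C \<and> Id C z = Zero_arr C z z"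
proof
  assume "zero_object C z"
  then show "z \<in> Obj C \<and> Id C z = Zero_arr C z z"
    unfolding zero_object_def by (metis Id_hom Zero_arr_simps in_hom_iff)
next
  assume z: "z \<in> Obj C \<and> Id C z = Zero_arr C z z"
  have "f = Zero_arr C z x" if "f \<in> Hom z x" for f x
    using that z Comp_Id_right[OF that] by (auto simp: in_hom_iff)
  moreover have "f = Zero_arr C x z" if "f \<in> Hom x z" for f x
    using that z Comp_Id_left[OF that] by (auto simp: in_hom_iff)
  ultimately show "zero_object C z"
    using z unfolding zero_object_def by (metis Zero_arr_simps in_hom_iff)
qed

end

section \<open>Von Neumann regularity of semisimple categories\<close>

definition von_neumann_regular :: "('o, 'a, 'z) cat_scheme \<Rightarrow> bool" where
  "von_neumann_regular C \<longleftrightarrow>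
     (\<forall>f \<in> Arr C. \<exists>g \<in> hom_set C (Cod C f) (Dom C f). f \<cdot>\<^bsub>C\<^esub> g \<cdot>\<^bsub>C\<^esub> f = f)"

definition idempotents_split :: "('o, 'a, 'z) cat_scheme \<Rightarrow> bool" where
  "idempotents_split C \<longleftrightarrow>
     (\<forall>x \<in> Obj C. \<forall>e \<in> hom_set C x x. e \<cdot>\<^bsub>C\<^esub> e = e \<longrightarrow>
        (\<exists>y \<in> Obj C. \<exists>i \<in> hom_set C y x. \<exists>r \<in> hom_set C x y.
           r \<cdot>\<^bsub>C\<^esub> i = Id C y \<and> i \<cdot>\<^bsub>C\<^esub> r = e))"

lemma direct_sumE:
  assumes "direct_sum C n S x"
  obtains \<iota> \<pi> where "\<And>i. i < n \<Longrightarrow> \<iota> i \<in> hom_set C (S i) x" "\<And>i. i < n \<Longrightarrow> \<pi> i \<in> hom_set C x (S i)"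
    "\<And>i j. \<lbrakk>i < n; j < n\<rbrakk> \<Longrightarrow> \<pi> i \<cdot>\<^bsub>C\<^esub> \<iota> j = (if i = j then Id C (S i) else Zero_arr C (S j) (S i))"
    "(\<Oplus>\<^bsub>hom_space C x x\<^esub>i \<in> {..<n}. \<iota> i \<cdot>\<^bsub>C\<^esub> \<pi> i) = Id C x"
proof -
  obtain \<iota> \<pi> where "(\<forall>i<n. \<iota> i \<in> hom_set C (S i) x \<and> \<pi> i \<in> hom_set C x (S i)) \<and>
        (\<forall>i<n. \<forall>j<n. \<pi> i \<cdot>\<^bsub>C\<^esub> \<iota> j = (if i = j then Id C (S i) else Zero_arr C (S j) (S i))) \<and>
        (\<Oplus>\<^bsub>hom_space C x x\<^esub>i \<in> {..<n}. \<iota> i \<cdot>\<^bsub>C\<^esub> \<pi> i) = Id C x"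
    using assms unfolding direct_sum_def by auto
  then show ?thesis
    by (intro that[of \<iota> \<pi>]) simp_all
qed

context linear_category
begin

lemma complement_idempotent:
  assumes p: "p \<in> Hom x x" and pp: "p \<star> p = p"
  obtains d where "d \<in> Hom x x" "Add_arr C d p = Id C x"
    "d \<star> p = Zero_arr C x x" "p \<star> d = Zero_arr C x x" "d \<star> d = d"
proof -
  have x: "x \<in> Obj C" and p': "p \<in> Arr C" "Dom C p = x" "Cod C p = x"
    using p by (auto simp: in_hom_iff)
  obtain d where d: "d \<in> Hom x x" and sum: "Add_arr C d p = Id C x"
    using Id_hom[OF x] p by (rule Add_solve)
  have d': "d \<in> Arr C" "Dom C d = x" "Cod C d = x"
    using d by (auto simp: in_hom_iff)
  have "Add_arr C (d \<star> p) p = Add_arr C d p \<star> p"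
    using p' d' by (simp add: Comp_Add pp)
  also have "\<dots> = Add_arr C (Zero_arr C x x) p"
    using p' by (simp add: sum)
  finally have dp: "d \<star> p = Zero_arr C x x"
    by (rule Add_cancel_right) (use p' d' x in \<open>auto simp: in_hom_iff\<close>)
  have "Add_arr C (p \<star> d) p = p \<star> Add_arr C d p"
    using p' d' by (simp add: Comp_Add pp)
  also have "\<dots> = Add_arr C (Zero_arr C x x) p"
    using p' by (simp add: sum)
  finally have pd: "p \<star> d = Zero_arr C x x"
    by (rule Add_cancel_right) (use p' d' x in \<open>auto simp: in_hom_iff\<close>)
  have "d = Add_arr C d p \<star> d"
    using d' by (simp add: sum)
  also have "\<dots> = d \<star> d"
    using p' d' by (simp add: Comp_Add pd)
  finally show ?thesis
    using that d sum dp pd by simp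
qed

text \<open>
  McCoy's lemma: if \<open>f' = f - f g f\<close> satisfies \<open>f' h f' = f'\<close>, then since
  \<open>f' = f (1 - g f) = (1 - f g) f\<close> the arrow \<open>g + (1 - g f) h (1 - f g)\<close> in place of \<open>g\<close>
  turns \<open>f g f\<close> into \<open>f\<close>.
\<close>

lemma mccoy:
  assumes f: "f \<in> Hom x y" and g: "g \<in> Hom y x" and h: "h \<in> Hom y x"
    and f': "f' \<in> Hom x y" "Add_arr C f' (f \<star> g \<star> f) = f" "f' \<star> h \<star> f' = f'"
  shows "\<exists>k \<in> Hom y x. f \<star> k \<star> f = f"
proof -
  note hom = f g h f'(1)
  have "Id C x \<in> Hom x x" "g \<star> f \<in> Hom x x"
    using hom by (auto simp: in_hom_iff)
  then obtain a where a: "a \<in> Hom x x" "Add_arr C a (g \<star> f) = Id C x"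
    by (rule Add_solve)
  have "Id C y \<in> Hom y y" "f \<star> g \<in> Hom y y"
    using hom by (auto simp: in_hom_iff)
  then obtain b where b: "b \<in> Hom y y" "Add_arr C b (f \<star> g) = Id C y"
    by (rule Add_solve)
  have "Add_arr C (f \<star> a) (f \<star> g \<star> f) = f \<star> Add_arr C a (g \<star> f)"
    using hom a(1) by (subst Comp_Add) (auto simp: in_hom_iff)
  also have "\<dots> = Add_arr C f' (f \<star> g \<star> f)"
    using a(2) f'(2) f by (auto simp: in_hom_iff)
  finally have fa: "f \<star> a = f'"
    using hom a(1) by (elim Add_cancel_right[where x = x and y = y]) (auto simp: in_hom_iff)
  have "Add_arr C (b \<star> f) (f \<star> g \<star> f) = Add_arr C b (f \<star> g) \<star> f"
    using hom b(1) by (subst Comp_Add) (auto simp: in_hom_iff)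
  also have "\<dots> = Add_arr C f' (f \<star> g \<star> f)"
    using b(2) f'(2) f by (auto simp: in_hom_iff)
  finally have bf: "b \<star> f = f'"
    using hom b(1) by (elim Add_cancel_right[where x = x and y = y]) (auto simp: in_hom_iff)
  define k where "k = Add_arr C (a \<star> h \<star> b) g"
  have k: "k \<in> Hom y x"
    using hom a(1) b(1) by (auto simp: k_def in_hom_iff)
  have "f \<star> k \<star> f = Add_arr C ((f \<star> a) \<star> h \<star> b \<star> f) (f \<star> g \<star> f)"
    using hom a(1) b(1) unfolding k_def by (auto simp: in_hom_iff Comp_Add)
  also have "\<dots> = f"
    unfolding fa bf using f'(2,3) by simp
  finally show ?thesis
    using k by blast
qed

lemma zero_kernel_imp_mono:
  assumes "is_kernel C f i" "zero_object C (Dom C i)"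
  shows "mono_arrow C f"
  unfolding mono_arrow_def
proof (intro conjI ballI impI)
  show f: "f \<in> Arr C"
    using assms by (simp add: is_kernel_def)
  fix x g h
  assume x: "x \<in> Obj C" and g: "g \<in> Hom x (Dom C f)" and h: "h \<in> Hom x (Dom C f)"
    and eq: "f \<star> g = f \<star> h"
  obtain d where d: "d \<in> Hom x (Dom C f)" "Add_arr C d h = g"
    using g h by (rule Add_solve)
  have "Add_arr C (f \<star> d) (f \<star> h) = f \<star> Add_arr C d h"
    using d(1) h f by (subst Comp_Add) (auto simp: in_hom_iff)
  also have "\<dots> = Add_arr C (Zero_arr C x (Cod C f)) (f \<star> h)"
    using h f x eq d(2) by (auto simp: in_hom_iff)
  finally have "f \<star> d = Zero_arr C x (Cod C f)"
    using d(1) h f x by (elim Add_cancel_right[where x = x and y = "Cod C f"]) (auto simp: in_hom_iff)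
  then obtain u where u: "u \<in> Hom x (Dom C i)" "i \<star> u = d"
    using assms(1) x d(1) unfolding is_kernel_def by blast
  have i: "i \<in> Arr C" "Cod C i = Dom C f"
    using assms(1) by (auto simp: is_kernel_def)
  have "u = Zero_arr C x (Dom C i)"
    using u(1) assms(2) x i unfolding zero_object_def
    by (metis Zero_arr_simps in_hom_iff)
  then have "d = Zero_arr C x (Dom C f)"
    using u(2) i x by auto
  then show "g = h"
    using d(2) h f by (auto simp: in_hom_iff)
qed

end

text \<open>
  The kernel of \<open>u\<close> is a subobject of \<open>S\<close>: it is \<open>S\<close>, and \<open>u\<close> vanishes, or it is zero, and \<open>u\<close> is a
  nonzero subobject of \<open>T\<close>.
\<close>

lemma (in abelian_category) schur:
  assumes S: "simple_object C S" and T: "simple_object C T"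
    and u: "u \<in> Hom S T" "u \<noteq> Zero_arr C S T"
  shows "iso_arrow C u"
proof -
  have u': "u \<in> Arr C" "Dom C u = S" "Cod C u = T"
    using u by (auto simp: in_hom_iff)
  obtain i where i: "is_kernel C u i"
    using ex_kernel u'(1) by blast
  have i': "i \<in> Arr C" "Cod C i = S" "u \<star> i = Zero_arr C (Dom C i) T"
    using i u' by (auto simp: is_kernel_def)
  have "mono_arrow C i"
    unfolding mono_arrow_def
  proof (intro conjI ballI impI)
    fix x g h
    assume x: "x \<in> Obj C" and g: "g \<in> Hom x (Dom C i)" and h: "h \<in> Hom x (Dom C i)"
      and eq: "i \<star> g = i \<star> h"
    have "u \<star> i \<star> g = (u \<star> i) \<star> g"
      using u' i' g by (subst Comp_assoc_simp) (auto simp: in_hom_iff)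
    then have "u \<star> i \<star> g = Zero_arr C x T" "i \<star> g \<in> Hom x S"
      using i' u' g by (auto simp: in_hom_iff)
    then have "\<exists>!w. w \<in> Hom x (Dom C i) \<and> i \<star> w = i \<star> g"
      using i x u' unfolding is_kernel_def by simp
    then show "g = h"
      using g h eq by metis
  qed (rule i'(1))
  then consider "zero_object C (Dom C i)" | "iso_arrow C i"
    using S i' unfolding simple_object_def by (metis Dom_Obj in_hom_iff)
  then show ?thesis
  proof cases
    case 1
    have "\<not> zero_object C S"
      using S by (simp add: simple_object_def)
    then show ?thesis
      using zero_kernel_imp_mono[OF i 1] T u(1) u'
      by (auto simp: simple_object_def)
  next
    case 2
    have "(u \<star> i) \<star> inverse_arrow C i = u"
      using 2 u' i' by (subst Comp_assoc_simp) auto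
    then have "u = Zero_arr C S T"
      using i' 2 u' by (metis Comp_Zero(1) Dom_Cod_Obj inverse_arrow_simps(1-3))
    then show ?thesis
      using u(2) by simp
  qed
qed

context semisimple_category
begin

text \<open>
  This is Gaussian elimination with pivots in division rings: by Schur's lemma a nonzero entry of
  \<open>f\<close> with respect to decompositions into simple objects is invertible; passing from \<open>f\<close> to
  \<open>f - f g f\<close>, where \<open>g\<close> is the inverse of that entry, clears the column of the pivot and keeps the
  columns that were already zero. By McCoy's lemma regularity of \<open>f\<close> follows from that
  of the result, and the process ends with \<open>0\<close>.
\<close>

theorem semisimple_von_neumann_regular: "von_neumann_regular C"
  unfolding von_neumann_regular_def
proof
  fix f0
  assume f0: "f0 \<in> Arr C"
  define x y where "x = Dom C f0" and "y = Cod C f0"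
  have xy: "x \<in> Obj C" "y \<in> Obj C"
    using f0 by (auto simp: x_def y_def)
  from sum_of_simples[OF xy(1)] obtain n S where
    S: "\<And>i. i < n \<Longrightarrow> simple_object C (S i)" and "direct_sum C n S x"
    by auto
  from this(2) obtain \<iota> \<pi> where
    \<iota>\<pi>: "\<And>i. i < n \<Longrightarrow> \<iota> i \<in> Hom (S i) x" "\<And>i. i < n \<Longrightarrow> \<pi> i \<in> Hom x (S i)"
    and sum_x: "(\<Oplus>\<^bsub>hom_space C x x\<^esub>i \<in> {..<n}. \<iota> i \<star> \<pi> i) = Id C x"
    by (rule direct_sumE) (rule that)
  from sum_of_simples[OF xy(2)] obtain m T where
    T: "\<And>i. i < m \<Longrightarrow> simple_object C (T i)" and "direct_sum C m T y"
    by auto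
  from this(2) obtain \<iota>' \<pi>' where
    \<iota>\<pi>': "\<And>i. i < m \<Longrightarrow> \<iota>' i \<in> Hom (T i) y" "\<And>i. i < m \<Longrightarrow> \<pi>' i \<in> Hom y (T i)"
    and sum_y: "(\<Oplus>\<^bsub>hom_space C y y\<^esub>i \<in> {..<m}. \<iota>' i \<star> \<pi>' i) = Id C y"
    by (rule direct_sumE) (rule that)
  have S_obj: "\<And>i. i < n \<Longrightarrow> S i \<in> Obj C" and T_obj: "\<And>i. i < m \<Longrightarrow> T i \<in> Obj C"
    using S T by (auto simp: simple_object_def)
  have "\<exists>k \<in> Hom y x. f \<star> k \<star> f = f" if "f \<in> Hom x y" for f
    using that
  proof (induction "card {i. i < n \<and> f \<star> \<iota> i \<noteq> Zero_arr C (S i) y}" arbitrary: f rule: less_induct)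
    case (less f)
    have f: "f \<in> Arr C" "Dom C f = x" "Cod C f = y"
      using less.prems by (auto simp: in_hom_iff)
    show ?case
    proof (cases "\<exists>i<n. f \<star> \<iota> i \<noteq> Zero_arr C (S i) y")
      case False
      have "f = f \<star> (\<Oplus>\<^bsub>hom_space C x x\<^esub>i \<in> {..<n}. \<iota> i \<star> \<pi> i)"
        using f by (simp add: sum_x)
      also have "\<dots> = (\<Oplus>\<^bsub>hom_space C x y\<^esub>i \<in> {..<n}. f \<star> \<iota> i \<star> \<pi> i)"
        using xy \<iota>\<pi> less.prems by (intro Comp_finsum(1)) (auto intro: Comp_hom)
      also have "\<dots> = Zero_arr C x y"
      proof (rule finsum_Zero)
        fix i
        assume i: "i \<in> {..<n}"
        then have "f \<star> \<iota> i \<star> \<pi> i = (f \<star> \<iota> i) \<star> \<pi> i"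
          using \<iota>\<pi> less.prems Comp_assoc by (metis lessThan_iff)
        then show "f \<star> \<iota> i \<star> \<pi> i = Zero_arr C x y"
          using False i \<iota>\<pi>(2)[of i] xy by (auto simp: in_hom_iff)
      qed (use xy in auto)
      finally have "f = Zero_arr C x y" .
      then show ?thesis
        using xy by (intro bexI[of _ "Zero_arr C y x"]) (auto simp: in_hom_iff)
    next
      case True
      then obtain i where i: "i < n" "f \<star> \<iota> i \<noteq> Zero_arr C (S i) y"
        by blast
      have \<iota>i: "\<iota> i \<in> Arr C" "Dom C (\<iota> i) = S i" "Cod C (\<iota> i) = x"
        using \<iota>\<pi>(1)[OF i(1)] by (auto simp: in_hom_iff)
      have "\<exists>j<m. \<pi>' j \<star> f \<star> \<iota> i \<noteq> Zero_arr C (S i) (T j)"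
      proof (rule ccontr)
        assume *: "\<not> (\<exists>j<m. \<pi>' j \<star> f \<star> \<iota> i \<noteq> Zero_arr C (S i) (T j))"
        have fi: "f \<star> \<iota> i \<in> Hom (S i) y"
          using f \<iota>i by (auto simp: in_hom_iff)
        have "f \<star> \<iota> i = (\<Oplus>\<^bsub>hom_space C y y\<^esub>j \<in> {..<m}. \<iota>' j \<star> \<pi>' j) \<star> (f \<star> \<iota> i)"
          using f \<iota>i by (simp add: sum_y)
        also have "\<dots> = (\<Oplus>\<^bsub>hom_space C (S i) y\<^esub>j \<in> {..<m}. (\<iota>' j \<star> \<pi>' j) \<star> f \<star> \<iota> i)"
          using xy \<iota>\<pi>' fi by (intro Comp_finsum(2)) (auto intro: Comp_hom)
        also have "\<dots> = Zero_arr C (S i) y"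
        proof (rule finsum_Zero)
          fix j
          assume j: "j \<in> {..<m}"
          then have "(\<iota>' j \<star> \<pi>' j) \<star> (f \<star> \<iota> i) = \<iota>' j \<star> \<pi>' j \<star> (f \<star> \<iota> i)"
            using \<iota>\<pi>' fi Comp_assoc by (metis lessThan_iff)
          then show "(\<iota>' j \<star> \<pi>' j) \<star> f \<star> \<iota> i = Zero_arr C (S i) y"
            using * j \<iota>\<pi>'(1)[of j] xy S_obj i(1) by (auto simp: in_hom_iff)
        qed (use xy S_obj i(1) in auto)
        finally show False
          using i(2) by simp
      qed
      then obtain j where j: "j < m" "\<pi>' j \<star> f \<star> \<iota> i \<noteq> Zero_arr C (S i) (T j)"
        by blast
      \<comment> \<open>the pivot\<close>
      define u where "u = \<pi>' j \<star> f \<star> \<iota> i"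
      have \<pi>j: "\<pi>' j \<in> Arr C" "Dom C (\<pi>' j) = y" "Cod C (\<pi>' j) = T j"
        using \<iota>\<pi>'(2)[OF j(1)] by (auto simp: in_hom_iff)
      have u: "u \<in> Arr C" "Dom C u = S i" "Cod C u = T j"
        using f \<iota>i \<pi>j by (auto simp: u_def)
      have u_iso: "iso_arrow C u"
        using schur[OF S[OF i(1)] T[OF j(1)]] j(2) u by (auto simp: u_def in_hom_iff)
      define g where "g = \<iota> i \<star> inverse_arrow C u \<star> \<pi>' j"
      have g: "g \<in> Arr C" "Dom C g = y" "Cod C g = x"
        using u u_iso \<iota>i \<pi>j by (auto simp: g_def)
      have g_\<iota>: "g \<star> f \<star> \<iota> i = \<iota> i"
        using u u_iso \<iota>i \<pi>j f unfolding g_def by (simp add: u_def[symmetric])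
      have "f \<star> g \<star> f \<in> Hom x y"
        using f g by (auto simp: in_hom_iff)
      with less.prems obtain f' where f': "f' \<in> Hom x y" "Add_arr C f' (f \<star> g \<star> f) = f"
        by (rule Add_solve)
      \<comment> \<open>\<open>f'\<close> has strictly fewer nonzero columns than \<open>f\<close>\<close>
      have col: "f' \<star> \<iota> k = Zero_arr C (S k) y"
        if "k < n" "f \<star> \<iota> k = Zero_arr C (S k) y \<or> k = i" for k
      proof -
        have \<iota>k: "\<iota> k \<in> Arr C" "Dom C (\<iota> k) = S k" "Cod C (\<iota> k) = x" "S k \<in> Obj C"
          using \<iota>\<pi>(1)[OF that(1)] S_obj[OF that(1)] by (auto simp: in_hom_iff)
        have "Add_arr C (f' \<star> \<iota> k) (f \<star> g \<star> f \<star> \<iota> k) = Add_arr C f' (f \<star> g \<star> f) \<star> \<iota> k"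
          using f g f'(1) \<iota>k by (subst Comp_Add) (auto simp: in_hom_iff)
        also have "\<dots> = Add_arr C (Zero_arr C (S k) y) (f \<star> g \<star> f \<star> \<iota> k)"
          using that(2) g_\<iota> f g \<iota>k xy by (auto simp: f'(2))
        finally show ?thesis
          using f g f'(1) \<iota>k xy
          by (elim Add_cancel_right[where x = "S k" and y = y]) (auto simp: in_hom_iff)
      qed
      have "{k. k < n \<and> f' \<star> \<iota> k \<noteq> Zero_arr C (S k) y} \<subset> {k. k < n \<and> f \<star> \<iota> k \<noteq> Zero_arr C (S k) y}"
        using col i by blast
      then have "card {k. k < n \<and> f' \<star> \<iota> k \<noteq> Zero_arr C (S k) y}
          < card {k. k < n \<and> f \<star> \<iota> k \<noteq> Zero_arr C (S k) y}"
        by (intro psubset_card_mono) auto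
      from less.hyps[OF this f'(1)] obtain h where "h \<in> Hom y x" "f' \<star> h \<star> f' = f'"
        by blast
      with less.prems f' g show ?thesis
        by (intro mccoy[of f x y g h f']) (auto simp: in_hom_iff)
    qed
  qed
  then show "\<exists>g \<in> Hom (Cod C f0) (Dom C f0). f0 \<star> g \<star> f0 = f0"
    using f0 by (auto simp: x_def y_def in_hom_iff)
qed

end

text \<open>The image of an idempotent \<open>e\<close> is the kernel of \<open>1 - e\<close>.\<close>

lemma (in abelian_category) abelian_idempotents_split: "idempotents_split C"
  unfolding idempotents_split_def
proof (intro ballI impI)
  fix x e
  assume x: "x \<in> Obj C" and e_hom: "e \<in> Hom x x" and ee: "e \<star> e = e"
  have e: "e \<in> Arr C" "Dom C e = x" "Cod C e = x"
    using e_hom by (auto simp: in_hom_iff)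
  obtain d where d_hom: "d \<in> Hom x x" and de: "Add_arr C d e = Id C x"
    and d_e: "d \<star> e = Zero_arr C x x"
    using complement_idempotent[OF e_hom ee] by blast
  have d: "d \<in> Arr C" "Dom C d = x" "Cod C d = x"
    using d_hom by (auto simp: in_hom_iff)
  obtain i where i: "is_kernel C d i"
    using ex_kernel d(1) by blast
  have i': "i \<in> Arr C" "Cod C i = x" "d \<star> i = Zero_arr C (Dom C i) x"
    using i d by (auto simp: is_kernel_def)
  obtain r where r: "r \<in> Hom x (Dom C i)" "i \<star> r = e"
    using i x e_hom d d_e unfolding is_kernel_def by metis
  have "i = Add_arr C d e \<star> i"
    using i' by (simp add: de)
  also have "\<dots> = e \<star> i"
    using d e i' by (simp add: Comp_Add)
  finally have ei: "e \<star> i = i"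
    by simp
  have "i \<star> (r \<star> i) = i"
    using r i' ei by (auto simp: in_hom_iff simp flip: Comp_assoc_simp)
  moreover have "i \<in> Hom (Dom C i) (Dom C d)" "Dom C i \<in> Obj C"
    using i' d by (auto simp: in_hom_iff)
  ultimately have "\<exists>!w. w \<in> Hom (Dom C i) (Dom C i) \<and> i \<star> w = i"
    using i i' d unfolding is_kernel_def by metis
  moreover have "r \<star> i \<in> Hom (Dom C i) (Dom C i)" "Id C (Dom C i) \<in> Hom (Dom C i) (Dom C i)"
    using r i' by (auto simp: in_hom_iff)
  moreover have "i \<star> Id C (Dom C i) = i"
    using i' by simp
  ultimately have "r \<star> i = Id C (Dom C i)"
    using \<open>i \<star> (r \<star> i) = i\<close> by blast
  then show "\<exists>y \<in> Obj C. \<exists>i \<in> Hom y x. \<exists>r \<in> Hom x y. r \<star> i = Id C y \<and> i \<star> r = e"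
    using r i' by (intro bexI[of _ "Dom C i"] bexI[of _ i] bexI[of _ r]) (auto simp: in_hom_iff)
qed


section \<open>Abelian categories through regularity\<close>

context linear_category
begin

lemma regular_mono_retraction:
  assumes "von_neumann_regular C" "mono_arrow C i"
  obtains g where "g \<in> Hom (Cod C i) (Dom C i)" "g \<star> i = Id C (Dom C i)"
proof -
  have i: "i \<in> Arr C"
    using assms(2) by (simp add: mono_arrow_def)
  obtain g where g: "g \<in> Hom (Cod C i) (Dom C i)" "i \<star> g \<star> i = i"
    using assms(1) i unfolding von_neumann_regular_def by blast
  have "g \<star> i \<in> Hom (Dom C i) (Dom C i)" "Id C (Dom C i) \<in> Hom (Dom C i) (Dom C i)"
    "i \<star> g \<star> i = i \<star> Id C (Dom C i)" "Dom C i \<in> Obj C"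
    using g i by (auto simp: in_hom_iff)
  then have "g \<star> i = Id C (Dom C i)"
    using assms(2) unfolding mono_arrow_def by blast
  then show ?thesis
    using g that by blast
qed

lemma regular_epi_section:
  assumes "von_neumann_regular C" "epi_arrow C p"
  obtains g where "g \<in> Hom (Cod C p) (Dom C p)" "p \<star> g = Id C (Cod C p)"
proof -
  have p: "p \<in> Arr C"
    using assms(2) by (simp add: epi_arrow_def)
  obtain g where g: "g \<in> Hom (Cod C p) (Dom C p)" "p \<star> g \<star> p = p"
    using assms(1) p unfolding von_neumann_regular_def by blast
  have "p \<star> g \<in> Hom (Cod C p) (Cod C p)" "Id C (Cod C p) \<in> Hom (Cod C p) (Cod C p)"
    "(p \<star> g) \<star> p = Id C (Cod C p) \<star> p" "Cod C p \<in> Obj C"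
    using g p by (auto simp: in_hom_iff)
  then have "p \<star> g = Id C (Cod C p)"
    using assms(2) unfolding epi_arrow_def by blast
  then show ?thesis
    using g that by blast
qed

text \<open>
  The identity is a sum of \<open>i r\<close> and an arrow factoring through \<open>f\<close>, so that an arrow annihilated by
  \<open>f\<close> is invariant under \<open>i r\<close>.
\<close>

lemma is_kernelI:
  assumes f: "f \<in> Hom x y" and i: "i \<in> Hom w x" and r: "r \<in> Hom x w"
    and k: "k \<in> Hom y x" and fi: "f \<star> i = Zero_arr C w y" and ri: "r \<star> i = Id C w"
    and sum: "Add_arr C (i \<star> r) (k \<star> f) = Id C x"
  shows "is_kernel C f i"
proof -
  have hom: "f \<in> Arr C" "Dom C f = x" "Cod C f = y" "i \<in> Arr C" "Dom C i = w" "Cod C i = x"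
    "r \<in> Arr C" "Dom C r = x" "Cod C r = w" "k \<in> Arr C" "Dom C k = y" "Cod C k = x"
    using f i r k by (auto simp: in_hom_iff)
  have "\<exists>!u. u \<in> Hom v w \<and> i \<star> u = h"
    if h: "h \<in> Hom v x" and fh: "f \<star> h = Zero_arr C v y" for v h
  proof (rule ex1I[of _ "r \<star> h"])
    have "h = Add_arr C (i \<star> r) (k \<star> f) \<star> h"
      using h by (auto simp: sum in_hom_iff)
    also have "\<dots> = i \<star> r \<star> h"
      using h hom fh by (auto simp: Comp_Add in_hom_iff)
    finally show "r \<star> h \<in> Hom v w \<and> i \<star> r \<star> h = h"
      using h hom by (auto simp: in_hom_iff)
    fix u
    assume u: "u \<in> Hom v w \<and> i \<star> u = h"
    have "r \<star> i \<star> u = Id C w \<star> u"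
      using Comp_eq_prefix1[OF ri, of u] hom u by (auto simp: in_hom_iff)
    then show "u = r \<star> h"
      using u by (auto simp: in_hom_iff)
  qed
  then show ?thesis
    using hom fi by (simp add: is_kernel_def)
qed

lemma is_cokernelI:
  assumes f: "f \<in> Hom x y" and p: "p \<in> Hom y w" and i: "i \<in> Hom w y"
    and k: "k \<in> Hom y x" and pf: "p \<star> f = Zero_arr C x w" and pi: "p \<star> i = Id C w"
    and sum: "Add_arr C (i \<star> p) (f \<star> k) = Id C y"
  shows "is_cokernel C f p"
proof -
  have hom: "f \<in> Arr C" "Dom C f = x" "Cod C f = y" "p \<in> Arr C" "Dom C p = y" "Cod C p = w"
    "i \<in> Arr C" "Dom C i = w" "Cod C i = y" "k \<in> Arr C" "Dom C k = y" "Cod C k = x"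
    using f p i k by (auto simp: in_hom_iff)
  have "\<exists>!u. u \<in> Hom w v \<and> u \<star> p = h"
    if h: "h \<in> Hom y v" and hf: "h \<star> f = Zero_arr C x v" for v h
  proof (rule ex1I[of _ "h \<star> i"])
    have h': "h \<in> Arr C" "Dom C h = y" "Cod C h = v" "v \<in> Obj C"
      using h by (auto simp: in_hom_iff)
    have "h = h \<star> Add_arr C (i \<star> p) (f \<star> k)"
      using h' by (simp add: sum)
    also have "\<dots> = Add_arr C ((h \<star> i) \<star> p) (h \<star> f \<star> k)"
      using h' hom by (simp add: Comp_Add)
    also have "h \<star> f \<star> k = Zero_arr C y v"
      using Comp_eq_prefix1[OF hf, of k] h' hom by simp
    finally show "h \<star> i \<in> Hom w v \<and> (h \<star> i) \<star> p = h"
      using h' hom by (simp add: in_hom_iff)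
    fix u
    assume "u \<in> Hom w v \<and> u \<star> p = h"
    then show "u = h \<star> i"
      using pi hom by (auto simp: in_hom_iff)
  qed
  then show ?thesis
    using hom pf by (simp add: is_cokernel_def)
qed

text \<open>
  A kernel of \<open>f\<close> is obtained by splitting the idempotent \<open>1 - g f\<close>, where \<open>f g f = f\<close>, and dually
  for cokernels; a mono \<open>i\<close> with retraction \<open>g\<close> is a kernel of \<open>1 - i g\<close>. So regularity replaces the
  axioms of an abelian category, and it has the advantage of being manifestly invariant under
  equivalence.
\<close>

lemma abelian_categoryI:
  assumes zero: "\<exists>z. zero_object C z"
    and sums: "\<And>x y. \<lbrakk>x \<in> Obj C; y \<in> Obj C\<rbrakk> \<Longrightarrow> \<exists>s. direct_sum C 2 (\<lambda>i. if i = 0 then x else y) s"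
    and reg: "von_neumann_regular C" and split: "idempotents_split C"
  shows "abelian_category K C"
proof (intro abelian_category.intro abelian_category_axioms.intro)
  show "linear_category K C"
    by (rule linear_category_axioms)
next
  fix f
  assume f: "f \<in> Arr C"
  define x y where "x = Dom C f" and "y = Cod C f"
  have xy: "x \<in> Obj C" "y \<in> Obj C"
    using f by (auto simp: x_def y_def)
  obtain g where g_hom: "g \<in> Hom y x" and fgf: "f \<star> g \<star> f = f"
    using reg f unfolding von_neumann_regular_def x_def y_def by blast
  then have g: "g \<in> Arr C" "Dom C g = y" "Cod C g = x"
    by (auto simp: in_hom_iff)
  have f': "Dom C f = x" "Cod C f = y"
    by (auto simp: x_def y_def)
  then have f_hom: "f \<in> Hom x y"
    using f by (simp add: in_hom_iff)
  note fg = f f' g xy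
  show "\<exists>i. is_kernel C f i"
  proof -
    have gf: "g \<star> f \<in> Hom x x" "(g \<star> f) \<star> g \<star> f = g \<star> f"
      using fg by (auto simp: in_hom_iff fgf)
    obtain e where e_hom: "e \<in> Hom x x" and sum: "Add_arr C e (g \<star> f) = Id C x"
      and gfe: "(g \<star> f) \<star> e = Zero_arr C x x" and ee: "e \<star> e = e"
      by (rule complement_idempotent[OF gf])
    have e: "e \<in> Arr C" "Dom C e = x" "Cod C e = x"
      using e_hom by (auto simp: in_hom_iff)
    have "f \<star> e = f \<star> (g \<star> f) \<star> e"
      using Comp_eq_prefix1[OF fgf, of e] fg e by simp
    then have fe: "f \<star> e = Zero_arr C x y"
      using fg by (simp only: gfe) simp
    obtain w i r where i: "i \<in> Hom w x" and r: "r \<in> Hom x w"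
      and ri: "r \<star> i = Id C w" and ir: "i \<star> r = e"
      using split e_hom ee xy(1) unfolding idempotents_split_def by metis
    have ir': "i \<in> Arr C" "Dom C i = w" "Cod C i = x" "r \<in> Arr C" "Dom C r = x" "Cod C r = w"
      using i r by (auto simp: in_hom_iff)
    have "f \<star> i = f \<star> (i \<star> r) \<star> i"
      using fg ir' by (simp add: ri)
    also have "\<dots> = Zero_arr C w y"
      unfolding ir using Comp_eq_prefix1[OF fe, of i] e fg ir' by simp
    finally have "is_kernel C f i"
      using sum by (intro is_kernelI[OF f_hom i r g_hom _ ri]) (simp_all add: ir)
    then show ?thesis ..
  qed
  show "\<exists>p. is_cokernel C f p"
  proof -
    have fg': "f \<star> g \<in> Hom y y" "(f \<star> g) \<star> f \<star> g = f \<star> g"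
      using fg Comp_eq_prefix1[OF fgf, of g] by (auto simp: in_hom_iff)
    obtain e where e_hom: "e \<in> Hom y y" and sum: "Add_arr C e (f \<star> g) = Id C y"
      and efg: "e \<star> f \<star> g = Zero_arr C y y" and ee: "e \<star> e = e"
      by (rule complement_idempotent[OF fg'])
    have e: "e \<in> Arr C" "Dom C e = y" "Cod C e = y"
      using e_hom by (auto simp: in_hom_iff)
    have "e \<star> f = (e \<star> f \<star> g) \<star> f"
      using fg e by (simp add: fgf)
    then have ef: "e \<star> f = Zero_arr C x y"
      using fg by (simp only: efg) simp
    obtain w i r where i: "i \<in> Hom w y" and r: "r \<in> Hom y w"
      and ri: "r \<star> i = Id C w" and ir: "i \<star> r = e"
      using split e_hom ee xy(2) unfolding idempotents_split_def by metis
    have ir': "i \<in> Arr C" "Dom C i = w" "Cod C i = y" "r \<in> Arr C" "Dom C r = y" "Cod C r = w"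
      using i r by (auto simp: in_hom_iff)
    have "r \<star> f = ((r \<star> i) \<star> r) \<star> f"
      unfolding ri using fg ir' by simp
    also have "\<dots> = r \<star> (i \<star> r) \<star> f"
      using fg ir' by simp
    also have "\<dots> = Zero_arr C x w"
      unfolding ir using fg ir' by (simp add: ef)
    finally have "is_cokernel C f r"
      using sum by (intro is_cokernelI[OF f_hom r i g_hom _ ri]) (simp_all add: ir)
    then show ?thesis ..
  qed
next
  fix i
  assume mono: "mono_arrow C i"
  define x y where "x = Dom C i" and "y = Cod C i"
  obtain g where g: "g \<in> Hom y x" and gi: "g \<star> i = Id C x"
    using regular_mono_retraction[OF reg mono] unfolding x_def y_def by blast
  then have ig: "g \<in> Arr C" "Dom C g = y" "Cod C g = x" "i \<in> Arr C" "Dom C i = x" "Cod C i = y"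
    "x \<in> Obj C" "y \<in> Obj C"
    using mono by (auto simp: in_hom_iff mono_arrow_def x_def y_def)
  then have i: "i \<in> Hom x y" and p: "i \<star> g \<in> Hom y y" "(i \<star> g) \<star> i \<star> g = i \<star> g"
    using Comp_eq_prefix1[OF gi, of g] by (auto simp: in_hom_iff)
  obtain d where d_hom: "d \<in> Hom y y" and sum: "Add_arr C d (i \<star> g) = Id C y"
    and dig: "d \<star> i \<star> g = Zero_arr C y y"
    by (rule complement_idempotent[OF p])
  have d: "d \<in> Arr C" "Dom C d = y" "Cod C d = y"
    using d_hom by (auto simp: in_hom_iff)
  have "d \<star> i = (d \<star> i \<star> g) \<star> i"
    using d ig by (simp add: gi)
  then have di: "d \<star> i = Zero_arr C x y"
    using ig by (simp only: dig) simp
  have "Add_arr C (i \<star> g) (Id C y \<star> d) = Id C y"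
    using sum Add_commute[of d y y "i \<star> g"] d ig by (simp add: in_hom_iff)
  then show "\<exists>f. is_kernel C f i"
    using is_kernelI[OF d_hom i g Id_hom[OF ig(8)] di gi] by blast
next
  fix p
  assume epi: "epi_arrow C p"
  define x y where "x = Dom C p" and "y = Cod C p"
  obtain g where g: "g \<in> Hom y x" and pg: "p \<star> g = Id C y"
    using regular_epi_section[OF reg epi] unfolding x_def y_def by blast
  then have pg': "g \<in> Arr C" "Dom C g = y" "Cod C g = x" "p \<in> Arr C" "Dom C p = x" "Cod C p = y"
    "x \<in> Obj C" "y \<in> Obj C"
    using epi by (auto simp: in_hom_iff epi_arrow_def x_def y_def)
  then have p: "p \<in> Hom x y" and q: "g \<star> p \<in> Hom x x" "(g \<star> p) \<star> g \<star> p = g \<star> p"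
    using Comp_eq_prefix1[OF pg, of p] by (auto simp: in_hom_iff)
  obtain d where d_hom: "d \<in> Hom x x" and sum: "Add_arr C d (g \<star> p) = Id C x"
    and gpd: "(g \<star> p) \<star> d = Zero_arr C x x"
    by (rule complement_idempotent[OF q])
  have d: "d \<in> Arr C" "Dom C d = x" "Cod C d = x"
    using d_hom by (auto simp: in_hom_iff)
  have "p \<star> d = p \<star> (g \<star> p) \<star> d"
    using d pg' Comp_eq_prefix1[OF pg, of "p \<star> d"] by simp
  then have pd: "p \<star> d = Zero_arr C x y"
    using pg' by (simp only: gpd) simp
  have "Add_arr C (g \<star> p) (d \<star> Id C x) = Id C x"
    using sum Add_commute[of d x x "g \<star> p"] d pg' by (simp add: in_hom_iff)
  then show "\<exists>f. is_cokernel C f p"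
    using is_cokernelI[OF d_hom p g Id_hom[OF pg'(7)] pd pg] by blast
qed (use zero sums in auto)

text \<open>
  Subobjects are images of idempotents here, so that simplicity becomes a condition on the
  endomorphism algebra, which a fully faithful functor cannot alter.
\<close>

lemma simple_object_iff_idempotents:
  assumes reg: "von_neumann_regular C" and split: "idempotents_split C" and x: "x \<in> Obj C"
  shows "simple_object C x \<longleftrightarrow> Id C x \<noteq> Zero_arr C x x \<and>
    (\<forall>e \<in> Hom x x. e \<star> e = e \<longrightarrow> e = Zero_arr C x x \<or> e = Id C x)"
proof
  assume S: "simple_object C x"
  show "Id C x \<noteq> Zero_arr C x x \<and>
    (\<forall>e \<in> Hom x x. e \<star> e = e \<longrightarrow> e = Zero_arr C x x \<or> e = Id C x)"
  proof (intro conjI ballI impI)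
    show "Id C x \<noteq> Zero_arr C x x"
      using S by (auto simp: simple_object_def zero_object_iff)
    fix e
    assume e: "e \<in> Hom x x" "e \<star> e = e"
    then obtain y i r where "i \<in> Hom y x" "r \<in> Hom x y"
      and ri: "r \<star> i = Id C y" and ir: "i \<star> r = e" and y: "y \<in> Obj C"
      using split x unfolding idempotents_split_def by metis
    then have i: "i \<in> Arr C" "Dom C i = y" "Cod C i = x" "r \<in> Arr C" "Dom C r = x" "Cod C r = y"
      by (auto simp: in_hom_iff)
    have ri': "r \<star> i \<star> g = g" if "g \<in> Hom z y" for g z
    proof -
      have "r \<star> i \<star> g = (r \<star> i) \<star> g"
        using that i by (subst Comp_assoc_simp) (auto simp: in_hom_iff)
      then show ?thesis
        using that by (auto simp: ri in_hom_iff)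
    qed
    have "mono_arrow C i"
      unfolding mono_arrow_def using i ri' by metis
    then consider "zero_object C y" | "iso_arrow C i"
      using S i y unfolding simple_object_def by (metis in_hom_iff)
    then show "e = Zero_arr C x x \<or> e = Id C x"
    proof cases
      case 1
      then have "r = Zero_arr C x y"
        using i x unfolding zero_object_def by (metis Zero_arr_simps in_hom_iff)
      then show ?thesis
        using ir i x by auto
    next
      case 2
      have "(i \<star> r) \<star> i = Id C x \<star> i"
        using i by (simp add: ri)
      then have "i \<star> r = Id C x"
        using 2 i x by (elim iso_cancel_right[of i]) auto
      then show ?thesis
        using ir by simp
    qed
  qed
next
  assume E: "Id C x \<noteq> Zero_arr C x x \<and>
    (\<forall>e \<in> Hom x x. e \<star> e = e \<longrightarrow> e = Zero_arr C x x \<or> e = Id C x)"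
  show "simple_object C x"
    unfolding simple_object_def
  proof (intro conjI ballI impI)
    show "\<not> zero_object C x"
      using E by (simp add: zero_object_iff)
    fix y f
    assume y: "y \<in> Obj C" and f_hom: "f \<in> Hom y x" and mono: "mono_arrow C f"
    have f: "f \<in> Arr C" "Dom C f = y" "Cod C f = x"
      using f_hom by (auto simp: in_hom_iff)
    obtain g where "g \<in> Hom x y" and gf: "g \<star> f = Id C y"
      using regular_mono_retraction[OF reg mono] f by metis
    then have g: "g \<in> Arr C" "Dom C g = x" "Cod C g = y"
      by (auto simp: in_hom_iff)
    have gf': "g \<star> f \<star> g = g"
      using f g by (simp add: gf flip: Comp_assoc_simp)
    have "f \<star> g \<in> Hom x x" "(f \<star> g) \<star> (f \<star> g) = f \<star> g"
      using f g gf' by (auto simp: in_hom_iff)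
    then consider "f \<star> g = Zero_arr C x x" | "f \<star> g = Id C x"
      using E by blast
    then show "zero_object C y \<or> iso_arrow C f"
    proof cases
      case 1
      have "g = Zero_arr C x y"
        using gf' f g x unfolding 1 by simp
      then have "Id C y = Zero_arr C y y"
        using gf f x y by simp
      then show ?thesis
        using y by (simp add: zero_object_iff)
    next
      case 2
      then have "iso_arrow C f"
        using f g gf by (intro iso_arrowI[of f g]) auto
      then show ?thesis ..
    qed
  qed (rule x)
qed

end

section \<open>Transport along an equivalence\<close>

context linear_functor
begin

lemma FArr_simps [simp]:
  assumes "f \<in> Arr C"
  shows "FArr F f \<in> Arr D" "Dom D (FArr F f) = FObj F (Dom C f)" "Cod D (FArr F f) = FObj F (Cod C f)"
  using FArr_hom[of f "Dom C f" "Cod C f"] assms by (auto simp: in_hom_iff)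

lemma FArr_Comp_simp [simp]:
  "\<lbrakk>f \<in> Arr C; g \<in> Arr C; Cod C f = Dom C g\<rbrakk> \<Longrightarrow> FArr F (g \<cdot>\<^bsub>C\<^esub> f) = FArr F g \<cdot>\<^bsub>D\<^esub> FArr F f"
  by (rule FArr_Comp) (auto simp: in_hom_iff)

declare FObj_Obj [simp] FArr_Id [simp]

lemma FArr_Zero [simp]:
  assumes "x \<in> Obj C" "y \<in> Obj C"
  shows "FArr F (Zero_arr C x y) = Zero_arr D (FObj F x) (FObj F y)"
  using additive_zero[of "hom_space C x y" "hom_space D (FObj F x) (FObj F y)" "FArr F"] assms
  by (auto simp: C.hom_abelian_group D.hom_abelian_group FArr_hom FArr_add)

text \<open>
  Objects of \<open>D\<close> are only isomorphic to images under an equivalence, hence the isomorphisms \<open>\<beta>\<close> and \<open>\<gamma>\<close>.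
\<close>

lemma direct_sum_image:
  assumes sum: "direct_sum C n S x"
    and \<beta>: "\<And>i. i < n \<Longrightarrow> \<beta> i \<in> hom_set D (FObj F (S i)) (T i) \<and> iso_arrow D (\<beta> i)"
    and \<gamma>: "\<gamma> \<in> hom_set D (FObj F x) y" "iso_arrow D \<gamma>"
  shows "direct_sum D n T y"
proof -
  have x: "x \<in> Obj C" and S: "\<And>i. i < n \<Longrightarrow> S i \<in> Obj C"
    using sum by (auto simp: direct_sum_def)
  have \<gamma>': "\<gamma> \<in> Arr D" "Dom D \<gamma> = FObj F x" "Cod D \<gamma> = y"
    using \<gamma>(1) by (auto simp: in_hom_iff)
  have y: "y \<in> Obj D"
    using \<gamma>' by auto
  have \<beta>': "\<beta> i \<in> Arr D" "Dom D (\<beta> i) = FObj F (S i)" "Cod D (\<beta> i) = T i" "iso_arrow D (\<beta> i)" "T i \<in> Obj D"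
    if "i < n" for i
    using \<beta>[OF that] D.Cod_Obj[of "\<beta> i"] by (auto simp: in_hom_iff)
  obtain \<iota> \<pi> where
    \<iota>\<pi>: "\<And>i. i < n \<Longrightarrow> \<iota> i \<in> hom_set C (S i) x" "\<And>i. i < n \<Longrightarrow> \<pi> i \<in> hom_set C x (S i)"
    and orth: "\<And>i j. \<lbrakk>i < n; j < n\<rbrakk> \<Longrightarrow> \<pi> i \<cdot>\<^bsub>C\<^esub> \<iota> j = (if i = j then Id C (S i) else Zero_arr C (S j) (S i))"
    and unit: "(\<Oplus>\<^bsub>hom_space C x x\<^esub>i \<in> {..<n}. \<iota> i \<cdot>\<^bsub>C\<^esub> \<pi> i) = Id C x"
    using sum by (rule direct_sumE) (rule that)
  have \<iota>\<pi>': "\<iota> i \<in> Arr C" "Dom C (\<iota> i) = S i" "Cod C (\<iota> i) = x"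
    "\<pi> i \<in> Arr C" "Dom C (\<pi> i) = x" "Cod C (\<pi> i) = S i" if "i < n" for i
    using \<iota>\<pi>[OF that] by (auto simp: in_hom_iff)
  define \<iota>' where "\<iota>' i = \<gamma> \<cdot>\<^bsub>D\<^esub> FArr F (\<iota> i) \<cdot>\<^bsub>D\<^esub> inverse_arrow D (\<beta> i)" for i
  define \<pi>' where "\<pi>' i = \<beta> i \<cdot>\<^bsub>D\<^esub> FArr F (\<pi> i) \<cdot>\<^bsub>D\<^esub> inverse_arrow D \<gamma>" for i
  have \<iota>\<pi>'_hom: "\<iota>' i \<in> hom_set D (T i) y" "\<pi>' i \<in> hom_set D y (T i)" if "i < n" for i
    using that \<beta>' \<gamma>' \<gamma>(2) \<iota>\<pi>' by (auto simp: \<iota>'_def \<pi>'_def in_hom_iff)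
  have orth': "\<pi>' i \<cdot>\<^bsub>D\<^esub> \<iota>' j = (if i = j then Id D (T i) else Zero_arr D (T j) (T i))"
    if ij: "i < n" "j < n" for i j
  proof -
    have "\<pi>' i \<cdot>\<^bsub>D\<^esub> \<iota>' j = \<beta> i \<cdot>\<^bsub>D\<^esub> (FArr F (\<pi> i) \<cdot>\<^bsub>D\<^esub> FArr F (\<iota> j)) \<cdot>\<^bsub>D\<^esub> inverse_arrow D (\<beta> j)"
      using ij \<beta>'[OF ij(1)] \<beta>'[OF ij(2)] \<gamma>' \<gamma>(2) \<iota>\<pi>'[OF ij(1)] \<iota>\<pi>'[OF ij(2)] x
      by (simp add: \<iota>'_def \<pi>'_def)
    also have "FArr F (\<pi> i) \<cdot>\<^bsub>D\<^esub> FArr F (\<iota> j) = FArr F (\<pi> i \<cdot>\<^bsub>C\<^esub> \<iota> j)"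
      using \<iota>\<pi>'[OF ij(1)] \<iota>\<pi>'[OF ij(2)] by simp
    also have "\<dots> = (if i = j then Id D (FObj F (S i)) else Zero_arr D (FObj F (S j)) (FObj F (S i)))"
      using S ij by (simp add: orth)
    finally show ?thesis
      using S ij \<beta>'[OF ij(1)] \<beta>'[OF ij(2)] by (auto split: if_splits)
  qed
  have "(\<Oplus>\<^bsub>hom_space D y y\<^esub>i \<in> {..<n}. \<iota>' i \<cdot>\<^bsub>D\<^esub> \<pi>' i) =
      (\<Oplus>\<^bsub>hom_space D y y\<^esub>i \<in> {..<n}. \<gamma> \<cdot>\<^bsub>D\<^esub> FArr F (\<iota> i \<cdot>\<^bsub>C\<^esub> \<pi> i) \<cdot>\<^bsub>D\<^esub> inverse_arrow D \<gamma>)"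
  proof (rule D.finsum_cong_hom)
    show "\<iota>' i \<cdot>\<^bsub>D\<^esub> \<pi>' i = \<gamma> \<cdot>\<^bsub>D\<^esub> FArr F (\<iota> i \<cdot>\<^bsub>C\<^esub> \<pi> i) \<cdot>\<^bsub>D\<^esub> inverse_arrow D \<gamma>" if "i \<in> {..<n}" for i
      using that \<beta>'[of i] \<gamma>' \<gamma>(2) \<iota>\<pi>'[of i] x by (simp add: \<iota>'_def \<pi>'_def)
    show "(\<lambda>i. \<gamma> \<cdot>\<^bsub>D\<^esub> FArr F (\<iota> i \<cdot>\<^bsub>C\<^esub> \<pi> i) \<cdot>\<^bsub>D\<^esub> inverse_arrow D \<gamma>) \<in> {..<n} \<rightarrow> hom_set D y y"
      using \<gamma>' \<gamma>(2) \<iota>\<pi>' by (auto simp: in_hom_iff)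
  qed (use y in auto)
  also have "\<dots> = \<gamma> \<cdot>\<^bsub>D\<^esub> FArr F (\<Oplus>\<^bsub>hom_space C x x\<^esub>i \<in> {..<n}. \<iota> i \<cdot>\<^bsub>C\<^esub> \<pi> i) \<cdot>\<^bsub>D\<^esub> inverse_arrow D \<gamma>"
  proof (rule additive_finsum[symmetric,
        where G = "hom_space C x x" and h = "\<lambda>f. \<gamma> \<cdot>\<^bsub>D\<^esub> FArr F f \<cdot>\<^bsub>D\<^esub> inverse_arrow D \<gamma>"])
    show "\<gamma> \<cdot>\<^bsub>D\<^esub> FArr F (f \<oplus>\<^bsub>hom_space C x x\<^esub> g) \<cdot>\<^bsub>D\<^esub> inverse_arrow D \<gamma> =
        (\<gamma> \<cdot>\<^bsub>D\<^esub> FArr F f \<cdot>\<^bsub>D\<^esub> inverse_arrow D \<gamma>) \<oplus>\<^bsub>hom_space D y y\<^esub>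
        (\<gamma> \<cdot>\<^bsub>D\<^esub> FArr F g \<cdot>\<^bsub>D\<^esub> inverse_arrow D \<gamma>)"
      if "f \<in> carrier (hom_space C x x)" "g \<in> carrier (hom_space C x x)" for f g
      using that \<gamma>' \<gamma>(2) by (auto simp: in_hom_iff FArr_add D.Comp_Add)
  qed (use x y \<gamma>' \<gamma>(2) \<iota>\<pi>' in \<open>auto simp: C.hom_abelian_group D.hom_abelian_group in_hom_iff\<close>)
  also have "\<dots> = Id D y"
    using x \<gamma>' \<gamma>(2) by (simp add: unit)
  finally show ?thesis
    unfolding direct_sum_def using y \<beta>'(5) \<iota>\<pi>'_hom orth' by (intro conjI exI[of _ \<iota>'] exI[of _ \<pi>']) auto
qed

end

lemma quasi_inverse_sym: "quasi_inverse K C D F G \<Longrightarrow> quasi_inverse K D C G F"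
  by (auto simp: quasi_inverse_def)

lemma quasi_inverse_counitE:
  assumes "quasi_inverse K C D F G"
  obtains \<eta> where "\<And>x. x \<in> Obj C \<Longrightarrow> \<eta> x \<in> hom_set C (FObj G (FObj F x)) x \<and> iso_arrow C (\<eta> x)"
    and "\<And>f. f \<in> Arr C \<Longrightarrow> f \<cdot>\<^bsub>C\<^esub> \<eta> (Dom C f) = \<eta> (Cod C f) \<cdot>\<^bsub>C\<^esub> FArr G (FArr F f)"
proof -
  obtain \<eta> where "natural_iso C C (comp_funct G F) id_funct \<eta>"
    using assms by (auto simp: quasi_inverse_def naturally_isomorphic_def)
  then show ?thesis
    by (intro that[of \<eta>]) (simp_all add: natural_iso_def comp_funct_def id_funct_def)
qed

text \<open>
  An arrow is recovered from its image under \<open>G F\<close> by conjugation with the counit. Faithfulness of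
  \<open>G\<close>, which the symmetric argument gives, then yields fullness of \<open>F\<close>.
\<close>

lemma quasi_inverse_faithful:
  assumes qi: "quasi_inverse K C D F G"
    and f: "f \<in> hom_set C x y" and g: "g \<in> hom_set C x y" and eq: "FArr F f = FArr F g"
  shows "f = g"
proof -
  interpret F: linear_functor K C D F
    using qi by (simp add: quasi_inverse_def)
  obtain \<eta> where \<eta>: "\<And>x. x \<in> Obj C \<Longrightarrow> \<eta> x \<in> hom_set C (FObj G (FObj F x)) x \<and> iso_arrow C (\<eta> x)"
    and nat: "\<And>f. f \<in> Arr C \<Longrightarrow> f \<cdot>\<^bsub>C\<^esub> \<eta> (Dom C f) = \<eta> (Cod C f) \<cdot>\<^bsub>C\<^esub> FArr G (FArr F f)"
    using quasi_inverse_counitE[OF qi] by blast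
  have fg: "f \<in> Arr C" "Dom C f = x" "Cod C f = y" "g \<in> Arr C" "Dom C g = x" "Cod C g = y"
    using f g by (auto simp: in_hom_iff)
  have "x \<in> Obj C"
    using fg by auto
  then have \<eta>x: "\<eta> x \<in> Arr C" "Cod C (\<eta> x) = x" "iso_arrow C (\<eta> x)"
    using \<eta>[of x] by (auto simp: in_hom_iff)
  have "f \<cdot>\<^bsub>C\<^esub> \<eta> x = g \<cdot>\<^bsub>C\<^esub> \<eta> x"
    using nat[of f] nat[of g] eq fg by simp
  then show ?thesis
    by (rule F.C.iso_cancel_right[OF \<eta>x(3)]) (use \<eta>x fg in auto)
qed

lemma quasi_inverse_full:
  assumes qi: "quasi_inverse K C D F G"
    and x: "x \<in> Obj C" and y: "y \<in> Obj C" and g: "g \<in> hom_set D (FObj F x) (FObj F y)"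
  shows "\<exists>f \<in> hom_set C x y. FArr F f = g"
proof -
  interpret F: linear_functor K C D F
    using qi by (simp add: quasi_inverse_def)
  interpret G: linear_functor K D C G
    using qi by (simp add: quasi_inverse_def)
  obtain \<eta> where \<eta>: "\<And>x. x \<in> Obj C \<Longrightarrow> \<eta> x \<in> hom_set C (FObj G (FObj F x)) x \<and> iso_arrow C (\<eta> x)"
    and nat: "\<And>f. f \<in> Arr C \<Longrightarrow> f \<cdot>\<^bsub>C\<^esub> \<eta> (Dom C f) = \<eta> (Cod C f) \<cdot>\<^bsub>C\<^esub> FArr G (FArr F f)"
    using quasi_inverse_counitE[OF qi] by blast
  have \<eta>xy: "\<eta> x \<in> Arr C" "Dom C (\<eta> x) = FObj G (FObj F x)" "Cod C (\<eta> x) = x" "iso_arrow C (\<eta> x)"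
    "\<eta> y \<in> Arr C" "Dom C (\<eta> y) = FObj G (FObj F y)" "Cod C (\<eta> y) = y" "iso_arrow C (\<eta> y)"
    using \<eta>[OF x] \<eta>[OF y] by (auto simp: in_hom_iff)
  have g': "g \<in> Arr D" "Dom D g = FObj F x" "Cod D g = FObj F y"
    using g by (auto simp: in_hom_iff)
  define f where "f = \<eta> y \<cdot>\<^bsub>C\<^esub> FArr G g \<cdot>\<^bsub>C\<^esub> inverse_arrow C (\<eta> x)"
  have f: "f \<in> Arr C" "Dom C f = x" "Cod C f = y"
    using \<eta>xy g' by (auto simp: f_def)
  have "\<eta> y \<cdot>\<^bsub>C\<^esub> FArr G (FArr F f) = \<eta> y \<cdot>\<^bsub>C\<^esub> FArr G g"
    using nat[OF f(1)] f \<eta>xy g' by (simp add: f_def)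
  then have "FArr G (FArr F f) = FArr G g"
    by (rule F.C.iso_cancel_left[OF \<eta>xy(8)]) (use \<eta>xy g' f in auto)
  then have "FArr F f = g"
    using f g' by (intro quasi_inverse_faithful[OF quasi_inverse_sym[OF qi]]) (auto simp: in_hom_iff)
  then show ?thesis
    using f by (auto simp: in_hom_iff)
qed

text \<open>The arrow that makes \<open>G f\<close> regular comes from \<open>D\<close>, as \<open>G\<close> is full, and works there, as \<open>G\<close> is faithful.\<close>

lemma quasi_inverse_regular:
  assumes qi: "quasi_inverse K C D F G" and reg: "von_neumann_regular C"
  shows "von_neumann_regular D"
  unfolding von_neumann_regular_def
proof
  fix f
  assume f: "f \<in> Arr D"
  interpret G: linear_functor K D C G
    using qi by (simp add: quasi_inverse_def)
  obtain g where g: "g \<in> hom_set C (FObj G (Cod D f)) (FObj G (Dom D f))"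
    and eq: "FArr G f \<cdot>\<^bsub>C\<^esub> g \<cdot>\<^bsub>C\<^esub> FArr G f = FArr G f"
    using reg[unfolded von_neumann_regular_def, rule_format, of "FArr G f"] f by auto
  then obtain k where k: "k \<in> hom_set D (Cod D f) (Dom D f)" "FArr G k = g"
    using quasi_inverse_full[OF quasi_inverse_sym[OF qi] _ _ g] f by auto
  have "f \<cdot>\<^bsub>D\<^esub> k \<cdot>\<^bsub>D\<^esub> f = f"
    using f k eq
    by (intro quasi_inverse_faithful[OF quasi_inverse_sym[OF qi], of _ "Dom D f" "Cod D f"])
       (auto simp: in_hom_iff)
  then show "\<exists>g \<in> hom_set D (Cod D f) (Dom D f). f \<cdot>\<^bsub>D\<^esub> g \<cdot>\<^bsub>D\<^esub> f = f"
    using k by blast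
qed

text \<open>
  Splittings are less immediate, since they involve a new object: \<open>G e\<close> splits through some \<open>y\<close>, and
  \<open>e\<close> splits through \<open>F y\<close> after conjugation with the isomorphism \<open>F (G x) \<rightarrow> x\<close>.
\<close>

lemma quasi_inverse_idempotents_split:
  assumes qi: "quasi_inverse K C D F G" and split: "idempotents_split C"
  shows "idempotents_split D"
  unfolding idempotents_split_def
proof (intro ballI impI)
  fix x e
  assume x: "x \<in> Obj D" and e_hom: "e \<in> hom_set D x x" and ee: "e \<cdot>\<^bsub>D\<^esub> e = e"
  interpret F: linear_functor K C D F
    using qi by (simp add: quasi_inverse_def)
  interpret G: linear_functor K D C G
    using qi by (simp add: quasi_inverse_def)
  obtain \<epsilon> where \<epsilon>: "\<And>x. x \<in> Obj D \<Longrightarrow> \<epsilon> x \<in> hom_set D (FObj F (FObj G x)) x \<and> iso_arrow D (\<epsilon> x)"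
    and nat: "\<And>f. f \<in> Arr D \<Longrightarrow> f \<cdot>\<^bsub>D\<^esub> \<epsilon> (Dom D f) = \<epsilon> (Cod D f) \<cdot>\<^bsub>D\<^esub> FArr F (FArr G f)"
    using quasi_inverse_counitE[OF quasi_inverse_sym[OF qi]] by blast
  have \<epsilon>x: "\<epsilon> x \<in> Arr D" "Dom D (\<epsilon> x) = FObj F (FObj G x)" "Cod D (\<epsilon> x) = x" "iso_arrow D (\<epsilon> x)"
    using \<epsilon>[OF x] by (auto simp: in_hom_iff)
  have e: "e \<in> Arr D" "Dom D e = x" "Cod D e = x"
    using e_hom by (auto simp: in_hom_iff)
  have "FArr G e \<cdot>\<^bsub>C\<^esub> FArr G e = FArr G e" "FArr G e \<in> hom_set C (FObj G x) (FObj G x)"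
    using e ee by (auto simp: in_hom_iff simp flip: G.FArr_Comp_simp)
  then obtain y i r where ir: "i \<in> hom_set C y (FObj G x)" "r \<in> hom_set C (FObj G x) y"
    "r \<cdot>\<^bsub>C\<^esub> i = Id C y" "i \<cdot>\<^bsub>C\<^esub> r = FArr G e" and y: "y \<in> Obj C"
    using split[unfolded idempotents_split_def, rule_format, of "FObj G x" "FArr G e"] x by auto
  then have ir': "i \<in> Arr C" "Dom C i = y" "Cod C i = FObj G x" "r \<in> Arr C" "Dom C r = FObj G x" "Cod C r = y"
    by (auto simp: in_hom_iff)
  have ri: "FArr F r \<cdot>\<^bsub>D\<^esub> FArr F i = Id D (FObj F y)"
    using ir' ir(3) y by (simp flip: F.FArr_Comp_simp)
  have nat_e: "\<epsilon> x \<cdot>\<^bsub>D\<^esub> FArr F (FArr G e) = e \<cdot>\<^bsub>D\<^esub> \<epsilon> x"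
    using nat[OF e(1)] e by simp
  have "\<epsilon> x \<cdot>\<^bsub>D\<^esub> (FArr F i \<cdot>\<^bsub>D\<^esub> FArr F r) \<cdot>\<^bsub>D\<^esub> inverse_arrow D (\<epsilon> x) =
      (\<epsilon> x \<cdot>\<^bsub>D\<^esub> FArr F (FArr G e)) \<cdot>\<^bsub>D\<^esub> inverse_arrow D (\<epsilon> x)"
    using ir' ir(4) \<epsilon>x e by (simp flip: F.FArr_Comp_simp)
  also have "\<dots> = e"
    unfolding nat_e using e \<epsilon>x by simp
  finally have ir'': "\<epsilon> x \<cdot>\<^bsub>D\<^esub> (FArr F i \<cdot>\<^bsub>D\<^esub> FArr F r) \<cdot>\<^bsub>D\<^esub> inverse_arrow D (\<epsilon> x) = e" .
  show "\<exists>y \<in> Obj D. \<exists>i \<in> hom_set D y x. \<exists>r \<in> hom_set D x y. r \<cdot>\<^bsub>D\<^esub> i = Id D y \<and> i \<cdot>\<^bsub>D\<^esub> r = e"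
  proof (intro bexI conjI)
    show "(FArr F r \<cdot>\<^bsub>D\<^esub> inverse_arrow D (\<epsilon> x)) \<cdot>\<^bsub>D\<^esub> (\<epsilon> x \<cdot>\<^bsub>D\<^esub> FArr F i) = Id D (FObj F y)"
      using ir' \<epsilon>x ri by simp
    show "(\<epsilon> x \<cdot>\<^bsub>D\<^esub> FArr F i) \<cdot>\<^bsub>D\<^esub> (FArr F r \<cdot>\<^bsub>D\<^esub> inverse_arrow D (\<epsilon> x)) = e"
      using ir' \<epsilon>x ir'' by simp
  qed (use ir' \<epsilon>x y in \<open>auto simp: in_hom_iff\<close>)
qed

lemma quasi_inverse_simple_iff:
  assumes qi: "quasi_inverse K C D F G"
    and reg: "von_neumann_regular C" and split: "idempotents_split C" and x: "x \<in> Obj C"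
  shows "simple_object C x \<longleftrightarrow> simple_object D (FObj F x)"
proof -
  interpret F: linear_functor K C D F
    using qi by (simp add: quasi_inverse_def)
  let ?y = "FObj F x"
  have y: "?y \<in> Obj D"
    using x by simp
  note inj = quasi_inverse_faithful[OF qi, of _ x x]
  have zero: "Id C x = Zero_arr C x x \<longleftrightarrow> Id D ?y = Zero_arr D ?y ?y"
    using inj[of "Id C x" "Zero_arr C x x"] x by (auto simp: in_hom_iff simp flip: F.FArr_Id F.FArr_Zero)
  have E: "(\<forall>e \<in> hom_set C x x. e \<cdot>\<^bsub>C\<^esub> e = e \<longrightarrow> e = Zero_arr C x x \<or> e = Id C x) \<longleftrightarrow>
      (\<forall>e \<in> hom_set D ?y ?y. e \<cdot>\<^bsub>D\<^esub> e = e \<longrightarrow> e = Zero_arr D ?y ?y \<or> e = Id D ?y)" (is "?L \<longleftrightarrow> ?R")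
  proof
    assume L: ?L
    show ?R
    proof (intro ballI impI)
      fix e
      assume e: "e \<in> hom_set D ?y ?y" "e \<cdot>\<^bsub>D\<^esub> e = e"
      obtain f where f: "f \<in> hom_set C x x" "FArr F f = e"
        using quasi_inverse_full[OF qi x x e(1)] by blast
      have "f \<cdot>\<^bsub>C\<^esub> f = f"
        using f e(2) by (intro inj) (auto simp: in_hom_iff)
      then show "e = Zero_arr D ?y ?y \<or> e = Id D ?y"
        using L f x by auto
    qed
  next
    assume R: ?R
    show ?L
    proof (intro ballI impI)
      fix e
      assume e: "e \<in> hom_set C x x" "e \<cdot>\<^bsub>C\<^esub> e = e"
      have "FArr F e \<cdot>\<^bsub>D\<^esub> FArr F e = FArr F e"
        using e by (auto simp: in_hom_iff simp flip: F.FArr_Comp_simp)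
      then have "FArr F e = FArr F (Zero_arr C x x) \<or> FArr F e = FArr F (Id C x)"
        using R e(1) x F.FArr_hom by auto
      then show "e = Zero_arr C x x \<or> e = Id C x"
        using inj[OF e(1), of "Zero_arr C x x"] inj[OF e(1), of "Id C x"] x by (auto simp: in_hom_iff)
    qed
  qed
  show ?thesis
    unfolding F.C.simple_object_iff_idempotents[OF reg split x]
      F.D.simple_object_iff_idempotents[OF quasi_inverse_regular[OF qi reg]
        quasi_inverse_idempotents_split[OF qi split] y]
    using zero E by simp
qed

text \<open>
  Kernels, cokernels and the normality of monos and epis come from regularity and split idempotents;
  biproducts and decompositions into simple objects are images of those in \<open>C\<close>.
\<close>

theorem quasi_inverse_semisimple:
  assumes qi: "quasi_inverse K C D F G" and ss: "semisimple_category K C"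
  shows "semisimple_category K D"
proof -
  interpret C: semisimple_category K C by fact
  interpret F: linear_functor K C D F
    using qi by (simp add: quasi_inverse_def)
  interpret G: linear_functor K D C G
    using qi by (simp add: quasi_inverse_def)
  obtain \<epsilon> where \<epsilon>: "\<And>x. x \<in> Obj D \<Longrightarrow> \<epsilon> x \<in> hom_set D (FObj F (FObj G x)) x \<and> iso_arrow D (\<epsilon> x)"
    using quasi_inverse_counitE[OF quasi_inverse_sym[OF qi]] by blast
  have "abelian_category K D"
  proof (rule F.D.abelian_categoryI)
    obtain z where "zero_object C z"
      using C.ex_zero_object by blast
    then have z: "z \<in> Obj C" "Id C z = Zero_arr C z z"
      by (auto simp: C.zero_object_iff)
    have "Id D (FObj F z) = Zero_arr D (FObj F z) (FObj F z)"
      using z F.FArr_Id[of z] by simp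
    then show "\<exists>z. zero_object D z"
      using z by (intro exI[of _ "FObj F z"]) (simp add: F.D.zero_object_iff)
    show "\<exists>s. direct_sum D 2 (\<lambda>i. if i = 0 then x else y) s" if xy: "x \<in> Obj D" "y \<in> Obj D" for x y
    proof -
      obtain s where s: "direct_sum C 2 (\<lambda>i. if i = 0 then FObj G x else FObj G y) s"
        using C.ex_direct_sum[OF xy[THEN G.FObj_Obj]] ..
      then have "s \<in> Obj C"
        by (simp add: direct_sum_def)
      then have "direct_sum D 2 (\<lambda>i. if i = 0 then x else y) (FObj F s)"
        using xy \<epsilon>[of x] \<epsilon>[of y]
        by (intro F.direct_sum_image[OF s, where \<beta> = "\<lambda>i. \<epsilon> (if i = 0 then x else y)"
              and \<gamma> = "Id D (FObj F s)"]) (auto simp: in_hom_iff)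
      then show ?thesis ..
    qed
  qed (use qi C.semisimple_von_neumann_regular C.abelian_idempotents_split in
      \<open>auto intro: quasi_inverse_regular quasi_inverse_idempotents_split\<close>)
  moreover have "\<exists>n S. (\<forall>i<n. simple_object D (S i)) \<and> direct_sum D n S x" if x: "x \<in> Obj D" for x
  proof -
    obtain n S where S: "\<And>i. i < n \<Longrightarrow> simple_object C (S i)" "direct_sum C n S (FObj G x)"
      using C.sum_of_simples[OF G.FObj_Obj[OF x]] by auto
    have S_obj: "S i \<in> Obj C" if "i < n" for i
      using S(1)[OF that] by (simp add: simple_object_def)
    have "simple_object D (FObj F (S i))" if "i < n" for i
      using quasi_inverse_simple_iff[OF qi C.semisimple_von_neumann_regular
          C.abelian_idempotents_split S_obj[OF that]] S(1)[OF that] by simp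
    moreover have "direct_sum D n (\<lambda>i. FObj F (S i)) x"
      by (rule F.direct_sum_image[OF S(2), where \<beta> = "\<lambda>i. Id D (FObj F (S i))" and \<gamma> = "\<epsilon> x"])
         (use \<epsilon>[OF x] S_obj in \<open>auto simp: in_hom_iff\<close>)
    ultimately show ?thesis
      by (intro exI[of _ n] exI[of _ "\<lambda>i. FObj F (S i)"]) simp
  qed
  ultimately show ?thesis
    by (intro semisimple_category.intro semisimple_category_axioms.intro)
qed

section \<open>Coherence and duality\<close>

context linear_monoidal_category
begin

lemma TenA_simps [simp]:
  assumes "f \<in> Arr C" "g \<in> Arr C"
  shows "f \<otimes>\<^sub>a\<^bsub>C\<^esub> g \<in> Arr C" "Dom C (f \<otimes>\<^sub>a\<^bsub>C\<^esub> g) = Dom C f \<otimes>\<^sub>o\<^bsub>C\<^esub> Dom C g"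
    "Cod C (f \<otimes>\<^sub>a\<^bsub>C\<^esub> g) = Cod C f \<otimes>\<^sub>o\<^bsub>C\<^esub> Cod C g"
  using TenA_hom[of f "Dom C f" "Cod C f" g "Dom C g" "Cod C g"] assms by (auto simp: in_hom_iff)

declare TenO_Obj [simp] UnitO_Obj [simp] TenA_Id [simp]

lemma constraint_simps [simp]:
  shows "\<lbrakk>x \<in> Obj C; y \<in> Obj C; z \<in> Obj C\<rbrakk> \<Longrightarrow> Assoc C x y z \<in> Arr C"
    "\<lbrakk>x \<in> Obj C; y \<in> Obj C; z \<in> Obj C\<rbrakk> \<Longrightarrow> Dom C (Assoc C x y z) = (x \<otimes>\<^sub>o\<^bsub>C\<^esub> y) \<otimes>\<^sub>o\<^bsub>C\<^esub> z"
    "\<lbrakk>x \<in> Obj C; y \<in> Obj C; z \<in> Obj C\<rbrakk> \<Longrightarrow> Cod C (Assoc C x y z) = x \<otimes>\<^sub>o\<^bsub>C\<^esub> y \<otimes>\<^sub>o\<^bsub>C\<^esub> z"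
    "x \<in> Obj C \<Longrightarrow> LUnit C x \<in> Arr C" "x \<in> Obj C \<Longrightarrow> Dom C (LUnit C x) = UnitO C \<otimes>\<^sub>o\<^bsub>C\<^esub> x"
    "x \<in> Obj C \<Longrightarrow> Cod C (LUnit C x) = x"
    "x \<in> Obj C \<Longrightarrow> RUnit C x \<in> Arr C" "x \<in> Obj C \<Longrightarrow> Dom C (RUnit C x) = x \<otimes>\<^sub>o\<^bsub>C\<^esub> UnitO C"
    "x \<in> Obj C \<Longrightarrow> Cod C (RUnit C x) = x"
  using Assoc_hom LUnit_hom RUnit_hom by (auto simp: in_hom_iff)

declare Assoc_iso [simp] LUnit_iso [simp] RUnit_iso [simp]

lemma TenA_Comp_fuse:
  assumes "f \<in> Arr C" "g \<in> Arr C" "f' \<in> Arr C" "g' \<in> Arr C" "Cod C f = Dom C g" "Cod C f' = Dom C g'"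
  shows "(g \<otimes>\<^sub>a\<^bsub>C\<^esub> g') \<star> (f \<otimes>\<^sub>a\<^bsub>C\<^esub> f') = (g \<star> f) \<otimes>\<^sub>a\<^bsub>C\<^esub> (g' \<star> f')"
  using assms by (intro TenA_Comp[symmetric]) (auto simp: in_hom_iff)

text \<open>
  A monoidal category acts on itself. Facts about module categories thereby specialise to monoidal
  categories.
\<close>

definition regular_module :: "('k, 'o, 'a, 'o, 'a) mod_cat" where
  "regular_module =
     \<lparr>Obj = Obj C, Arr = Arr C, Dom = Dom C, Cod = Cod C, Id = Id C, Comp = Comp C,
      Zero_arr = Zero_arr C, Add_arr = Add_arr C, Smult_arr = Smult_arr C,
      ActO = TenO C, ActA = TenA C, MAssoc = Assoc C, MUnit = LUnit C\<rparr>"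

lemma regular_module_simps [simp]:
  "Obj regular_module = Obj C" "Arr regular_module = Arr C"
  "Dom regular_module = Dom C" "Cod regular_module = Cod C"
  "Id regular_module = Id C" "Comp regular_module = Comp C"
  "Zero_arr regular_module = Zero_arr C" "Add_arr regular_module = Add_arr C"
  "Smult_arr regular_module = Smult_arr C"
  "ActO regular_module = TenO C" "ActA regular_module = TenA C"
  "MAssoc regular_module = Assoc C" "MUnit regular_module = LUnit C"
  by (simp_all add: regular_module_def)

lemma regular_module_simps' [simp]:
  "hom_set regular_module = hom_set C" "hom_space regular_module = hom_space C"
  "inverse_arrows regular_module = inverse_arrows C" "iso_arrow regular_module = iso_arrow C"
  "inverse_arrow regular_module = inverse_arrow C"
proof -
  show *: "hom_set regular_module = hom_set C" "inverse_arrows regular_module = inverse_arrows C"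
    by (intro ext; simp add: hom_set_def inverse_arrows_def)+
  show "hom_space regular_module = hom_space C" "iso_arrow regular_module = iso_arrow C"
    "inverse_arrow regular_module = inverse_arrow C"
    by (intro ext; simp add: hom_space_def iso_arrow_def inverse_arrow_def *)+
qed

lemma module_category_regular_module: "module_category K C regular_module"
proof (intro module_category.intro linear_category.intro category.intro
    linear_category_axioms.intro module_category_axioms.intro)
  show "linear_monoidal_category K C"
    by (rule linear_monoidal_category_axioms)
  show "field K"
    by (rule field_axioms)
qed (simp_all only: regular_module_simps regular_module_simps' Dom_Obj Cod_Obj Id_hom Comp_hom
      Comp_Id_left Comp_Id_right Comp_assoc hom_module Comp_add_left Comp_add_right Comp_smult_left
      Comp_smult_right TenO_Obj TenA_hom TenA_Id TenA_Comp TenA_add_left TenA_add_right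
      TenA_smult_left TenA_smult_right Assoc_hom Assoc_iso Assoc_natural LUnit_hom LUnit_iso
      LUnit_natural pentagon triangle)

lemma dual_pair_simps:
  assumes "dual_pair C y x e d"
  shows "x \<in> Obj C" "y \<in> Obj C"
    "e \<in> Arr C" "Dom C e = y \<otimes>\<^sub>o\<^bsub>C\<^esub> x" "Cod C e = UnitO C"
    "d \<in> Arr C" "Dom C d = UnitO C" "Cod C d = x \<otimes>\<^sub>o\<^bsub>C\<^esub> y"
  using assms by (auto simp: dual_pair_def in_hom_iff)

lemma dual_pair_zigzag:
  assumes "dual_pair C y x e d"
  shows "RUnit C x \<star> (Id C x \<otimes>\<^sub>a\<^bsub>C\<^esub> e) \<star> Assoc C x y x \<star> (d \<otimes>\<^sub>a\<^bsub>C\<^esub> Id C x) = LUnit C x"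
proof -
  note [simp] = dual_pair_simps[OF assms]
  let ?z = "RUnit C x \<star> (Id C x \<otimes>\<^sub>a\<^bsub>C\<^esub> e) \<star> Assoc C x y x \<star> (d \<otimes>\<^sub>a\<^bsub>C\<^esub> Id C x)"
  have "?z \<star> inverse_arrow C (LUnit C x) = LUnit C x \<star> inverse_arrow C (LUnit C x)"
    using assms by (simp add: dual_pair_def)
  then show ?thesis
    by (rule iso_cancel_right[rotated]) auto
qed

end

context module_category
begin

abbreviation comp_C (infixr "\<cdot>\<^sub>C" 65) where "g \<cdot>\<^sub>C f \<equiv> Comp C g f"
abbreviation comp_M (infixr "\<cdot>\<^sub>M" 65) where "g \<cdot>\<^sub>M f \<equiv> Comp \<M> g f"
abbreviation tensor_obj (infixr "\<otimes>\<^sub>O" 75) where "x \<otimes>\<^sub>O y \<equiv> TenO C x y"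
abbreviation tensor_arr (infixr "\<otimes>\<^sub>C" 75) where "f \<otimes>\<^sub>C g \<equiv> TenA C f g"
abbreviation act_obj (infixr "\<rhd>\<^sub>O" 75) where "x \<rhd>\<^sub>O m \<equiv> ActO \<M> x m"
abbreviation act_arr (infixr "\<rhd>\<^sub>M" 75) where "f \<rhd>\<^sub>M h \<equiv> ActA \<M> f h"
abbreviation whisker (infixr "\<triangleright>" 75) where "x \<triangleright> h \<equiv> ActA \<M> (Id C x) h"

lemma ActA_simps [simp]:
  assumes "f \<in> Arr C" "h \<in> Arr \<M>"
  shows "f \<rhd>\<^sub>M h \<in> Arr \<M>" "Dom \<M> (f \<rhd>\<^sub>M h) = Dom C f \<rhd>\<^sub>O Dom \<M> h"
    "Cod \<M> (f \<rhd>\<^sub>M h) = Cod C f \<rhd>\<^sub>O Cod \<M> h"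
  using ActA_hom[of f "Dom C f" "Cod C f" h "Dom \<M> h" "Cod \<M> h"] assms by (auto simp: in_hom_iff)

declare ActO_Obj [simp] ActA_Id [simp]

lemma module_constraint_simps [simp]:
  shows "\<lbrakk>x \<in> Obj C; y \<in> Obj C; m \<in> Obj \<M>\<rbrakk> \<Longrightarrow> MAssoc \<M> x y m \<in> Arr \<M>"
    "\<lbrakk>x \<in> Obj C; y \<in> Obj C; m \<in> Obj \<M>\<rbrakk> \<Longrightarrow> Dom \<M> (MAssoc \<M> x y m) = (x \<otimes>\<^sub>O y) \<rhd>\<^sub>O m"
    "\<lbrakk>x \<in> Obj C; y \<in> Obj C; m \<in> Obj \<M>\<rbrakk> \<Longrightarrow> Cod \<M> (MAssoc \<M> x y m) = x \<rhd>\<^sub>O y \<rhd>\<^sub>O m"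
    "m \<in> Obj \<M> \<Longrightarrow> MUnit \<M> m \<in> Arr \<M>" "m \<in> Obj \<M> \<Longrightarrow> Dom \<M> (MUnit \<M> m) = UnitO C \<rhd>\<^sub>O m"
    "m \<in> Obj \<M> \<Longrightarrow> Cod \<M> (MUnit \<M> m) = m"
  using MAssoc_hom MUnit_hom by (auto simp: in_hom_iff)

declare MAssoc_iso [simp] MUnit_iso [simp]

lemma ActA_Comp_fuse:
  assumes "f \<in> Arr C" "g \<in> Arr C" "h \<in> Arr \<M>" "i \<in> Arr \<M>" "Cod C f = Dom C g" "Cod \<M> h = Dom \<M> i"
  shows "(g \<rhd>\<^sub>M i) \<cdot>\<^sub>M (f \<rhd>\<^sub>M h) = (g \<cdot>\<^sub>C f) \<rhd>\<^sub>M (i \<cdot>\<^sub>M h)"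
  using assms by (intro ActA_Comp[symmetric]) (auto simp: in_hom_iff)

lemma ActA_iso [simp]:
  assumes "iso_arrow C f" "iso_arrow \<M> h"
  shows "iso_arrow \<M> (f \<rhd>\<^sub>M h)"
  using assms C.iso_arrow_Arr[OF assms(1)] M.iso_arrow_Arr[OF assms(2)]
  by (intro M.iso_arrowI[where g = "inverse_arrow C f \<rhd>\<^sub>M inverse_arrow \<M> h"])
     (auto simp: ActA_Comp_fuse)

lemma MAssoc_nat:
  assumes "f \<in> Arr C" "g \<in> Arr C" "h \<in> Arr \<M>"
    and "Dom C f = x" "Cod C f = x'" "Dom C g = y" "Cod C g = y'" "Dom \<M> h = m" "Cod \<M> h = m'"
  shows "MAssoc \<M> x' y' m' \<cdot>\<^sub>M ((f \<otimes>\<^sub>C g) \<rhd>\<^sub>M h) = (f \<rhd>\<^sub>M g \<rhd>\<^sub>M h) \<cdot>\<^sub>M MAssoc \<M> x y m"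
  using assms by (intro MAssoc_natural) (auto simp: in_hom_iff)

text \<open>The unit object acts faithfully, because its action is isomorphic to the identity functor.\<close>

lemma UnitO_faithful:
  assumes eq: "(UnitO C) \<triangleright> h = (UnitO C) \<triangleright> h'"
    and h: "h \<in> hom_set \<M> m n" "h' \<in> hom_set \<M> m n"
  shows "h = h'"
proof -
  have m: "m \<in> Obj \<M>" and [simp]: "h \<in> Arr \<M>" "h' \<in> Arr \<M>" "Dom \<M> h = m" "Dom \<M> h' = m"
    using h by (auto simp: in_hom_iff)
  have "h \<cdot>\<^sub>M MUnit \<M> m = h' \<cdot>\<^sub>M MUnit \<M> m"
    using MUnit_natural[OF h(1)] MUnit_natural[OF h(2)] eq by simp
  then show ?thesis
    by (rule M.iso_cancel_right[rotated]) (use m in auto)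
qed

text \<open>
  Kelly's argument: after applying \<open>1 \<otimes> \<bullet>\<close> the claim follows from the pentagon and the two
  triangles, and \<open>1 \<otimes> \<bullet>\<close> may be cancelled.
\<close>

lemma MUnit_ActO:
  assumes [simp]: "x \<in> Obj C" "m \<in> Obj \<M>"
  shows "MUnit \<M> (x \<rhd>\<^sub>O m) \<cdot>\<^sub>M MAssoc \<M> (UnitO C) x m = LUnit C x \<rhd>\<^sub>M Id \<M> m"
proof -
  let ?I = "UnitO C"
  let ?b = "MAssoc \<M> ?I (?I \<otimes>\<^sub>O x) m \<cdot>\<^sub>M (Assoc C ?I ?I x \<rhd>\<^sub>M Id \<M> m)"
  have "(?I \<triangleright> (MUnit \<M> (x \<rhd>\<^sub>O m) \<cdot>\<^sub>M MAssoc \<M> ?I x m)) \<cdot>\<^sub>M ?b =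
      (?I \<triangleright> MUnit \<M> (x \<rhd>\<^sub>O m)) \<cdot>\<^sub>M (?I \<triangleright> MAssoc \<M> ?I x m) \<cdot>\<^sub>M ?b"
    using ActA_Comp_fuse[of "Id C ?I" "Id C ?I" "MAssoc \<M> ?I x m" "MUnit \<M> (x \<rhd>\<^sub>O m)", symmetric]
    by simp
  also have "(?I \<triangleright> MAssoc \<M> ?I x m) \<cdot>\<^sub>M ?b =
      MAssoc \<M> ?I ?I (x \<rhd>\<^sub>O m) \<cdot>\<^sub>M MAssoc \<M> (?I \<otimes>\<^sub>O ?I) x m"
    by (rule module_pentagon[symmetric]) auto
  also have "(?I \<triangleright> MUnit \<M> (x \<rhd>\<^sub>O m)) \<cdot>\<^sub>M \<dots> =
      ((?I \<triangleright> MUnit \<M> (x \<rhd>\<^sub>O m)) \<cdot>\<^sub>M MAssoc \<M> ?I ?I (x \<rhd>\<^sub>O m)) \<cdot>\<^sub>M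
        MAssoc \<M> (?I \<otimes>\<^sub>O ?I) x m"
    by simp
  also have "\<dots> = (RUnit C ?I \<rhd>\<^sub>M x \<triangleright> Id \<M> m) \<cdot>\<^sub>M MAssoc \<M> (?I \<otimes>\<^sub>O ?I) x m"
    by (subst module_triangle) auto
  also have "\<dots> = MAssoc \<M> ?I x m \<cdot>\<^sub>M ((RUnit C ?I \<otimes>\<^sub>C Id C x) \<rhd>\<^sub>M Id \<M> m)"
    by (rule MAssoc_nat[symmetric]) auto
  also have "RUnit C ?I \<otimes>\<^sub>C Id C x = (Id C ?I \<otimes>\<^sub>C LUnit C x) \<cdot>\<^sub>C Assoc C ?I ?I x"
    by (rule C.triangle[symmetric]) auto
  also have "\<dots> \<rhd>\<^sub>M Id \<M> m = ((Id C ?I \<otimes>\<^sub>C LUnit C x) \<rhd>\<^sub>M Id \<M> m) \<cdot>\<^sub>M (Assoc C ?I ?I x \<rhd>\<^sub>M Id \<M> m)"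
    by (subst ActA_Comp_fuse) auto
  also have "MAssoc \<M> ?I x m \<cdot>\<^sub>M \<dots> =
      (MAssoc \<M> ?I x m \<cdot>\<^sub>M ((Id C ?I \<otimes>\<^sub>C LUnit C x) \<rhd>\<^sub>M Id \<M> m)) \<cdot>\<^sub>M (Assoc C ?I ?I x \<rhd>\<^sub>M Id \<M> m)"
    by simp
  also have "MAssoc \<M> ?I x m \<cdot>\<^sub>M ((Id C ?I \<otimes>\<^sub>C LUnit C x) \<rhd>\<^sub>M Id \<M> m) =
      (?I \<triangleright> LUnit C x \<rhd>\<^sub>M Id \<M> m) \<cdot>\<^sub>M MAssoc \<M> ?I (?I \<otimes>\<^sub>O x) m"
    by (rule MAssoc_nat) auto
  also have "\<dots> \<cdot>\<^sub>M (Assoc C ?I ?I x \<rhd>\<^sub>M Id \<M> m) = (?I \<triangleright> LUnit C x \<rhd>\<^sub>M Id \<M> m) \<cdot>\<^sub>M ?b"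
    by simp
  finally have "?I \<triangleright> (MUnit \<M> (x \<rhd>\<^sub>O m) \<cdot>\<^sub>M MAssoc \<M> ?I x m) =
      ?I \<triangleright> LUnit C x \<rhd>\<^sub>M Id \<M> m"
    by (rule M.iso_cancel_right[rotated]) auto
  then show ?thesis
    by (rule UnitO_faithful) (auto simp: in_hom_iff)
qed

text \<open>
  If \<open>y\<close> is a left dual of \<open>x\<close>, then \<open>y \<otimes> \<bullet>\<close> is left adjoint to \<open>x \<otimes> \<bullet>\<close> on every module category;
  these are the two transpositions of the adjunction.
\<close>

definition flat :: "'a \<Rightarrow> 'o \<Rightarrow> 'o \<Rightarrow> 'p \<Rightarrow> 'b \<Rightarrow> 'b" where
  "flat e y x P f =
     MUnit \<M> P \<cdot>\<^sub>M (e \<rhd>\<^sub>M Id \<M> P) \<cdot>\<^sub>M inverse_arrow \<M> (MAssoc \<M> y x P) \<cdot>\<^sub>M (y \<triangleright> f)"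

definition sharp :: "'a \<Rightarrow> 'o \<Rightarrow> 'o \<Rightarrow> 'p \<Rightarrow> 'b \<Rightarrow> 'b" where
  "sharp d y x N g =
     (x \<triangleright> g) \<cdot>\<^sub>M MAssoc \<M> x y N \<cdot>\<^sub>M (d \<rhd>\<^sub>M Id \<M> N) \<cdot>\<^sub>M inverse_arrow \<M> (MUnit \<M> N)"

lemma flat_hom:
  assumes "dual_pair C y x e d" "f \<in> hom_set \<M> N (x \<rhd>\<^sub>O P)" "P \<in> Obj \<M>"
  shows "flat e y x P f \<in> hom_set \<M> (y \<rhd>\<^sub>O N) P"
  using assms C.dual_pair_simps[OF assms(1)] unfolding flat_def by (auto simp: in_hom_iff)

text \<open>
  By naturality the composite is \<open>f\<close> followed by an endomorphism \<open>Z\<close> of \<open>x \<otimes> P\<close>; the pentagon, the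
  triangle and the coherence law for the unit identify \<open>Z\<close> with the action of the zigzag at \<open>x\<close>.
\<close>

lemma sharp_flat:
  assumes dual: "dual_pair C y x e d" and f_hom: "f \<in> hom_set \<M> N (x \<rhd>\<^sub>O P)" and P [simp]: "P \<in> Obj \<M>"
  shows "sharp d y x N (flat e y x P f) = f"
proof -
  note [simp] = C.dual_pair_simps[OF dual]
  have f [simp]: "f \<in> Arr \<M>" "Dom \<M> f = N" "Cod \<M> f = x \<rhd>\<^sub>O P"
    using f_hom by (auto simp: in_hom_iff)
  have N [simp]: "N \<in> Obj \<M>"
    using M.Dom_Obj[OF f(1)] by simp
  define v where "v = MUnit \<M> P \<cdot>\<^sub>M (e \<rhd>\<^sub>M Id \<M> P) \<cdot>\<^sub>M inverse_arrow \<M> (MAssoc \<M> y x P)"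
  have v [simp]: "v \<in> Arr \<M>" "Dom \<M> v = y \<rhd>\<^sub>O x \<rhd>\<^sub>O P" "Cod \<M> v = P"
    by (auto simp: v_def)
  define Z where "Z = (x \<triangleright> v) \<cdot>\<^sub>M MAssoc \<M> x y (x \<rhd>\<^sub>O P) \<cdot>\<^sub>M (d \<rhd>\<^sub>M Id \<M> (x \<rhd>\<^sub>O P)) \<cdot>\<^sub>M
    inverse_arrow \<M> (MUnit \<M> (x \<rhd>\<^sub>O P))"
  have Z [simp]: "Z \<in> Arr \<M>" "Dom \<M> Z = x \<rhd>\<^sub>O P" "Cod \<M> Z = x \<rhd>\<^sub>O P"
    by (auto simp: Z_def)
  have "sharp d y x N (flat e y x P f) = (x \<triangleright> (v \<cdot>\<^sub>M (y \<triangleright> f))) \<cdot>\<^sub>M MAssoc \<M> x y N \<cdot>\<^sub>M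
      (d \<rhd>\<^sub>M Id \<M> N) \<cdot>\<^sub>M inverse_arrow \<M> (MUnit \<M> N)"
    by (simp add: sharp_def flat_def v_def)
  also have "x \<triangleright> (v \<cdot>\<^sub>M (y \<triangleright> f)) = (x \<triangleright> v) \<cdot>\<^sub>M (x \<triangleright> y \<triangleright> f)"
    by (subst ActA_Comp_fuse) auto
  also have "\<dots> \<cdot>\<^sub>M MAssoc \<M> x y N \<cdot>\<^sub>M (d \<rhd>\<^sub>M Id \<M> N) \<cdot>\<^sub>M inverse_arrow \<M> (MUnit \<M> N) =
      (x \<triangleright> v) \<cdot>\<^sub>M ((x \<triangleright> y \<triangleright> f) \<cdot>\<^sub>M MAssoc \<M> x y N) \<cdot>\<^sub>M
        (d \<rhd>\<^sub>M Id \<M> N) \<cdot>\<^sub>M inverse_arrow \<M> (MUnit \<M> N)"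
    by simp
  also have "(x \<triangleright> y \<triangleright> f) \<cdot>\<^sub>M MAssoc \<M> x y N =
      MAssoc \<M> x y (x \<rhd>\<^sub>O P) \<cdot>\<^sub>M ((x \<otimes>\<^sub>O y) \<triangleright> f)"
    using MAssoc_natural[OF C.Id_hom[of x] C.Id_hom[of y] f_hom] by simp
  also have "(x \<triangleright> v) \<cdot>\<^sub>M \<dots> \<cdot>\<^sub>M (d \<rhd>\<^sub>M Id \<M> N) \<cdot>\<^sub>M inverse_arrow \<M> (MUnit \<M> N) =
      (x \<triangleright> v) \<cdot>\<^sub>M MAssoc \<M> x y (x \<rhd>\<^sub>O P) \<cdot>\<^sub>M
        (((x \<otimes>\<^sub>O y) \<triangleright> f) \<cdot>\<^sub>M (d \<rhd>\<^sub>M Id \<M> N)) \<cdot>\<^sub>M inverse_arrow \<M> (MUnit \<M> N)"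
    by simp
  also have "((x \<otimes>\<^sub>O y) \<triangleright> f) \<cdot>\<^sub>M (d \<rhd>\<^sub>M Id \<M> N) =
      (d \<rhd>\<^sub>M Id \<M> (x \<rhd>\<^sub>O P)) \<cdot>\<^sub>M ((UnitO C) \<triangleright> f)"
    by (simp add: ActA_Comp_fuse)
  also have "(UnitO C) \<triangleright> f = inverse_arrow \<M> (MUnit \<M> (x \<rhd>\<^sub>O P)) \<cdot>\<^sub>M f \<cdot>\<^sub>M MUnit \<M> N"
    using MUnit_natural[OF f_hom, symmetric] by simp
  also have "(x \<triangleright> v) \<cdot>\<^sub>M MAssoc \<M> x y (x \<rhd>\<^sub>O P) \<cdot>\<^sub>M
        ((d \<rhd>\<^sub>M Id \<M> (x \<rhd>\<^sub>O P)) \<cdot>\<^sub>M \<dots>) \<cdot>\<^sub>M inverse_arrow \<M> (MUnit \<M> N) = Z \<cdot>\<^sub>M f"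
    by (simp add: Z_def)
  also have "Z = Id \<M> (x \<rhd>\<^sub>O P)"
  proof -
    let ?k = "MUnit \<M> (x \<rhd>\<^sub>O P) \<cdot>\<^sub>M MAssoc \<M> (UnitO C) x P"
    have "Z \<cdot>\<^sub>M ?k = (x \<triangleright> v) \<cdot>\<^sub>M MAssoc \<M> x y (x \<rhd>\<^sub>O P) \<cdot>\<^sub>M
        ((d \<rhd>\<^sub>M x \<triangleright> Id \<M> P) \<cdot>\<^sub>M MAssoc \<M> (UnitO C) x P)"
      by (simp add: Z_def)
    also have "(d \<rhd>\<^sub>M x \<triangleright> Id \<M> P) \<cdot>\<^sub>M MAssoc \<M> (UnitO C) x P =
        MAssoc \<M> (x \<otimes>\<^sub>O y) x P \<cdot>\<^sub>M ((d \<otimes>\<^sub>C Id C x) \<rhd>\<^sub>M Id \<M> P)"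
      by (rule MAssoc_nat[symmetric]) auto
    also have "(x \<triangleright> v) \<cdot>\<^sub>M MAssoc \<M> x y (x \<rhd>\<^sub>O P) \<cdot>\<^sub>M \<dots> =
        (x \<triangleright> v) \<cdot>\<^sub>M (MAssoc \<M> x y (x \<rhd>\<^sub>O P) \<cdot>\<^sub>M MAssoc \<M> (x \<otimes>\<^sub>O y) x P) \<cdot>\<^sub>M
          ((d \<otimes>\<^sub>C Id C x) \<rhd>\<^sub>M Id \<M> P)"
      by simp
    also have "MAssoc \<M> x y (x \<rhd>\<^sub>O P) \<cdot>\<^sub>M MAssoc \<M> (x \<otimes>\<^sub>O y) x P =
        (x \<triangleright> MAssoc \<M> y x P) \<cdot>\<^sub>M MAssoc \<M> x (y \<otimes>\<^sub>O x) P \<cdot>\<^sub>M (Assoc C x y x \<rhd>\<^sub>M Id \<M> P)"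
      by (rule module_pentagon) auto
    also have "(x \<triangleright> v) \<cdot>\<^sub>M \<dots> \<cdot>\<^sub>M ((d \<otimes>\<^sub>C Id C x) \<rhd>\<^sub>M Id \<M> P) =
        ((x \<triangleright> v) \<cdot>\<^sub>M (x \<triangleright> MAssoc \<M> y x P)) \<cdot>\<^sub>M MAssoc \<M> x (y \<otimes>\<^sub>O x) P \<cdot>\<^sub>M
          (Assoc C x y x \<rhd>\<^sub>M Id \<M> P) \<cdot>\<^sub>M ((d \<otimes>\<^sub>C Id C x) \<rhd>\<^sub>M Id \<M> P)"
      by simp
    also have "(x \<triangleright> v) \<cdot>\<^sub>M (x \<triangleright> MAssoc \<M> y x P) =
        (x \<triangleright> MUnit \<M> P) \<cdot>\<^sub>M (x \<triangleright> e \<rhd>\<^sub>M Id \<M> P)"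
      by (simp add: v_def ActA_Comp_fuse)
    also have "\<dots> \<cdot>\<^sub>M MAssoc \<M> x (y \<otimes>\<^sub>O x) P \<cdot>\<^sub>M
          (Assoc C x y x \<rhd>\<^sub>M Id \<M> P) \<cdot>\<^sub>M ((d \<otimes>\<^sub>C Id C x) \<rhd>\<^sub>M Id \<M> P) =
        (x \<triangleright> MUnit \<M> P) \<cdot>\<^sub>M ((x \<triangleright> e \<rhd>\<^sub>M Id \<M> P) \<cdot>\<^sub>M MAssoc \<M> x (y \<otimes>\<^sub>O x) P) \<cdot>\<^sub>M
          (Assoc C x y x \<rhd>\<^sub>M Id \<M> P) \<cdot>\<^sub>M ((d \<otimes>\<^sub>C Id C x) \<rhd>\<^sub>M Id \<M> P)"
      by simp
    also have "(x \<triangleright> e \<rhd>\<^sub>M Id \<M> P) \<cdot>\<^sub>M MAssoc \<M> x (y \<otimes>\<^sub>O x) P =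
        MAssoc \<M> x (UnitO C) P \<cdot>\<^sub>M ((Id C x \<otimes>\<^sub>C e) \<rhd>\<^sub>M Id \<M> P)"
      by (rule MAssoc_nat[symmetric]) auto
    also have "(x \<triangleright> MUnit \<M> P) \<cdot>\<^sub>M \<dots> \<cdot>\<^sub>M
          (Assoc C x y x \<rhd>\<^sub>M Id \<M> P) \<cdot>\<^sub>M ((d \<otimes>\<^sub>C Id C x) \<rhd>\<^sub>M Id \<M> P) =
        ((x \<triangleright> MUnit \<M> P) \<cdot>\<^sub>M MAssoc \<M> x (UnitO C) P) \<cdot>\<^sub>M ((Id C x \<otimes>\<^sub>C e) \<rhd>\<^sub>M Id \<M> P) \<cdot>\<^sub>M
          (Assoc C x y x \<rhd>\<^sub>M Id \<M> P) \<cdot>\<^sub>M ((d \<otimes>\<^sub>C Id C x) \<rhd>\<^sub>M Id \<M> P)"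
      by simp
    also have "\<dots> = (RUnit C x \<cdot>\<^sub>C (Id C x \<otimes>\<^sub>C e) \<cdot>\<^sub>C Assoc C x y x \<cdot>\<^sub>C (d \<otimes>\<^sub>C Id C x)) \<rhd>\<^sub>M Id \<M> P"
      by (subst module_triangle) (auto simp: ActA_Comp_fuse)
    also have "\<dots> = Id \<M> (x \<rhd>\<^sub>O P) \<cdot>\<^sub>M ?k"
      unfolding C.dual_pair_zigzag[OF dual] by (simp add: MUnit_ActO)
    finally show ?thesis
      by (rule M.iso_cancel_right[rotated]) auto
  qed
  also have "Id \<M> (x \<rhd>\<^sub>O P) \<cdot>\<^sub>M f = f"
    by simp
  finally show ?thesis .
qed

end

section \<open>The category of right modules over an algebra\<close>

definition module_map ::
  "('k, 'o, 'a, 'z) mon_cat_scheme \<Rightarrow> ('o, 'a) alg \<Rightarrow> 'o \<times> 'a \<Rightarrow> 'a \<Rightarrow> 'o \<times> 'a \<Rightarrow> bool" where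
  "module_map C B S f T \<longleftrightarrow> right_module C B S \<and> right_module C B T \<and>
     f \<in> Arr C \<and> Dom C f = fst S \<and> Cod C f = fst T \<and>
     f \<cdot>\<^bsub>C\<^esub> snd S = snd T \<cdot>\<^bsub>C\<^esub> (f \<otimes>\<^sub>a\<^bsub>C\<^esub> Id C (ACarr B))"

lemma Mod_cat_simps [simp]:
  "S \<in> Obj (Mod_cat C B) \<longleftrightarrow> right_module C B S"
  "(S, f, T) \<in> Arr (Mod_cat C B) \<longleftrightarrow> module_map C B S f T"
  "Dom (Mod_cat C B) (S, f, T) = S" "Cod (Mod_cat C B) (S, f, T) = T"
  "Id (Mod_cat C B) S = (S, Id C (fst S), S)"
  "(T', g, Q) \<cdot>\<^bsub>Mod_cat C B\<^esub> (S, f, T) = (S, g \<cdot>\<^bsub>C\<^esub> f, Q)"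
  "Zero_arr (Mod_cat C B) S T = (S, Zero_arr C (fst S) (fst T), T)"
  "Add_arr (Mod_cat C B) (S, f, T) (S', g, T') = (S, Add_arr C f g, T)"
  "Smult_arr (Mod_cat C B) c (S, f, T) = (S, Smult_arr C c f, T)"
  by (auto simp: Mod_cat_def module_map_def in_hom_iff)

lemma Mod_cat_hom_iff:
  "F \<in> hom_set (Mod_cat C B) S T \<longleftrightarrow> (\<exists>f. F = (S, f, T) \<and> module_map C B S f T)"
  by (cases F) (auto simp: in_hom_iff)

context linear_monoidal_category
begin

lemma right_module_simps:
  assumes "right_module C B S"
  shows "fst S \<in> Obj C" "snd S \<in> Arr C" "Dom C (snd S) = fst S \<otimes>\<^sub>o\<^bsub>C\<^esub> ACarr B" "Cod C (snd S) = fst S"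
  using assms by (auto simp: right_module_def in_hom_iff split: prod.splits)

lemma module_mapD:
  assumes "module_map C B S f T"
  shows "right_module C B S" "right_module C B T" "f \<in> Arr C" "Dom C f = fst S" "Cod C f = fst T"
    "f \<star> snd S = snd T \<star> (f \<otimes>\<^sub>a\<^bsub>C\<^esub> Id C (ACarr B))"
  using assms by (simp_all add: module_map_def)

lemma TenA_add_whisker:
  assumes "f \<in> Arr C" "g \<in> Arr C" "Dom C f = Dom C g" "Cod C f = Cod C g" "x \<in> Obj C"
  shows "Add_arr C f g \<otimes>\<^sub>a\<^bsub>C\<^esub> Id C x = Add_arr C (f \<otimes>\<^sub>a\<^bsub>C\<^esub> Id C x) (g \<otimes>\<^sub>a\<^bsub>C\<^esub> Id C x)"
  using assms by (intro TenA_add_left[where v = x and w = x]) (auto simp: in_hom_iff)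

lemma TenA_smult_whisker:
  assumes "c \<in> carrier K" "f \<in> Arr C" "x \<in> Obj C"
  shows "Smult_arr C c f \<otimes>\<^sub>a\<^bsub>C\<^esub> Id C x = Smult_arr C c (f \<otimes>\<^sub>a\<^bsub>C\<^esub> Id C x)"
  using assms by (intro TenA_smult_left[where v = x and w = x]) (auto simp: in_hom_iff)

lemma TenA_zero_whisker:
  assumes "x \<in> Obj C" "y \<in> Obj C" "z \<in> Obj C"
  shows "Zero_arr C x y \<otimes>\<^sub>a\<^bsub>C\<^esub> Id C z = Zero_arr C (x \<otimes>\<^sub>o\<^bsub>C\<^esub> z) (y \<otimes>\<^sub>o\<^bsub>C\<^esub> z)"
  using additive_zero[of "hom_space C x y" "hom_space C (x \<otimes>\<^sub>o\<^bsub>C\<^esub> z) (y \<otimes>\<^sub>o\<^bsub>C\<^esub> z)"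
      "\<lambda>f. f \<otimes>\<^sub>a\<^bsub>C\<^esub> Id C z"] assms
  by (auto simp: hom_abelian_group TenA_add_whisker in_hom_iff)

lemma module_map_Id:
  assumes "ACarr B \<in> Obj C" "right_module C B S"
  shows "module_map C B S (Id C (fst S)) S"
  using assms right_module_simps[OF assms(2)] by (simp add: module_map_def)

lemma module_map_Comp:
  assumes B: "ACarr B \<in> Obj C" and f: "module_map C B S f T" and g: "module_map C B T g Q"
  shows "module_map C B S (g \<star> f) Q"
proof -
  note fD = module_mapD[OF f] and gD = module_mapD[OF g]
  note [simp] = right_module_simps[OF fD(1)] right_module_simps[OF gD(1)] right_module_simps[OF gD(2)]
    fD(3-5) gD(3-5) B
  have "(g \<star> f) \<star> snd S = (g \<star> snd T) \<star> (f \<otimes>\<^sub>a\<^bsub>C\<^esub> Id C (ACarr B))"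
    by (simp add: fD(6))
  also have "\<dots> = snd Q \<star> ((g \<star> f) \<otimes>\<^sub>a\<^bsub>C\<^esub> Id C (ACarr B))"
    unfolding gD(6) by (simp add: TenA_Comp_fuse)
  finally show ?thesis
    using fD(1) gD(2) by (simp add: module_map_def)
qed

lemma module_map_Zero:
  assumes "ACarr B \<in> Obj C" "right_module C B S" "right_module C B T"
  shows "module_map C B S (Zero_arr C (fst S) (fst T)) T"
  using assms right_module_simps[OF assms(2)] right_module_simps[OF assms(3)]
  by (simp add: module_map_def TenA_zero_whisker)

lemma module_map_Add:
  assumes B: "ACarr B \<in> Obj C" and f: "module_map C B S f T" and g: "module_map C B S g T"
  shows "module_map C B S (Add_arr C f g) T"
  using B f g right_module_simps[OF module_mapD(1)[OF f]] right_module_simps[OF module_mapD(2)[OF f]]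
  by (simp add: module_map_def TenA_add_whisker Comp_Add)

lemma module_map_Smult:
  assumes B: "ACarr B \<in> Obj C" and f: "module_map C B S f T" and c: "c \<in> carrier K"
  shows "module_map C B S (Smult_arr C c f) T"
  using B f c right_module_simps[OF module_mapD(1)[OF f]] right_module_simps[OF module_mapD(2)[OF f]]
  by (simp add: module_map_def TenA_smult_whisker Comp_Smult)

lemma module_map_uminus:
  assumes B: "ACarr B \<in> Obj C" and f: "module_map C B S f T"
  shows "\<exists>h. module_map C B S h T \<and> Add_arr C h f = Zero_arr C (fst S) (fst T)"
proof -
  note ST = module_mapD(1,2)[OF f] and eq = module_mapD(6)[OF f]
  note [simp] = right_module_simps[OF ST(1)] right_module_simps[OF ST(2)] B module_mapD(3-5)[OF f]
  have "Zero_arr C (fst S) (fst T) \<in> Hom (fst S) (fst T)" "f \<in> Hom (fst S) (fst T)"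
    by (auto simp: in_hom_iff)
  then obtain h where "h \<in> Hom (fst S) (fst T)" and hf: "Add_arr C h f = Zero_arr C (fst S) (fst T)"
    by (rule Add_solve)
  then have [simp]: "h \<in> Arr C" "Dom C h = fst S" "Cod C h = fst T"
    by (auto simp: in_hom_iff)
  have "Add_arr C (h \<star> snd S) (f \<star> snd S) = Add_arr C h f \<star> snd S"
    by (simp add: Comp_Add)
  also have "\<dots> = snd T \<star> (Add_arr C h f \<otimes>\<^sub>a\<^bsub>C\<^esub> Id C (ACarr B))"
    by (simp add: hf TenA_zero_whisker)
  also have "\<dots> = Add_arr C (snd T \<star> (h \<otimes>\<^sub>a\<^bsub>C\<^esub> Id C (ACarr B))) (f \<star> snd S)"
    by (simp add: eq TenA_add_whisker Comp_Add)
  finally have "h \<star> snd S = snd T \<star> (h \<otimes>\<^sub>a\<^bsub>C\<^esub> Id C (ACarr B))"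
    by (rule Add_cancel_right[where x = "fst S \<otimes>\<^sub>o\<^bsub>C\<^esub> ACarr B" and y = "fst T"]) (auto simp: in_hom_iff)
  then show ?thesis
    using ST hf by (intro exI[of _ h]) (simp add: module_map_def)
qed

lemma hom_module_rules:
  assumes "x \<in> Obj C" "y \<in> Obj C" "f \<in> Hom x y"
  shows "\<lbrakk>g \<in> Hom x y; h \<in> Hom x y\<rbrakk> \<Longrightarrow> Add_arr C (Add_arr C f g) h = Add_arr C f (Add_arr C g h)"
    "g \<in> Hom x y \<Longrightarrow> Add_arr C f g = Add_arr C g f"
    "\<lbrakk>c \<in> carrier K; c' \<in> carrier K\<rbrakk> \<Longrightarrow>
      Smult_arr C (c \<oplus> c') f = Add_arr C (Smult_arr C c f) (Smult_arr C c' f)"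
    "\<lbrakk>g \<in> Hom x y; c \<in> carrier K\<rbrakk> \<Longrightarrow>
      Smult_arr C c (Add_arr C f g) = Add_arr C (Smult_arr C c f) (Smult_arr C c g)"
    "\<lbrakk>c \<in> carrier K; c' \<in> carrier K\<rbrakk> \<Longrightarrow> Smult_arr C (c \<otimes> c') f = Smult_arr C c (Smult_arr C c' f)"
    "Smult_arr C \<one> f = f"
proof -
  interpret G: module K "hom_space C x y"
    using assms by (intro hom_module)
  note laws = G.add.m_assoc[of f g h] G.add.m_comm[of f g] G.smult_l_distr[of c c' f]
    G.smult_r_distr[of c f g] G.smult_assoc1[of c c' f] G.smult_one[of f]
  show "Add_arr C (Add_arr C f g) h = Add_arr C f (Add_arr C g h)" if "g \<in> Hom x y" "h \<in> Hom x y"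
    using assms laws(1) that by simp
  show "Add_arr C f g = Add_arr C g f" if "g \<in> Hom x y"
    using assms laws(2) that by simp
  show "Smult_arr C (c \<oplus> c') f = Add_arr C (Smult_arr C c f) (Smult_arr C c' f)"
    if "c \<in> carrier K" "c' \<in> carrier K"
    using assms laws(3) that by simp
  show "Smult_arr C c (Add_arr C f g) = Add_arr C (Smult_arr C c f) (Smult_arr C c g)"
    if "g \<in> Hom x y" "c \<in> carrier K"
    using assms laws(4) that by simp
  show "Smult_arr C (c \<otimes> c') f = Smult_arr C c (Smult_arr C c' f)"
    if "c \<in> carrier K" "c' \<in> carrier K"
    using assms laws(5) that by simp
  show "Smult_arr C \<one> f = f"
    using assms laws(6) by simp
qed

theorem Mod_cat_linear:
  assumes B: "ACarr B \<in> Obj C"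
  shows "linear_category K (Mod_cat C B)"
proof (intro linear_category.intro category.intro linear_category_axioms.intro)
  show "field K"
    by (rule field_axioms)
next
  fix S T
  assume "S \<in> Obj (Mod_cat C B)" "T \<in> Obj (Mod_cat C B)"
  then have ST: "right_module C B S" "right_module C B T"
    by auto
  note [simp] = right_module_simps[OF ST(1)] right_module_simps[OF ST(2)] B
  have hom: "f \<in> Hom (fst S) (fst T)" if "module_map C B S f T" for f
    using that by (simp add: module_map_def in_hom_iff)
  note rules = hom_module_rules[of "fst S" "fst T", OF _ _ hom]
  note closed = module_map_Zero[OF B ST] module_map_Add[OF B] module_map_Smult[OF B]
  show "module K (hom_space (Mod_cat C B) S T)"
  proof (rule moduleI)
    show "cring K"
      by (rule is_cring)
    show "abelian_group (hom_space (Mod_cat C B) S T)"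
    proof (rule abelian_groupI, goal_cases)
      case (3 f g h)
      then show ?case
        using rules(1)[OF _ _ _ hom hom] by (auto simp: Mod_cat_hom_iff)
    next
      case (4 f g)
      then show ?case
        using rules(2)[OF _ _ _ hom] by (auto simp: Mod_cat_hom_iff)
    next
      case (6 f)
      then obtain f' where f': "f = (S, f', T)" "module_map C B S f' T"
        by (auto simp: Mod_cat_hom_iff)
      then obtain h where "module_map C B S h T" "Add_arr C h f' = Zero_arr C (fst S) (fst T)"
        using module_map_uminus[OF B] by blast
      then show ?case
        using f' by (intro bexI[of _ "(S, h, T)"]) (auto simp: Mod_cat_hom_iff)
    qed (use closed in \<open>auto simp: Mod_cat_hom_iff module_map_def\<close>)
  qed (use closed rules(3) rules(4)[OF _ _ _ hom] rules(5,6) in \<open>auto simp: Mod_cat_hom_iff\<close>)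
next
  show "Id (Mod_cat C B) S \<in> hom_set (Mod_cat C B) S S" if "S \<in> Obj (Mod_cat C B)" for S
    using that B by (simp add: Mod_cat_hom_iff module_map_Id)
  show "g \<cdot>\<^bsub>Mod_cat C B\<^esub> f \<in> hom_set (Mod_cat C B) S Q"
    if "f \<in> hom_set (Mod_cat C B) S T" "g \<in> hom_set (Mod_cat C B) T Q" for f g S T Q
    using that by (auto simp: Mod_cat_hom_iff intro: module_map_Comp[OF B])
qed (auto simp: Mod_cat_hom_iff module_map_def Comp_Add Comp_Smult)

lemma Mod_cat_iso:
  assumes B: "ACarr B \<in> Obj C" and f: "module_map C B S f T" and iso: "iso_arrow C f"
  shows "iso_arrow (Mod_cat C B) (S, f, T)"
proof -
  note ST = module_mapD(1,2)[OF f] and eq = module_mapD(6)[OF f]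
  note [simp] = right_module_simps[OF ST(1)] right_module_simps[OF ST(2)] B iso module_mapD(3-5)[OF f]
  let ?g = "inverse_arrow C f"
  have "?g \<star> snd T = ?g \<star> (snd T \<star> (f \<otimes>\<^sub>a\<^bsub>C\<^esub> Id C (ACarr B))) \<star> (?g \<otimes>\<^sub>a\<^bsub>C\<^esub> Id C (ACarr B))"
    by (simp add: TenA_Comp_fuse)
  also have "\<dots> = snd S \<star> (?g \<otimes>\<^sub>a\<^bsub>C\<^esub> Id C (ACarr B))"
    unfolding eq[symmetric] by simp
  finally have "module_map C B T ?g S"
    using ST by (simp add: module_map_def)
  then show ?thesis
    using f unfolding iso_arrow_def inverse_arrows_def
    by (intro exI[of _ "(T, ?g, S)"]) (auto simp: Mod_cat_hom_iff)
qed

end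


section \<open>Internal Homs out of a fixed object\<close>

locale internal_hom_source = module_category K C \<M>
  for K :: "('k, 'r) ring_scheme" (structure)
    and C :: "('k, 'o, 'a, 'z) mon_cat_scheme"
    and \<M> :: "('k, 'o, 'a, 'p, 'b, 'y) mod_cat_scheme" +
  fixes I :: "('o, 'a, 'p, 'b) ihoms" and M :: 'p
  assumes ihoms: "internal_homs C \<M> I" and M_Obj [simp]: "M \<in> Obj \<M>"
begin

abbreviation H :: "'p \<Rightarrow> 'o" where "H V \<equiv> IHom I M V"
abbreviation A :: 'o where "A \<equiv> IHom I M M"
abbreviation Alg :: "('o, 'a) alg" where "Alg \<equiv> ihom_alg C \<M> I M"
abbreviation ev :: "'p \<Rightarrow> 'b" where "ev V \<equiv> ihom_ev C I M V"
abbreviation \<mu> :: "'p \<Rightarrow> 'a" where "\<mu> V \<equiv> ihom_mu C \<M> I M M V"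
abbreviation u :: 'a where "u \<equiv> AUnit Alg"
abbreviation tr :: "'p \<Rightarrow> 'o \<Rightarrow> 'b \<Rightarrow> 'a" where "tr V X f \<equiv> ihom_transpose C I M V X f"
abbreviation R :: "'a \<Rightarrow> 'b" where "R f \<equiv> f \<rhd>\<^sub>M Id \<M> M"
abbreviation hm :: "'p \<Rightarrow> 'o \<times> 'a" where "hm V \<equiv> ihom_module C \<M> I M V"

text \<open>
  The action \<open>A \<otimes> M \<rightarrow> M\<close>, tensored with \<open>X\<close>. It is the evaluation of \<open>X \<otimes> M\<close> once \<open>X \<otimes> A\<close> is
  identified with \<open>Hom(M, X \<otimes> M)\<close>.
\<close>

definition act :: "'o \<Rightarrow> 'b" where
  "act X = (X \<triangleright> ev M) \<cdot>\<^sub>M MAssoc \<M> X A M"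

lemma R_Comp [simp]:
  assumes "f \<in> Arr C" "g \<in> Arr C" "Cod C f = Dom C g"
  shows "R (g \<cdot>\<^sub>C f) = R g \<cdot>\<^sub>M R f"
  using assms by (simp add: ActA_Comp_fuse)

lemma R_Add:
  assumes "f \<in> Arr C" "g \<in> Arr C" "Dom C f = Dom C g" "Cod C f = Cod C g"
  shows "R (Add_arr C f g) = Add_arr \<M> (R f) (R g)"
  using assms by (intro ActA_add_left[where m = M and n = M]) (auto simp: in_hom_iff)

lemma R_Smult:
  assumes "c \<in> carrier K" "f \<in> Arr C"
  shows "R (Smult_arr C c f) = Smult_arr \<M> c (R f)"
  using assms by (intro ActA_smult_left[where m = M and n = M]) (auto simp: in_hom_iff)

lemma represents: "V \<in> Obj \<M> \<Longrightarrow> represents_internal_hom C \<M> M V (H V) (Rep I M V)"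
  using ihoms by (simp add: internal_homs_def)

lemma H_Obj [simp]: "V \<in> Obj \<M> \<Longrightarrow> H V \<in> Obj C"
  using represents by (simp add: represents_internal_hom_def)

lemma Rep_bij:
  "\<lbrakk>V \<in> Obj \<M>; X \<in> Obj C\<rbrakk> \<Longrightarrow> bij_betw (Rep I M V X) (hom_set C X (H V)) (hom_set \<M> (X \<rhd>\<^sub>O M) V)"
  using represents by (simp add: represents_internal_hom_def)

lemma ev_simps [simp]:
  assumes "V \<in> Obj \<M>"
  shows "ev V \<in> Arr \<M>" "Dom \<M> (ev V) = H V \<rhd>\<^sub>O M" "Cod \<M> (ev V) = V"
proof -
  have "ev V \<in> hom_set \<M> (H V \<rhd>\<^sub>O M) V"
    unfolding ihom_ev_def using assms by (intro bij_betwE[OF Rep_bij, rule_format]) (auto simp: in_hom_iff)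
  then show "ev V \<in> Arr \<M>" "Dom \<M> (ev V) = H V \<rhd>\<^sub>O M" "Cod \<M> (ev V) = V"
    by (auto simp: in_hom_iff)
qed

text \<open>By the Yoneda lemma the representing bijection is given by the evaluation.\<close>

lemma Rep_eq:
  assumes V: "V \<in> Obj \<M>" and g: "g \<in> hom_set C X (H V)"
  shows "Rep I M V X g = ev V \<cdot>\<^sub>M R g"
proof -
  have g': "g \<in> Arr C" "Dom C g = X" "Cod C g = H V"
    using g by (auto simp: in_hom_iff)
  then have X: "X \<in> Obj C"
    using C.Dom_Obj[of g] by simp
  have "Rep I M V X (Id C (H V) \<cdot>\<^sub>C g) = Rep I M V (H V) (Id C (H V)) \<cdot>\<^sub>M R g"
    using represents[OF V] V X g C.Id_hom[of "H V"] unfolding represents_internal_hom_def by blast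
  then show ?thesis
    using g' by (simp add: ihom_ev_def)
qed

lemma transpose:
  assumes V: "V \<in> Obj \<M>" and X: "X \<in> Obj C" and f: "f \<in> hom_set \<M> (X \<rhd>\<^sub>O M) V"
  shows "tr V X f \<in> Arr C" "Dom C (tr V X f) = X" "Cod C (tr V X f) = H V"
    "ev V \<cdot>\<^sub>M R (tr V X f) = f"
proof -
  note bij = Rep_bij[OF V X]
  have t: "tr V X f \<in> hom_set C X (H V)"
    unfolding ihom_transpose_def
    using bij f by (intro the_inv_into_into) (auto simp: bij_betw_def)
  then show "tr V X f \<in> Arr C" "Dom C (tr V X f) = X" "Cod C (tr V X f) = H V"
    by (auto simp: in_hom_iff)
  have "Rep I M V X (tr V X f) = f"
    unfolding ihom_transpose_def using bij f by (auto simp: bij_betw_def intro: f_the_inv_into_f)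
  then show "ev V \<cdot>\<^sub>M R (tr V X f) = f"
    using Rep_eq[OF V t] by simp
qed

lemma ev_cancel:
  assumes eq: "ev V \<cdot>\<^sub>M R f = ev V \<cdot>\<^sub>M R g" and V: "V \<in> Obj \<M>"
    and "f \<in> Arr C" "g \<in> Arr C" "Dom C f = Dom C g" "Cod C f = H V" "Cod C g = H V"
  shows "f = g"
proof -
  have "f \<in> hom_set C (Dom C g) (H V)" "g \<in> hom_set C (Dom C g) (H V)"
    using assms by (auto simp: in_hom_iff)
  moreover have "inj_on (Rep I M V (Dom C g)) (hom_set C (Dom C g) (H V))"
    using Rep_bij[OF V, of "Dom C g"] assms(4) by (auto simp: bij_betw_def)
  ultimately show ?thesis
    using eq Rep_eq[OF V] by (metis inj_onD)
qed

lemma act_simps [simp]: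
  assumes "X \<in> Obj C"
  shows "act X \<in> Arr \<M>" "Dom \<M> (act X) = (X \<otimes>\<^sub>O A) \<rhd>\<^sub>O M" "Cod \<M> (act X) = X \<rhd>\<^sub>O M"
  using assms by (simp_all add: act_def)

lemma act_natural:
  assumes "f \<in> Arr C" "Dom C f = X" "Cod C f = Y"
  shows "act Y \<cdot>\<^sub>M R (f \<otimes>\<^sub>C Id C A) = R f \<cdot>\<^sub>M act X"
proof -
  have [simp]: "X \<in> Obj C" "Y \<in> Obj C" "f \<in> Arr C" "Dom C f = X" "Cod C f = Y"
    using assms by auto
  have "act Y \<cdot>\<^sub>M R (f \<otimes>\<^sub>C Id C A) =
      (Y \<triangleright> ev M) \<cdot>\<^sub>M (MAssoc \<M> Y A M \<cdot>\<^sub>M R (f \<otimes>\<^sub>C Id C A))"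
    by (simp add: act_def)
  also have "MAssoc \<M> Y A M \<cdot>\<^sub>M R (f \<otimes>\<^sub>C Id C A) = (f \<rhd>\<^sub>M A \<triangleright> Id \<M> M) \<cdot>\<^sub>M MAssoc \<M> X A M"
    by (rule MAssoc_nat) auto
  also have "(Y \<triangleright> ev M) \<cdot>\<^sub>M \<dots> =
      ((Y \<triangleright> ev M) \<cdot>\<^sub>M (f \<rhd>\<^sub>M A \<triangleright> Id \<M> M)) \<cdot>\<^sub>M MAssoc \<M> X A M"
    by simp
  also have "(Y \<triangleright> ev M) \<cdot>\<^sub>M (f \<rhd>\<^sub>M A \<triangleright> Id \<M> M) = R f \<cdot>\<^sub>M (X \<triangleright> ev M)"
    by (simp add: ActA_Comp_fuse)
  finally show ?thesis
    by (simp add: act_def)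
qed

lemma mu:
  assumes V: "V \<in> Obj \<M>"
  shows "\<mu> V \<in> Arr C" "Dom C (\<mu> V) = H V \<otimes>\<^sub>O A" "Cod C (\<mu> V) = H V"
    "ev V \<cdot>\<^sub>M R (\<mu> V) = ev V \<cdot>\<^sub>M act (H V)"
  using transpose[of V "H V \<otimes>\<^sub>O A" "ev V \<cdot>\<^sub>M act (H V)"] V
  by (auto simp: ihom_mu_def act_def in_hom_iff)

lemma u:
  shows "u \<in> Arr C" "Dom C u = UnitO C" "Cod C u = A" "ev M \<cdot>\<^sub>M R u = MUnit \<M> M"
  using transpose[of M "UnitO C" "MUnit \<M> M"] by (auto simp: ihom_alg_def in_hom_iff)

lemma Alg_simps [simp]: "ACarr Alg = A" "AMult Alg = \<mu> M"
  by (simp_all add: ihom_alg_def)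

declare mu(1-3) [simp] u(1-3) [simp]

text \<open>
  Acting twice is acting through the product of \<open>A\<close>. All module axioms for \<open>H V\<close> reduce to this and to
  the unit law, since arrows into \<open>H V\<close> are determined by their composites with \<open>ev V\<close>.
\<close>

lemma act_assoc:
  assumes [simp]: "X \<in> Obj C"
  shows "act X \<cdot>\<^sub>M R ((Id C X \<otimes>\<^sub>C \<mu> M) \<cdot>\<^sub>C Assoc C X A A) = act X \<cdot>\<^sub>M act (X \<otimes>\<^sub>O A)"
proof -
  have "act X \<cdot>\<^sub>M R ((Id C X \<otimes>\<^sub>C \<mu> M) \<cdot>\<^sub>C Assoc C X A A) =
      (X \<triangleright> ev M) \<cdot>\<^sub>M (MAssoc \<M> X A M \<cdot>\<^sub>M R (Id C X \<otimes>\<^sub>C \<mu> M)) \<cdot>\<^sub>M R (Assoc C X A A)"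
    by (simp add: act_def)
  also have "MAssoc \<M> X A M \<cdot>\<^sub>M R (Id C X \<otimes>\<^sub>C \<mu> M) = (X \<triangleright> R (\<mu> M)) \<cdot>\<^sub>M MAssoc \<M> X (A \<otimes>\<^sub>O A) M"
    by (rule MAssoc_nat) auto
  also have "(X \<triangleright> ev M) \<cdot>\<^sub>M \<dots> \<cdot>\<^sub>M R (Assoc C X A A) =
      ((X \<triangleright> ev M) \<cdot>\<^sub>M (X \<triangleright> R (\<mu> M))) \<cdot>\<^sub>M MAssoc \<M> X (A \<otimes>\<^sub>O A) M \<cdot>\<^sub>M R (Assoc C X A A)"
    by simp
  also have "(X \<triangleright> ev M) \<cdot>\<^sub>M (X \<triangleright> R (\<mu> M)) = X \<triangleright> (ev M \<cdot>\<^sub>M act A)"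
    using mu(4)[of M] by (simp add: ActA_Comp_fuse)
  also have "\<dots> = (X \<triangleright> ev M) \<cdot>\<^sub>M (X \<triangleright> A \<triangleright> ev M) \<cdot>\<^sub>M (X \<triangleright> MAssoc \<M> A A M)"
    by (simp add: ActA_Comp_fuse act_def)
  also have "\<dots> \<cdot>\<^sub>M MAssoc \<M> X (A \<otimes>\<^sub>O A) M \<cdot>\<^sub>M R (Assoc C X A A) =
      (X \<triangleright> ev M) \<cdot>\<^sub>M (X \<triangleright> A \<triangleright> ev M) \<cdot>\<^sub>M
        ((X \<triangleright> MAssoc \<M> A A M) \<cdot>\<^sub>M MAssoc \<M> X (A \<otimes>\<^sub>O A) M \<cdot>\<^sub>M R (Assoc C X A A))"
    by simp
  also have "(X \<triangleright> MAssoc \<M> A A M) \<cdot>\<^sub>M MAssoc \<M> X (A \<otimes>\<^sub>O A) M \<cdot>\<^sub>M R (Assoc C X A A) =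
      MAssoc \<M> X A (A \<rhd>\<^sub>O M) \<cdot>\<^sub>M MAssoc \<M> (X \<otimes>\<^sub>O A) A M"
    by (rule module_pentagon[symmetric]) auto
  also have "(X \<triangleright> ev M) \<cdot>\<^sub>M (X \<triangleright> A \<triangleright> ev M) \<cdot>\<^sub>M \<dots> =
      (X \<triangleright> ev M) \<cdot>\<^sub>M ((X \<triangleright> A \<triangleright> ev M) \<cdot>\<^sub>M MAssoc \<M> X A (A \<rhd>\<^sub>O M)) \<cdot>\<^sub>M
        MAssoc \<M> (X \<otimes>\<^sub>O A) A M"
    by simp
  also have "(X \<triangleright> A \<triangleright> ev M) \<cdot>\<^sub>M MAssoc \<M> X A (A \<rhd>\<^sub>O M) =
      MAssoc \<M> X A M \<cdot>\<^sub>M ((X \<otimes>\<^sub>O A) \<triangleright> ev M)"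
    using MAssoc_natural[OF C.Id_hom[of X] C.Id_hom[of A], of "ev M" "A \<rhd>\<^sub>O M" M]
    by (simp add: in_hom_iff)
  finally show ?thesis
    by (simp add: act_def)
qed

lemma act_unit:
  assumes [simp]: "X \<in> Obj C"
  shows "act X \<cdot>\<^sub>M R (Id C X \<otimes>\<^sub>C u) = R (RUnit C X)"
proof -
  have "act X \<cdot>\<^sub>M R (Id C X \<otimes>\<^sub>C u) = (X \<triangleright> ev M) \<cdot>\<^sub>M (MAssoc \<M> X A M \<cdot>\<^sub>M R (Id C X \<otimes>\<^sub>C u))"
    by (simp add: act_def)
  also have "MAssoc \<M> X A M \<cdot>\<^sub>M R (Id C X \<otimes>\<^sub>C u) = (X \<triangleright> R u) \<cdot>\<^sub>M MAssoc \<M> X (UnitO C) M"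
    by (rule MAssoc_nat) auto
  also have "(X \<triangleright> ev M) \<cdot>\<^sub>M \<dots> = ((X \<triangleright> ev M) \<cdot>\<^sub>M (X \<triangleright> R u)) \<cdot>\<^sub>M MAssoc \<M> X (UnitO C) M"
    by simp
  also have "(X \<triangleright> ev M) \<cdot>\<^sub>M (X \<triangleright> R u) = X \<triangleright> MUnit \<M> M"
    using u(4) by (simp add: ActA_Comp_fuse)
  also have "\<dots> \<cdot>\<^sub>M MAssoc \<M> X (UnitO C) M = R (RUnit C X)"
    by (rule module_triangle) auto
  finally show ?thesis .
qed

text \<open>The left unit law of \<open>A\<close> rests on the coherence law \<open>MUnit_ActO\<close> for \<open>1 \<otimes> (A \<otimes> M)\<close>.\<close>

lemma ev_LUnit: "ev M \<cdot>\<^sub>M R (LUnit C A) = MUnit \<M> M \<cdot>\<^sub>M act (UnitO C)"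
proof -
  have "ev M \<cdot>\<^sub>M R (LUnit C A) = (ev M \<cdot>\<^sub>M MUnit \<M> (A \<rhd>\<^sub>O M)) \<cdot>\<^sub>M MAssoc \<M> (UnitO C) A M"
    by (simp add: MUnit_ActO)
  also have "ev M \<cdot>\<^sub>M MUnit \<M> (A \<rhd>\<^sub>O M) = MUnit \<M> M \<cdot>\<^sub>M ((UnitO C) \<triangleright> ev M)"
    by (rule MUnit_natural[symmetric]) (auto simp: in_hom_iff)
  finally show ?thesis
    by (simp add: act_def)
qed

lemma unit_act:
  "ev M \<cdot>\<^sub>M act A \<cdot>\<^sub>M R (u \<otimes>\<^sub>C Id C A) = ev M \<cdot>\<^sub>M R (LUnit C A)"
proof -
  have "ev M \<cdot>\<^sub>M act A \<cdot>\<^sub>M R (u \<otimes>\<^sub>C Id C A) = (ev M \<cdot>\<^sub>M R u) \<cdot>\<^sub>M act (UnitO C)"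
    using act_natural[of u "UnitO C" A] by simp
  then show ?thesis
    by (simp only: u(4) ev_LUnit)
qed

lemma mu_assoc:
  assumes [simp]: "V \<in> Obj \<M>"
  shows "\<mu> V \<cdot>\<^sub>C (\<mu> V \<otimes>\<^sub>C Id C A) = \<mu> V \<cdot>\<^sub>C (Id C (H V) \<otimes>\<^sub>C \<mu> M) \<cdot>\<^sub>C Assoc C (H V) A A"
proof (rule ev_cancel)
  have "ev V \<cdot>\<^sub>M R (\<mu> V \<cdot>\<^sub>C (\<mu> V \<otimes>\<^sub>C Id C A)) = (ev V \<cdot>\<^sub>M R (\<mu> V)) \<cdot>\<^sub>M R (\<mu> V \<otimes>\<^sub>C Id C A)"
    by simp
  also have "\<dots> = ev V \<cdot>\<^sub>M (act (H V) \<cdot>\<^sub>M R (\<mu> V \<otimes>\<^sub>C Id C A))"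
    unfolding mu(4)[OF assms] by simp
  also have "act (H V) \<cdot>\<^sub>M R (\<mu> V \<otimes>\<^sub>C Id C A) = R (\<mu> V) \<cdot>\<^sub>M act (H V \<otimes>\<^sub>O A)"
    by (rule act_natural) auto
  also have "ev V \<cdot>\<^sub>M \<dots> = (ev V \<cdot>\<^sub>M R (\<mu> V)) \<cdot>\<^sub>M act (H V \<otimes>\<^sub>O A)"
    by simp
  also have "\<dots> = ev V \<cdot>\<^sub>M (act (H V) \<cdot>\<^sub>M act (H V \<otimes>\<^sub>O A))"
    unfolding mu(4)[OF assms] by simp
  also have "act (H V) \<cdot>\<^sub>M act (H V \<otimes>\<^sub>O A) = act (H V) \<cdot>\<^sub>M R ((Id C (H V) \<otimes>\<^sub>C \<mu> M) \<cdot>\<^sub>C Assoc C (H V) A A)"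
    by (rule act_assoc[symmetric]) simp
  also have "ev V \<cdot>\<^sub>M \<dots> = (ev V \<cdot>\<^sub>M act (H V)) \<cdot>\<^sub>M R ((Id C (H V) \<otimes>\<^sub>C \<mu> M) \<cdot>\<^sub>C Assoc C (H V) A A)"
    by simp
  also have "\<dots> = ev V \<cdot>\<^sub>M R (\<mu> V \<cdot>\<^sub>C (Id C (H V) \<otimes>\<^sub>C \<mu> M) \<cdot>\<^sub>C Assoc C (H V) A A)"
    unfolding mu(4)[OF assms, symmetric] by simp
  finally show "ev V \<cdot>\<^sub>M R (\<mu> V \<cdot>\<^sub>C (\<mu> V \<otimes>\<^sub>C Id C A)) =
    ev V \<cdot>\<^sub>M R (\<mu> V \<cdot>\<^sub>C (Id C (H V) \<otimes>\<^sub>C \<mu> M) \<cdot>\<^sub>C Assoc C (H V) A A)" .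
qed auto

lemma mu_unit:
  assumes [simp]: "V \<in> Obj \<M>"
  shows "\<mu> V \<cdot>\<^sub>C (Id C (H V) \<otimes>\<^sub>C u) = RUnit C (H V)"
proof (rule ev_cancel)
  have "ev V \<cdot>\<^sub>M R (\<mu> V \<cdot>\<^sub>C (Id C (H V) \<otimes>\<^sub>C u)) = (ev V \<cdot>\<^sub>M R (\<mu> V)) \<cdot>\<^sub>M R (Id C (H V) \<otimes>\<^sub>C u)"
    by simp
  also have "\<dots> = ev V \<cdot>\<^sub>M R (RUnit C (H V))"
    unfolding mu(4)[OF assms] by (simp add: act_unit)
  finally show "ev V \<cdot>\<^sub>M R (\<mu> V \<cdot>\<^sub>C (Id C (H V) \<otimes>\<^sub>C u)) = ev V \<cdot>\<^sub>M R (RUnit C (H V))" .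
qed auto

theorem algebra_Alg: "algebra_in C Alg"
proof -
  have "\<mu> M \<cdot>\<^sub>C (u \<otimes>\<^sub>C Id C A) = LUnit C A"
  proof (rule ev_cancel)
    have "ev M \<cdot>\<^sub>M R (\<mu> M \<cdot>\<^sub>C (u \<otimes>\<^sub>C Id C A)) = (ev M \<cdot>\<^sub>M R (\<mu> M)) \<cdot>\<^sub>M R (u \<otimes>\<^sub>C Id C A)"
      by simp
    also have "\<dots> = ev M \<cdot>\<^sub>M R (LUnit C A)"
      unfolding mu(4)[OF M_Obj] using unit_act by simp
    finally show "ev M \<cdot>\<^sub>M R (\<mu> M \<cdot>\<^sub>C (u \<otimes>\<^sub>C Id C A)) = ev M \<cdot>\<^sub>M R (LUnit C A)" .
  qed auto
  then show ?thesis
    using mu_assoc[of M] mu_unit[of M] by (simp add: algebra_in_def in_hom_iff)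
qed

lemma right_module_hm: "V \<in> Obj \<M> \<Longrightarrow> right_module C Alg (hm V)"
  using mu_assoc[of V] mu_unit[of V] by (simp add: right_module_def ihom_module_def in_hom_iff)

lemma hm_simps [simp]: "fst (hm V) = H V" "snd (hm V) = \<mu> V"
  by (simp_all add: ihom_module_def)

lemma Mod_linear: "linear_category K (Mod_cat C Alg)"
  by (rule C.Mod_cat_linear) simp

text \<open>
  A map into \<open>H W\<close> respects the actions if its transpose does; this gives both the functor \<open>F\<close> on
  arrows and the unit of the adjunction.
\<close>

lemma module_map_hmI:
  assumes S: "right_module C Alg S" and W [simp]: "W \<in> Obj \<M>"
    and f [simp]: "f \<in> Arr C" "Dom C f = fst S" "Cod C f = H W"
    and eq: "ev W \<cdot>\<^sub>M R f \<cdot>\<^sub>M R (snd S) = ev W \<cdot>\<^sub>M R f \<cdot>\<^sub>M act (fst S)"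
  shows "module_map C Alg S f (hm W)"
proof -
  note [simp] = C.right_module_simps[OF S]
  have "f \<cdot>\<^sub>C snd S = \<mu> W \<cdot>\<^sub>C (f \<otimes>\<^sub>C Id C A)"
  proof (rule ev_cancel)
    have "ev W \<cdot>\<^sub>M R (f \<cdot>\<^sub>C snd S) = ev W \<cdot>\<^sub>M (R f \<cdot>\<^sub>M act (fst S))"
      using eq by simp
    also have "R f \<cdot>\<^sub>M act (fst S) = act (H W) \<cdot>\<^sub>M R (f \<otimes>\<^sub>C Id C A)"
      by (rule act_natural[symmetric]) auto
    also have "ev W \<cdot>\<^sub>M \<dots> = (ev W \<cdot>\<^sub>M act (H W)) \<cdot>\<^sub>M R (f \<otimes>\<^sub>C Id C A)"
      by simp
    also have "\<dots> = ev W \<cdot>\<^sub>M R (\<mu> W \<cdot>\<^sub>C (f \<otimes>\<^sub>C Id C A))"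
      unfolding mu(4)[OF W, symmetric] by simp
    finally show "ev W \<cdot>\<^sub>M R (f \<cdot>\<^sub>C snd S) = ev W \<cdot>\<^sub>M R (\<mu> W \<cdot>\<^sub>C (f \<otimes>\<^sub>C Id C A))" .
  qed auto
  then show ?thesis
    using S by (simp add: module_map_def right_module_hm)
qed

abbreviation Hmap :: "'b \<Rightarrow> 'a" where
  "Hmap h \<equiv> tr (Cod \<M> h) (H (Dom \<M> h)) (h \<cdot>\<^sub>M ev (Dom \<M> h))"

lemma Hmap:
  assumes "h \<in> Arr \<M>"
  shows "Hmap h \<in> Arr C" "Dom C (Hmap h) = H (Dom \<M> h)" "Cod C (Hmap h) = H (Cod \<M> h)"
    "ev (Cod \<M> h) \<cdot>\<^sub>M R (Hmap h) = h \<cdot>\<^sub>M ev (Dom \<M> h)"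
  using transpose[of "Cod \<M> h" "H (Dom \<M> h)" "h \<cdot>\<^sub>M ev (Dom \<M> h)"] assms by (auto simp: in_hom_iff)

lemma Hmap_unique:
  assumes "h \<in> Arr \<M>" "ev (Cod \<M> h) \<cdot>\<^sub>M R f = h \<cdot>\<^sub>M ev (Dom \<M> h)"
    and "f \<in> Arr C" "Dom C f = H (Dom \<M> h)" "Cod C f = H (Cod \<M> h)"
  shows "Hmap h = f"
  using assms Hmap[OF assms(1)] by (intro ev_cancel[of "Cod \<M> h" "Hmap h" f]) auto

lemma Hmap_module_map:
  assumes h [simp]: "h \<in> Arr \<M>"
  shows "module_map C Alg (hm (Dom \<M> h)) (Hmap h) (hm (Cod \<M> h))"
proof (rule module_map_hmI)
  note [simp] = Hmap[OF h]
  have "ev (Cod \<M> h) \<cdot>\<^sub>M R (Hmap h) \<cdot>\<^sub>M R (\<mu> (Dom \<M> h)) =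
      (ev (Cod \<M> h) \<cdot>\<^sub>M R (Hmap h)) \<cdot>\<^sub>M R (\<mu> (Dom \<M> h))"
    by (subst M.Comp_assoc_simp) auto
  also have "\<dots> = h \<cdot>\<^sub>M ev (Dom \<M> h) \<cdot>\<^sub>M act (H (Dom \<M> h))"
    using mu(4)[of "Dom \<M> h"] by simp
  also have "\<dots> = (ev (Cod \<M> h) \<cdot>\<^sub>M R (Hmap h)) \<cdot>\<^sub>M act (H (Dom \<M> h))"
    by simp
  also have "\<dots> = ev (Cod \<M> h) \<cdot>\<^sub>M R (Hmap h) \<cdot>\<^sub>M act (H (Dom \<M> h))"
    by (subst M.Comp_assoc_simp) auto
  finally show "ev (Cod \<M> h) \<cdot>\<^sub>M R (Hmap h) \<cdot>\<^sub>M R (snd (hm (Dom \<M> h))) =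
      ev (Cod \<M> h) \<cdot>\<^sub>M R (Hmap h) \<cdot>\<^sub>M act (fst (hm (Dom \<M> h)))"
    by simp
qed (use h Hmap[OF h] in \<open>auto simp: right_module_hm\<close>)

abbreviation F where "F \<equiv> ihom_funct C \<M> I M"

lemma F_simps: "FObj F V = hm V" "FArr F h = (hm (Dom \<M> h), Hmap h, hm (Cod \<M> h))"
  by (simp_all add: ihom_funct_def)

theorem linear_functor_F: "linear_functor K \<M> (Mod_cat C Alg) F"
proof (intro linear_functor.intro linear_functor_axioms.intro)
  show "linear_category K \<M>"
    by (rule M.linear_category_axioms)
  show "linear_category K (Mod_cat C Alg)"
    by (rule Mod_linear)
  show "FObj F x \<in> Obj (Mod_cat C Alg)" if "x \<in> Obj \<M>" for x
    using that by (simp add: F_simps right_module_hm)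
  show "FArr F f \<in> hom_set (Mod_cat C Alg) (FObj F x) (FObj F y)" if "f \<in> hom_set \<M> x y" for f x y
    using that Hmap_module_map[of f] by (auto simp: F_simps in_hom_iff)
  show "FArr F (Id \<M> x) = Id (Mod_cat C Alg) (FObj F x)" if "x \<in> Obj \<M>" for x
    using that Hmap_unique[of "Id \<M> x" "Id C (H x)"] by (simp add: F_simps)
  show "FArr F (g \<cdot>\<^sub>M f) = FArr F g \<cdot>\<^bsub>Mod_cat C Alg\<^esub> FArr F f"
    if "f \<in> hom_set \<M> x y" "g \<in> hom_set \<M> y z" for f g x y z
  proof -
    have fg: "f \<in> Arr \<M>" "Dom \<M> f = x" "Cod \<M> f = y" "g \<in> Arr \<M>" "Dom \<M> g = y" "Cod \<M> g = z"
      using that by (auto simp: in_hom_iff)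
    have xyz: "x \<in> Obj \<M>" "y \<in> Obj \<M>" "z \<in> Obj \<M>"
      using fg M.Dom_Obj[of f] M.Dom_Obj[of g] M.Cod_Obj[of g] by auto
    have "ev z \<cdot>\<^sub>M R (Hmap g \<cdot>\<^sub>C Hmap f) = (ev z \<cdot>\<^sub>M R (Hmap g)) \<cdot>\<^sub>M R (Hmap f)"
      using fg xyz Hmap(1-3)[of f] Hmap(1-3)[of g] by simp
    also have "ev z \<cdot>\<^sub>M R (Hmap g) = g \<cdot>\<^sub>M ev y"
      using Hmap(4)[of g] fg by simp
    also have "\<dots> \<cdot>\<^sub>M R (Hmap f) = g \<cdot>\<^sub>M ev y \<cdot>\<^sub>M R (Hmap f)"
      using fg xyz Hmap[of f] by simp
    also have "ev y \<cdot>\<^sub>M R (Hmap f) = f \<cdot>\<^sub>M ev x"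
      using Hmap(4)[of f] fg by simp
    also have "g \<cdot>\<^sub>M f \<cdot>\<^sub>M ev x = (g \<cdot>\<^sub>M f) \<cdot>\<^sub>M ev x"
      using fg xyz by simp
    finally have eq: "ev z \<cdot>\<^sub>M R (Hmap g \<cdot>\<^sub>C Hmap f) = (g \<cdot>\<^sub>M f) \<cdot>\<^sub>M ev x" .
    have "Hmap (g \<cdot>\<^sub>M f) = Hmap g \<cdot>\<^sub>C Hmap f"
    proof (rule Hmap_unique)
      show "ev (Cod \<M> (g \<cdot>\<^sub>M f)) \<cdot>\<^sub>M R (Hmap g \<cdot>\<^sub>C Hmap f) =
          (g \<cdot>\<^sub>M f) \<cdot>\<^sub>M ev (Dom \<M> (g \<cdot>\<^sub>M f))"
        using eq fg by simp
    qed (use fg Hmap[of f] Hmap[of g] in auto)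
    then show ?thesis
      using fg by (simp add: F_simps)
  qed
  show "FArr F (Add_arr \<M> f g) = Add_arr (Mod_cat C Alg) (FArr F f) (FArr F g)"
    if "f \<in> hom_set \<M> x y" "g \<in> hom_set \<M> x y" for f g x y
  proof -
    have fg: "f \<in> Arr \<M>" "Dom \<M> f = x" "Cod \<M> f = y" "g \<in> Arr \<M>" "Dom \<M> g = x" "Cod \<M> g = y"
      using that by (auto simp: in_hom_iff)
    have xy: "x \<in> Obj \<M>" "y \<in> Obj \<M>"
      using fg M.Dom_Obj[of f] M.Cod_Obj[of g] by auto
    have "Hmap (Add_arr \<M> f g) = Add_arr C (Hmap f) (Hmap g)"
      using fg xy Hmap[of f] Hmap[of g] by (intro Hmap_unique) (auto simp: R_Add M.Comp_Add)
    then show ?thesis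
      using fg by (simp add: F_simps)
  qed
  show "FArr F (Smult_arr \<M> c f) = Smult_arr (Mod_cat C Alg) c (FArr F f)"
    if "c \<in> carrier K" "f \<in> hom_set \<M> x y" for c f x y
  proof -
    have f: "f \<in> Arr \<M>" "Dom \<M> f = x" "Cod \<M> f = y"
      using that by (auto simp: in_hom_iff)
    have xy: "x \<in> Obj \<M>" "y \<in> Obj \<M>"
      using f M.Dom_Obj[of f] M.Cod_Obj[of f] by auto
    have "Hmap (Smult_arr \<M> c f) = Smult_arr C c (Hmap f)"
      using f xy that(1) Hmap[of f] by (intro Hmap_unique) (auto simp: R_Smult M.Comp_Smult)
    then show ?thesis
      using f that(1) by (simp add: F_simps)
  qed
qed

end

section \<open>Free modules represent internal Homs\<close>

context internal_hom_source
begin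

lemma act_Assoc:
  assumes [simp]: "y \<in> Obj C" "X \<in> Obj C"
  shows "MAssoc \<M> y X M \<cdot>\<^sub>M act (y \<otimes>\<^sub>O X) =
    (y \<triangleright> act X) \<cdot>\<^sub>M MAssoc \<M> y (X \<otimes>\<^sub>O A) M \<cdot>\<^sub>M R (Assoc C y X A)"
proof -
  have "MAssoc \<M> y X M \<cdot>\<^sub>M act (y \<otimes>\<^sub>O X) =
      (MAssoc \<M> y X M \<cdot>\<^sub>M ((y \<otimes>\<^sub>O X) \<triangleright> ev M)) \<cdot>\<^sub>M MAssoc \<M> (y \<otimes>\<^sub>O X) A M"
    by (simp add: act_def)
  also have "MAssoc \<M> y X M \<cdot>\<^sub>M ((y \<otimes>\<^sub>O X) \<triangleright> ev M) =
      (y \<triangleright> X \<triangleright> ev M) \<cdot>\<^sub>M MAssoc \<M> y X (A \<rhd>\<^sub>O M)"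
    using MAssoc_natural[OF C.Id_hom[of y] C.Id_hom[of X], of "ev M" "A \<rhd>\<^sub>O M" M]
    by (simp add: in_hom_iff)
  also have "\<dots> \<cdot>\<^sub>M MAssoc \<M> (y \<otimes>\<^sub>O X) A M =
      (y \<triangleright> X \<triangleright> ev M) \<cdot>\<^sub>M
        (MAssoc \<M> y X (A \<rhd>\<^sub>O M) \<cdot>\<^sub>M MAssoc \<M> (y \<otimes>\<^sub>O X) A M)"
    by simp
  also have "MAssoc \<M> y X (A \<rhd>\<^sub>O M) \<cdot>\<^sub>M MAssoc \<M> (y \<otimes>\<^sub>O X) A M =
      (y \<triangleright> MAssoc \<M> X A M) \<cdot>\<^sub>M MAssoc \<M> y (X \<otimes>\<^sub>O A) M \<cdot>\<^sub>M R (Assoc C y X A)"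
    by (rule module_pentagon) auto
  also have "(y \<triangleright> X \<triangleright> ev M) \<cdot>\<^sub>M \<dots> =
      ((y \<triangleright> X \<triangleright> ev M) \<cdot>\<^sub>M (y \<triangleright> MAssoc \<M> X A M)) \<cdot>\<^sub>M
        MAssoc \<M> y (X \<otimes>\<^sub>O A) M \<cdot>\<^sub>M R (Assoc C y X A)"
    by simp
  also have "(y \<triangleright> X \<triangleright> ev M) \<cdot>\<^sub>M (y \<triangleright> MAssoc \<M> X A M) = y \<triangleright> act X"
    by (simp add: ActA_Comp_fuse act_def)
  finally show ?thesis .
qed

text \<open>
  \<open>Hom(Y, X \<otimes> A) = Hom(y \<otimes> Y, A) = Hom((y \<otimes> Y) \<otimes> M, M) = Hom(Y \<otimes> M, X \<otimes> M)\<close> for a left dual \<open>y\<close> of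
  \<open>X\<close>, the outer steps being transpositions in \<open>C\<close> and in \<open>\<M>\<close>. The composite bijection is
  \<open>t \<mapsto> act X \<cdot> (t \<otimes> M)\<close>: a preimage of \<open>f\<close> is found by going from right to left.
\<close>

lemma act_surj:
  assumes dual: "dual_pair C y X e d" and Y [simp]: "Y \<in> Obj C"
    and f: "f \<in> hom_set \<M> (Y \<rhd>\<^sub>O M) (X \<rhd>\<^sub>O M)"
  shows "\<exists>t \<in> hom_set C Y (X \<otimes>\<^sub>O A). act X \<cdot>\<^sub>M R t = f"
proof -
  note [simp] = C.dual_pair_simps[OF dual]
  define f' where "f' = flat e y X M f"
  have [simp]: "f' \<in> Arr \<M>" "Dom \<M> f' = y \<rhd>\<^sub>O Y \<rhd>\<^sub>O M" "Cod \<M> f' = M"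
    using flat_hom[OF dual f] by (auto simp: f'_def in_hom_iff)
  define g where "g = tr M (y \<otimes>\<^sub>O Y) (f' \<cdot>\<^sub>M MAssoc \<M> y Y M)"
  have g: "g \<in> Arr C" "Dom C g = y \<otimes>\<^sub>O Y" "Cod C g = A" "ev M \<cdot>\<^sub>M R g = f' \<cdot>\<^sub>M MAssoc \<M> y Y M"
    using transpose[of M "y \<otimes>\<^sub>O Y" "f' \<cdot>\<^sub>M MAssoc \<M> y Y M"] by (auto simp: g_def in_hom_iff)
  note [simp] = g(1-3)
  let ?l = "inverse_arrow C (LUnit C Y)"
  define t where "t = (Id C X \<otimes>\<^sub>C g) \<cdot>\<^sub>C Assoc C X y Y \<cdot>\<^sub>C (d \<otimes>\<^sub>C Id C Y) \<cdot>\<^sub>C ?l"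
  have t: "t \<in> hom_set C Y (X \<otimes>\<^sub>O A)"
    by (simp add: t_def in_hom_iff)
  have l: "MAssoc \<M> (UnitO C) Y M \<cdot>\<^sub>M R ?l = inverse_arrow \<M> (MUnit \<M> (Y \<rhd>\<^sub>O M))"
  proof (rule M.iso_cancel_left)
    have "MUnit \<M> (Y \<rhd>\<^sub>O M) \<cdot>\<^sub>M MAssoc \<M> (UnitO C) Y M \<cdot>\<^sub>M R ?l =
        (MUnit \<M> (Y \<rhd>\<^sub>O M) \<cdot>\<^sub>M MAssoc \<M> (UnitO C) Y M) \<cdot>\<^sub>M R ?l"
      by simp
    also have "\<dots> = MUnit \<M> (Y \<rhd>\<^sub>O M) \<cdot>\<^sub>M inverse_arrow \<M> (MUnit \<M> (Y \<rhd>\<^sub>O M))"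
      unfolding MUnit_ActO[OF Y M_Obj] by (simp add: ActA_Comp_fuse)
    finally show "MUnit \<M> (Y \<rhd>\<^sub>O M) \<cdot>\<^sub>M MAssoc \<M> (UnitO C) Y M \<cdot>\<^sub>M R ?l =
      MUnit \<M> (Y \<rhd>\<^sub>O M) \<cdot>\<^sub>M inverse_arrow \<M> (MUnit \<M> (Y \<rhd>\<^sub>O M))" .
  qed auto
  have "act X \<cdot>\<^sub>M R t = (X \<triangleright> ev M) \<cdot>\<^sub>M (MAssoc \<M> X A M \<cdot>\<^sub>M R (Id C X \<otimes>\<^sub>C g)) \<cdot>\<^sub>M
      R (Assoc C X y Y) \<cdot>\<^sub>M R (d \<otimes>\<^sub>C Id C Y) \<cdot>\<^sub>M R ?l"
    by (simp add: t_def act_def)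
  also have "MAssoc \<M> X A M \<cdot>\<^sub>M R (Id C X \<otimes>\<^sub>C g) = (X \<triangleright> R g) \<cdot>\<^sub>M MAssoc \<M> X (y \<otimes>\<^sub>O Y) M"
    by (rule MAssoc_nat) auto
  also have "(X \<triangleright> ev M) \<cdot>\<^sub>M \<dots> \<cdot>\<^sub>M R (Assoc C X y Y) \<cdot>\<^sub>M R (d \<otimes>\<^sub>C Id C Y) \<cdot>\<^sub>M R ?l =
      ((X \<triangleright> ev M) \<cdot>\<^sub>M (X \<triangleright> R g)) \<cdot>\<^sub>M MAssoc \<M> X (y \<otimes>\<^sub>O Y) M \<cdot>\<^sub>M
        R (Assoc C X y Y) \<cdot>\<^sub>M R (d \<otimes>\<^sub>C Id C Y) \<cdot>\<^sub>M R ?l"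
    by simp
  also have "(X \<triangleright> ev M) \<cdot>\<^sub>M (X \<triangleright> R g) =
      (X \<triangleright> f') \<cdot>\<^sub>M (X \<triangleright> MAssoc \<M> y Y M)"
    by (simp add: ActA_Comp_fuse g(4))
  also have "\<dots> \<cdot>\<^sub>M MAssoc \<M> X (y \<otimes>\<^sub>O Y) M \<cdot>\<^sub>M R (Assoc C X y Y) \<cdot>\<^sub>M R (d \<otimes>\<^sub>C Id C Y) \<cdot>\<^sub>M R ?l =
      (X \<triangleright> f') \<cdot>\<^sub>M ((X \<triangleright> MAssoc \<M> y Y M) \<cdot>\<^sub>M MAssoc \<M> X (y \<otimes>\<^sub>O Y) M \<cdot>\<^sub>M
        R (Assoc C X y Y)) \<cdot>\<^sub>M R (d \<otimes>\<^sub>C Id C Y) \<cdot>\<^sub>M R ?l"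
    by simp
  also have "(X \<triangleright> MAssoc \<M> y Y M) \<cdot>\<^sub>M MAssoc \<M> X (y \<otimes>\<^sub>O Y) M \<cdot>\<^sub>M R (Assoc C X y Y) =
      MAssoc \<M> X y (Y \<rhd>\<^sub>O M) \<cdot>\<^sub>M MAssoc \<M> (X \<otimes>\<^sub>O y) Y M"
    by (rule module_pentagon[symmetric]) auto
  also have "(X \<triangleright> f') \<cdot>\<^sub>M \<dots> \<cdot>\<^sub>M R (d \<otimes>\<^sub>C Id C Y) \<cdot>\<^sub>M R ?l =
      (X \<triangleright> f') \<cdot>\<^sub>M MAssoc \<M> X y (Y \<rhd>\<^sub>O M) \<cdot>\<^sub>M
        (MAssoc \<M> (X \<otimes>\<^sub>O y) Y M \<cdot>\<^sub>M R (d \<otimes>\<^sub>C Id C Y)) \<cdot>\<^sub>M R ?l"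
    by simp
  also have "MAssoc \<M> (X \<otimes>\<^sub>O y) Y M \<cdot>\<^sub>M R (d \<otimes>\<^sub>C Id C Y) =
      (d \<rhd>\<^sub>M R (Id C Y)) \<cdot>\<^sub>M MAssoc \<M> (UnitO C) Y M"
    by (rule MAssoc_nat) auto
  also have "(X \<triangleright> f') \<cdot>\<^sub>M MAssoc \<M> X y (Y \<rhd>\<^sub>O M) \<cdot>\<^sub>M \<dots> \<cdot>\<^sub>M R ?l =
      (X \<triangleright> f') \<cdot>\<^sub>M MAssoc \<M> X y (Y \<rhd>\<^sub>O M) \<cdot>\<^sub>M (d \<rhd>\<^sub>M Id \<M> (Y \<rhd>\<^sub>O M)) \<cdot>\<^sub>M
        (MAssoc \<M> (UnitO C) Y M \<cdot>\<^sub>M R ?l)"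
    by simp
  also have "\<dots> = sharp d y X (Y \<rhd>\<^sub>O M) f'"
    unfolding l by (simp add: sharp_def)
  also have "\<dots> = f"
    unfolding f'_def by (rule sharp_flat[OF dual f]) simp
  finally show ?thesis
    using t by blast
qed

text \<open>
  By \<open>key\<close>, the transpose of \<open>t\<close> in \<open>C\<close>, regarded as a module category over itself, is determined by
  the transpose of \<open>act X \<cdot> (t \<otimes> M)\<close> in \<open>\<M>\<close>; and it determines \<open>t\<close>.
\<close>

lemma act_inj:
  assumes dual: "dual_pair C y X e d" and eq: "act X \<cdot>\<^sub>M R s = act X \<cdot>\<^sub>M R t"
    and s: "s \<in> hom_set C Y (X \<otimes>\<^sub>O A)" and t: "t \<in> hom_set C Y (X \<otimes>\<^sub>O A)"
  shows "s = t"
proof -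
  note Reg = C.module_category_regular_module
  let ?flat = "module_category.flat C C.regular_module e y X A"
  note [simp] = C.dual_pair_simps[OF dual]
  have key: "ev M \<cdot>\<^sub>M R (?flat t) = flat e y X M (act X \<cdot>\<^sub>M R t) \<cdot>\<^sub>M MAssoc \<M> y Y M"
    if t: "t \<in> hom_set C Y (X \<otimes>\<^sub>O A)" for t
  proof -
    have [simp]: "t \<in> Arr C" "Dom C t = Y" "Cod C t = X \<otimes>\<^sub>O A"
      using t by (auto simp: in_hom_iff)
    have [simp]: "Y \<in> Obj C"
      using C.Dom_Obj[of t] by simp
    let ?b = "inverse_arrow C (Assoc C y X A)" and ?c = "inverse_arrow \<M> (MAssoc \<M> y X M)"
    have b: "act (y \<otimes>\<^sub>O X) \<cdot>\<^sub>M R ?b = ?c \<cdot>\<^sub>M (y \<triangleright> act X) \<cdot>\<^sub>M MAssoc \<M> y (X \<otimes>\<^sub>O A) M"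
    proof -
      have "act (y \<otimes>\<^sub>O X) \<cdot>\<^sub>M R ?b = ?c \<cdot>\<^sub>M (MAssoc \<M> y X M \<cdot>\<^sub>M act (y \<otimes>\<^sub>O X)) \<cdot>\<^sub>M R ?b"
        by simp
      also have "\<dots> = ?c \<cdot>\<^sub>M (y \<triangleright> act X) \<cdot>\<^sub>M MAssoc \<M> y (X \<otimes>\<^sub>O A) M \<cdot>\<^sub>M
          R (Assoc C y X A) \<cdot>\<^sub>M R ?b"
        by (subst act_Assoc) auto
      also have "R (Assoc C y X A) \<cdot>\<^sub>M R ?b = Id \<M> ((y \<otimes>\<^sub>O X \<otimes>\<^sub>O A) \<rhd>\<^sub>O M)"
        by (simp add: ActA_Comp_fuse)
      finally show ?thesis
        by simp
    qed
    have "ev M \<cdot>\<^sub>M R (?flat t) =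
        (ev M \<cdot>\<^sub>M R (LUnit C A)) \<cdot>\<^sub>M R (e \<otimes>\<^sub>C Id C A) \<cdot>\<^sub>M R ?b \<cdot>\<^sub>M R (Id C y \<otimes>\<^sub>C t)"
      by (simp add: module_category.flat_def[OF Reg])
    also have "\<dots> = MUnit \<M> M \<cdot>\<^sub>M (act (UnitO C) \<cdot>\<^sub>M R (e \<otimes>\<^sub>C Id C A)) \<cdot>\<^sub>M R ?b \<cdot>\<^sub>M R (Id C y \<otimes>\<^sub>C t)"
      unfolding ev_LUnit by simp
    also have "act (UnitO C) \<cdot>\<^sub>M R (e \<otimes>\<^sub>C Id C A) = R e \<cdot>\<^sub>M act (y \<otimes>\<^sub>O X)"
      by (rule act_natural) auto
    also have "MUnit \<M> M \<cdot>\<^sub>M \<dots> \<cdot>\<^sub>M R ?b \<cdot>\<^sub>M R (Id C y \<otimes>\<^sub>C t) =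
        MUnit \<M> M \<cdot>\<^sub>M R e \<cdot>\<^sub>M (act (y \<otimes>\<^sub>O X) \<cdot>\<^sub>M R ?b) \<cdot>\<^sub>M R (Id C y \<otimes>\<^sub>C t)"
      by simp
    also have "\<dots> = MUnit \<M> M \<cdot>\<^sub>M R e \<cdot>\<^sub>M ?c \<cdot>\<^sub>M (y \<triangleright> act X) \<cdot>\<^sub>M
        (MAssoc \<M> y (X \<otimes>\<^sub>O A) M \<cdot>\<^sub>M R (Id C y \<otimes>\<^sub>C t))"
      unfolding b by simp
    also have "MAssoc \<M> y (X \<otimes>\<^sub>O A) M \<cdot>\<^sub>M R (Id C y \<otimes>\<^sub>C t) =
        (y \<triangleright> R t) \<cdot>\<^sub>M MAssoc \<M> y Y M"
      by (rule MAssoc_nat) auto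
    also have "MUnit \<M> M \<cdot>\<^sub>M R e \<cdot>\<^sub>M ?c \<cdot>\<^sub>M (y \<triangleright> act X) \<cdot>\<^sub>M \<dots> =
        MUnit \<M> M \<cdot>\<^sub>M R e \<cdot>\<^sub>M ?c \<cdot>\<^sub>M ((y \<triangleright> act X) \<cdot>\<^sub>M (y \<triangleright> R t)) \<cdot>\<^sub>M
          MAssoc \<M> y Y M"
      by simp
    also have "(y \<triangleright> act X) \<cdot>\<^sub>M (y \<triangleright> R t) = y \<triangleright> (act X \<cdot>\<^sub>M R t)"
      by (simp add: ActA_Comp_fuse)
    finally show ?thesis
      by (simp add: flat_def)
  qed
  have flat: "?flat t \<in> hom_set C (y \<otimes>\<^sub>O Y) A" if "t \<in> hom_set C Y (X \<otimes>\<^sub>O A)" for t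
    using module_category.flat_hom[OF Reg dual, of t Y A] that
    by (simp only: C.regular_module_simps C.regular_module_simps' H_Obj M_Obj)
  have "ev M \<cdot>\<^sub>M R (?flat s) = ev M \<cdot>\<^sub>M R (?flat t)"
    by (simp only: key[OF s] key[OF t] eq)
  then have "?flat s = ?flat t"
    by (rule ev_cancel) (use flat[OF s] flat[OF t] in \<open>simp_all only: in_hom_iff M_Obj\<close>)
  moreover have "module_category.sharp C C.regular_module d y X Y (?flat t) = t" if "t \<in> hom_set C Y (X \<otimes>\<^sub>O A)" for t
    using module_category.sharp_flat[OF Reg dual, of t Y A] that by (simp only: C.regular_module_simps C.regular_module_simps' H_Obj M_Obj)
  ultimately show ?thesis
    using s t by metis
qed

end

section \<open>The equivalence for a generator\<close>

locale internal_hom_generator = internal_hom_source K C \<M> I M + S: semisimple_category K \<M>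
  for K :: "('k, 'r) ring_scheme" (structure)
    and C :: "('k, 'o, 'a, 'z) mon_cat_scheme"
    and \<M> :: "('k, 'o, 'a, 'p, 'b, 'y) mod_cat_scheme"
    and I :: "('o, 'a, 'p, 'b) ihoms" and M :: 'p +
  assumes left_dual: "x \<in> Obj C \<Longrightarrow> \<exists>y e d. dual_pair C y x e d"
    and generator: "generates C \<M> M"
begin

abbreviation ModA where "ModA \<equiv> Mod_cat C Alg"
abbreviation proj where "proj S \<equiv> rel_tensor_proj \<M> C Alg (M, ev M) S"
abbreviation quot where "quot S \<equiv> rel_tensor \<M> C Alg (M, ev M) S"
abbreviation G where "G \<equiv> rel_tensor_funct \<M> C Alg (M, ev M)"

lemma obtain_act_preimage:
  assumes "X \<in> Obj C" "Y \<in> Obj C" "f \<in> hom_set \<M> (Y \<rhd>\<^sub>O M) (X \<rhd>\<^sub>O M)"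
  obtains t where "t \<in> Arr C" "Dom C t = Y" "Cod C t = X \<otimes>\<^sub>O A" "act X \<cdot>\<^sub>M R t = f"
proof -
  obtain y e d where "dual_pair C y X e d"
    using left_dual[OF assms(1)] by blast
  then obtain t where "t \<in> hom_set C Y (X \<otimes>\<^sub>O A)" "act X \<cdot>\<^sub>M R t = f"
    using act_surj[OF _ assms(2,3)] by blast
  then show ?thesis
    using that by (auto simp: in_hom_iff)
qed

lemma act_cancel:
  assumes "act X \<cdot>\<^sub>M R s = act X \<cdot>\<^sub>M R t" "X \<in> Obj C"
    and "s \<in> Arr C" "t \<in> Arr C" "Dom C s = Dom C t" "Cod C s = X \<otimes>\<^sub>O A" "Cod C t = X \<otimes>\<^sub>O A"
  shows "s = t"
proof -
  obtain y e d where "dual_pair C y X e d"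
    using left_dual[OF assms(2)] by blast
  then show ?thesis
    by (rule act_inj[OF _ assms(1), where Y = "Dom C t"]) (use assms in \<open>simp_all add: in_hom_iff\<close>)
qed

text \<open>
  The epimorphism \<open>X \<otimes> M \<rightarrow> V\<close> that a generator provides splits, because \<open>\<M>\<close> is semisimple.
\<close>

lemma retract_of_free:
  assumes V: "V \<in> Obj \<M>"
  obtains X p s where "X \<in> Obj C" "p \<in> Arr \<M>" "Dom \<M> p = X \<rhd>\<^sub>O M" "Cod \<M> p = V"
    "s \<in> Arr \<M>" "Dom \<M> s = V" "Cod \<M> s = X \<rhd>\<^sub>O M" "p \<cdot>\<^sub>M s = Id \<M> V"
proof -
  obtain X p where X: "X \<in> Obj C" and p: "p \<in> hom_set \<M> (X \<rhd>\<^sub>O M) V" and epi: "epi_arrow \<M> p"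
    using generator V unfolding generates_def by blast
  obtain s where "s \<in> hom_set \<M> (Cod \<M> p) (Dom \<M> p)" "p \<cdot>\<^sub>M s = Id \<M> (Cod \<M> p)"
    using M.regular_epi_section[OF S.semisimple_von_neumann_regular epi] by blast
  then show ?thesis
    using that[of X p s] X p by (simp add: in_hom_iff)
qed

text \<open>
  The evaluation \<open>H V \<otimes> M \<rightarrow> V\<close> is the coequalizer of the two actions of \<open>A\<close>. For \<open>V = X \<otimes> M\<close> the
  fork is split; in general \<open>V\<close> is a retract of such an object, and a splitting of \<open>V\<close> lifts to the
  arrow \<open>t\<close> below, which exhibits \<open>H V\<close> as a retract of \<open>X \<otimes> A\<close>.
\<close>

lemma ev_coequalizer:
  assumes V [simp]: "V \<in> Obj \<M>"
    and h [simp]: "h \<in> Arr \<M>" "Dom \<M> h = H V \<rhd>\<^sub>O M"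
    and eq: "h \<cdot>\<^sub>M R (\<mu> V) = h \<cdot>\<^sub>M act (H V)"
  obtains v where "v \<in> Arr \<M>" "Dom \<M> v = V" "Cod \<M> v = Cod \<M> h" "v \<cdot>\<^sub>M ev V = h"
proof -
  obtain X p s where [simp]: "X \<in> Obj C" "p \<in> Arr \<M>" "Dom \<M> p = X \<rhd>\<^sub>O M" "Cod \<M> p = V"
    "s \<in> Arr \<M>" "Dom \<M> s = V" "Cod \<M> s = X \<rhd>\<^sub>O M" and ps: "p \<cdot>\<^sub>M s = Id \<M> V"
    by (rule retract_of_free[OF V])
  define p' where "p' = tr V X p"
  have p' [simp]: "p' \<in> Arr C" "Dom C p' = X" "Cod C p' = H V" and ev_p': "ev V \<cdot>\<^sub>M R p' = p"
    using transpose[of V X p] by (auto simp: p'_def in_hom_iff)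
  obtain t where t [simp]: "t \<in> Arr C" "Dom C t = H V" "Cod C t = X \<otimes>\<^sub>O A"
    and act_t: "act X \<cdot>\<^sub>M R t = s \<cdot>\<^sub>M ev V"
    by (rule obtain_act_preimage[of X "H V" "s \<cdot>\<^sub>M ev V"]) (auto simp: in_hom_iff)
  define w where "w = \<mu> V \<cdot>\<^sub>C (p' \<otimes>\<^sub>C Id C A) \<cdot>\<^sub>C t"
  have [simp]: "w \<in> Arr C" "Dom C w = H V" "Cod C w = H V"
    by (auto simp: w_def)
  have via_act: "act (H V) \<cdot>\<^sub>M R (p' \<otimes>\<^sub>C Id C A) \<cdot>\<^sub>M R t = R p' \<cdot>\<^sub>M s \<cdot>\<^sub>M ev V"
  proof -
    have "act (H V) \<cdot>\<^sub>M R (p' \<otimes>\<^sub>C Id C A) \<cdot>\<^sub>M R t = (act (H V) \<cdot>\<^sub>M R (p' \<otimes>\<^sub>C Id C A)) \<cdot>\<^sub>M R t"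
      by simp
    also have "\<dots> = R p' \<cdot>\<^sub>M act X \<cdot>\<^sub>M R t"
      by (subst act_natural[of p' X]) auto
    finally show ?thesis
      unfolding act_t .
  qed
  have fork: "k \<cdot>\<^sub>M R w = k \<cdot>\<^sub>M R p' \<cdot>\<^sub>M s \<cdot>\<^sub>M ev V"
    if k: "k \<in> Arr \<M>" "Dom \<M> k = H V \<rhd>\<^sub>O M" "k \<cdot>\<^sub>M R (\<mu> V) = k \<cdot>\<^sub>M act (H V)" for k
  proof -
    have "k \<cdot>\<^sub>M R w = (k \<cdot>\<^sub>M R (\<mu> V)) \<cdot>\<^sub>M R (p' \<otimes>\<^sub>C Id C A) \<cdot>\<^sub>M R t"
      using k(1,2) by (simp add: w_def)
    also have "\<dots> = k \<cdot>\<^sub>M (act (H V) \<cdot>\<^sub>M R (p' \<otimes>\<^sub>C Id C A) \<cdot>\<^sub>M R t)"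
      unfolding k(3) using k(1,2) by simp
    finally show ?thesis
      unfolding via_act .
  qed
  have "ev V \<cdot>\<^sub>M R w = (ev V \<cdot>\<^sub>M R p') \<cdot>\<^sub>M s \<cdot>\<^sub>M ev V"
    using fork[of "ev V"] mu(4)[OF V] by simp
  also have "\<dots> = (p \<cdot>\<^sub>M s) \<cdot>\<^sub>M ev V"
    unfolding ev_p' by simp
  also have "\<dots> = ev V \<cdot>\<^sub>M R (Id C (H V))"
    unfolding ps by simp
  finally have "w = Id C (H V)"
    by (rule ev_cancel) auto
  then have "h = (h \<cdot>\<^sub>M R p' \<cdot>\<^sub>M s) \<cdot>\<^sub>M ev V"
    using fork[OF h eq] by simp
  then show ?thesis
    using that[of "h \<cdot>\<^sub>M R p' \<cdot>\<^sub>M s"] by simp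
qed

lemma ev_right_cancel:
  assumes V [simp]: "V \<in> Obj \<M>" and eq: "v \<cdot>\<^sub>M ev V = v' \<cdot>\<^sub>M ev V"
    and v: "v \<in> Arr \<M>" "v' \<in> Arr \<M>" "Dom \<M> v = V" "Dom \<M> v' = V"
  shows "v = v'"
proof -
  obtain X p s where [simp]: "X \<in> Obj C" "p \<in> Arr \<M>" "Dom \<M> p = X \<rhd>\<^sub>O M" "Cod \<M> p = V"
    "s \<in> Arr \<M>" "Dom \<M> s = V" "Cod \<M> s = X \<rhd>\<^sub>O M" and ps: "p \<cdot>\<^sub>M s = Id \<M> V"
    by (rule retract_of_free[OF V])
  have p' [simp]: "tr V X p \<in> Arr C" "Dom C (tr V X p) = X" "Cod C (tr V X p) = H V"
    and ev_p': "ev V \<cdot>\<^sub>M R (tr V X p) = p"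
    using transpose[of V X p] by (auto simp: in_hom_iff)
  have "(k \<cdot>\<^sub>M ev V) \<cdot>\<^sub>M R (tr V X p) \<cdot>\<^sub>M s = k" if "k \<in> Arr \<M>" "Dom \<M> k = V" for k
  proof -
    have "(k \<cdot>\<^sub>M ev V) \<cdot>\<^sub>M R (tr V X p) \<cdot>\<^sub>M s = k \<cdot>\<^sub>M (ev V \<cdot>\<^sub>M R (tr V X p)) \<cdot>\<^sub>M s"
      using that by simp
    then show ?thesis
      unfolding ev_p' ps using that by simp
  qed
  then show ?thesis
    using eq v by metis
qed

definition action_difference :: "'o \<times> 'a \<Rightarrow> 'b" where
  "action_difference S =
     R (snd S) \<ominus>\<^bsub>hom_space \<M> ((fst S \<otimes>\<^sub>O A) \<rhd>\<^sub>O M) (fst S \<rhd>\<^sub>O M)\<^esub> act (fst S)"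

lemma actions_hom:
  assumes "right_module C Alg S"
  shows "R (snd S) \<in> hom_set \<M> ((fst S \<otimes>\<^sub>O A) \<rhd>\<^sub>O M) (fst S \<rhd>\<^sub>O M)"
    "act (fst S) \<in> hom_set \<M> ((fst S \<otimes>\<^sub>O A) \<rhd>\<^sub>O M) (fst S \<rhd>\<^sub>O M)"
  using C.right_module_simps[OF assms] by (auto simp: in_hom_iff)

lemma action_difference:
  assumes "right_module C Alg S"
  shows "action_difference S \<in> Arr \<M>"
    "Dom \<M> (action_difference S) = (fst S \<otimes>\<^sub>O A) \<rhd>\<^sub>O M"
    "Cod \<M> (action_difference S) = fst S \<rhd>\<^sub>O M"
    "Add_arr \<M> (action_difference S) (act (fst S)) = R (snd S)"
  using M.Add_minus[OF actions_hom[OF assms]] by (auto simp: action_difference_def in_hom_iff)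

text \<open>Cokernels of the difference are thus coequalizers of the two actions.\<close>

lemma action_difference_eq_Zero_iff:
  assumes "right_module C Alg S" "h \<in> hom_set \<M> (fst S \<rhd>\<^sub>O M) N"
  shows "h \<cdot>\<^sub>M action_difference S = Zero_arr \<M> ((fst S \<otimes>\<^sub>O A) \<rhd>\<^sub>O M) N \<longleftrightarrow>
    h \<cdot>\<^sub>M R (snd S) = h \<cdot>\<^sub>M act (fst S)"
  unfolding action_difference_def by (rule M.Comp_minus_eq_Zero_iff[OF actions_hom[OF assms(1)] assms(2)])

lemma proj_cokernel:
  assumes "right_module C Alg S"
  shows "is_cokernel \<M> (action_difference S) (proj S)"
proof -
  have "proj S = cokernel_arrow \<M> (action_difference S)"
    by (cases S) (simp add: rel_tensor_proj_def action_difference_def act_def)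
  then show ?thesis
    unfolding cokernel_arrow_def
    using someI_ex[OF S.ex_cokernel[OF action_difference(1)[OF assms]]] by simp
qed

lemma proj:
  assumes S: "right_module C Alg S"
  shows "proj S \<in> Arr \<M>" "Dom \<M> (proj S) = fst S \<rhd>\<^sub>O M" "Cod \<M> (proj S) = quot S" "quot S \<in> Obj \<M>"
    "proj S \<cdot>\<^sub>M R (snd S) = proj S \<cdot>\<^sub>M act (fst S)"
proof -
  note cok = proj_cokernel[OF S, unfolded is_cokernel_def action_difference(2,3)[OF S]]
  show *: "proj S \<in> Arr \<M>" "Dom \<M> (proj S) = fst S \<rhd>\<^sub>O M" "Cod \<M> (proj S) = quot S"
    using cok by (auto simp: rel_tensor_def)
  then show "quot S \<in> Obj \<M>"
    using M.Cod_Obj[of "proj S"] by simp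
  show "proj S \<cdot>\<^sub>M R (snd S) = proj S \<cdot>\<^sub>M act (fst S)"
    using action_difference_eq_Zero_iff[OF S, of "proj S" "quot S"] cok * by (simp add: in_hom_iff)
qed

lemma proj_factor:
  assumes S: "right_module C Alg S" and h: "h \<in> hom_set \<M> (fst S \<rhd>\<^sub>O M) N"
    and eq: "h \<cdot>\<^sub>M R (snd S) = h \<cdot>\<^sub>M act (fst S)"
  shows "\<exists>!v. v \<in> hom_set \<M> (quot S) N \<and> v \<cdot>\<^sub>M proj S = h"
proof -
  note cok = proj_cokernel[OF S, unfolded is_cokernel_def action_difference(2,3)[OF S] proj(3)[OF S]]
  have "N \<in> Obj \<M>"
    using h by (auto simp: in_hom_iff)
  moreover have "h \<cdot>\<^sub>M action_difference S = Zero_arr \<M> ((fst S \<otimes>\<^sub>O A) \<rhd>\<^sub>O M) N"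
    using action_difference_eq_Zero_iff[OF S h] eq by simp
  ultimately show ?thesis
    using cok h by blast
qed

lemma proj_cancel:
  assumes S: "right_module C Alg S" and eq: "v \<cdot>\<^sub>M proj S = v' \<cdot>\<^sub>M proj S"
    and v: "v \<in> Arr \<M>" "v' \<in> Arr \<M>" "Dom \<M> v = quot S" "Dom \<M> v' = quot S" "Cod \<M> v = Cod \<M> v'"
  shows "v = v'"
proof -
  note [simp] = v proj[OF S] C.right_module_simps[OF S]
  have "(v \<cdot>\<^sub>M proj S) \<cdot>\<^sub>M R (snd S) = v \<cdot>\<^sub>M (proj S \<cdot>\<^sub>M R (snd S))"
    by (simp del: proj)
  also have "\<dots> = (v \<cdot>\<^sub>M proj S) \<cdot>\<^sub>M act (fst S)"
    by simp
  finally have "\<exists>!w. w \<in> hom_set \<M> (quot S) (Cod \<M> v') \<and> w \<cdot>\<^sub>M proj S = v \<cdot>\<^sub>M proj S"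
    using proj_factor[OF S, of "v \<cdot>\<^sub>M proj S" "Cod \<M> v'"] by (simp add: in_hom_iff)
  moreover have "v \<in> hom_set \<M> (quot S) (Cod \<M> v')" "v' \<in> hom_set \<M> (quot S) (Cod \<M> v')"
    by (simp_all add: in_hom_iff)
  ultimately show ?thesis
    using eq by metis
qed

abbreviation Gmap :: "'o \<times> 'a \<Rightarrow> 'a \<Rightarrow> 'o \<times> 'a \<Rightarrow> 'b" where
  "Gmap S f T \<equiv> FArr G (S, f, T)"

lemma Gmap:
  assumes f: "module_map C Alg S f T"
  shows "Gmap S f T \<in> Arr \<M>" "Dom \<M> (Gmap S f T) = quot S" "Cod \<M> (Gmap S f T) = quot T"
    "Gmap S f T \<cdot>\<^sub>M proj S = proj T \<cdot>\<^sub>M R f"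
proof -
  note ST = C.module_mapD(1,2)[OF f] and eq = C.module_mapD(6)[OF f, unfolded Alg_simps]
  note pS = proj[OF ST(1)] C.right_module_simps[OF ST(1)]
  note pT = proj[OF ST(2)] C.right_module_simps[OF ST(2)]
  note [simp] = pS(1-4,6-) pT(1-4,6-) C.module_mapD(3-5)[OF f]
  have "(proj T \<cdot>\<^sub>M R f) \<cdot>\<^sub>M R (snd S) = proj T \<cdot>\<^sub>M R (f \<cdot>\<^sub>C snd S)"
    by simp
  also have "\<dots> = (proj T \<cdot>\<^sub>M R (snd T)) \<cdot>\<^sub>M R (f \<otimes>\<^sub>C Id C A)"
    unfolding eq by simp
  also have "\<dots> = proj T \<cdot>\<^sub>M (act (fst T) \<cdot>\<^sub>M R (f \<otimes>\<^sub>C Id C A))"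
    unfolding pT(5) by simp
  also have "act (fst T) \<cdot>\<^sub>M R (f \<otimes>\<^sub>C Id C A) = R f \<cdot>\<^sub>M act (fst S)"
    by (rule act_natural) auto
  also have "proj T \<cdot>\<^sub>M \<dots> = (proj T \<cdot>\<^sub>M R f) \<cdot>\<^sub>M act (fst S)"
    by simp
  finally have "\<exists>!g. g \<in> hom_set \<M> (quot S) (quot T) \<and> g \<cdot>\<^sub>M proj S = proj T \<cdot>\<^sub>M R f"
    by (intro proj_factor[OF ST(1)]) (auto simp: in_hom_iff)
  from theI'[OF this]
  have "Gmap S f T \<in> hom_set \<M> (quot S) (quot T) \<and> Gmap S f T \<cdot>\<^sub>M proj S = proj T \<cdot>\<^sub>M R f"
    by (simp add: rel_tensor_funct_def)
  then show "Gmap S f T \<in> Arr \<M>" "Dom \<M> (Gmap S f T) = quot S" "Cod \<M> (Gmap S f T) = quot T"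
    "Gmap S f T \<cdot>\<^sub>M proj S = proj T \<cdot>\<^sub>M R f"
    by (auto simp: in_hom_iff)
qed

lemma Gmap_unique:
  assumes f: "module_map C Alg S f T" and g: "g \<in> Arr \<M>" "Dom \<M> g = quot S" "Cod \<M> g = quot T"
    and eq: "g \<cdot>\<^sub>M proj S = proj T \<cdot>\<^sub>M R f"
  shows "Gmap S f T = g"
proof (rule proj_cancel[of S])
  show "right_module C Alg S"
    using f by (simp add: module_map_def)
  show "Gmap S f T \<cdot>\<^sub>M proj S = g \<cdot>\<^sub>M proj S"
    using Gmap(4)[OF f] eq by simp
qed (use g Gmap[OF f] in simp_all)

lemma FObj_G [simp]: "FObj G S = quot S"
  by (simp add: rel_tensor_funct_def)

theorem linear_functor_G: "linear_functor K ModA \<M> G"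
proof (intro linear_functor.intro linear_functor_axioms.intro)
  show "linear_category K \<M>"
    by (rule M.linear_category_axioms)
  show "linear_category K ModA"
    by (rule Mod_linear)
  show "FObj G S \<in> Obj \<M>" if "S \<in> Obj ModA" for S
    using that proj(4) by simp
  show "FArr G f \<in> hom_set \<M> (FObj G S) (FObj G T)" if hyps: "f \<in> hom_set ModA S T" for f S T
  proof -
    obtain f' where f': "f = (S, f', T)" "module_map C Alg S f' T"
      using hyps by (auto simp: Mod_cat_hom_iff)
    then show ?thesis
      using Gmap(1-3)[OF f'(2)] by (simp add: in_hom_iff)
  qed
  show "FArr G (Id ModA S) = Id \<M> (FObj G S)" if "S \<in> Obj ModA" for S
  proof -
    have S: "right_module C Alg S"
      using that by simp
    then show ?thesis
      using proj[OF S] C.right_module_simps[OF S] Gmap_unique[OF C.module_map_Id[OF _ S], of "Id \<M> (quot S)"]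
      by simp
  qed
  show "FArr G (g \<cdot>\<^bsub>ModA\<^esub> f) = FArr G g \<cdot>\<^sub>M FArr G f"
    if hyps: "f \<in> hom_set ModA S T" "g \<in> hom_set ModA T Q" for f g S T Q
  proof -
    obtain f' g' where fg: "f = (S, f', T)" "g = (T, g', Q)"
      and f': "module_map C Alg S f' T" and g': "module_map C Alg T g' Q"
      using hyps by (auto simp: Mod_cat_hom_iff)
    note ST = C.module_mapD(1,2)[OF f'] C.module_mapD(2)[OF g']
    note [simp] = proj(1-4)[OF ST(1)] proj(1-4)[OF ST(2)] proj(1-4)[OF ST(3)] Gmap(1-3)[OF f'] Gmap(1-3)[OF g']
    note [simp] = C.module_mapD(3-5)[OF f'] C.module_mapD(3-5)[OF g']
    have "(Gmap T g' Q \<cdot>\<^sub>M Gmap S f' T) \<cdot>\<^sub>M proj S = Gmap T g' Q \<cdot>\<^sub>M (Gmap S f' T \<cdot>\<^sub>M proj S)"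
      by simp
    also have "\<dots> = (Gmap T g' Q \<cdot>\<^sub>M proj T) \<cdot>\<^sub>M R f'"
      unfolding Gmap(4)[OF f'] by simp
    also have "\<dots> = proj Q \<cdot>\<^sub>M R (g' \<cdot>\<^sub>C f')"
      unfolding Gmap(4)[OF g'] by simp
    finally have eq: "(Gmap T g' Q \<cdot>\<^sub>M Gmap S f' T) \<cdot>\<^sub>M proj S = proj Q \<cdot>\<^sub>M R (g' \<cdot>\<^sub>C f')" .
    have "module_map C Alg S (g' \<cdot>\<^sub>C f') Q"
      by (rule C.module_map_Comp[OF _ f' g']) simp
    then show ?thesis
      unfolding fg Mod_cat_simps by (rule Gmap_unique[OF _ _ _ _ eq]) auto
  qed
  show "FArr G (Add_arr ModA f g) = Add_arr \<M> (FArr G f) (FArr G g)"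
    if hyps: "f \<in> hom_set ModA S T" "g \<in> hom_set ModA S T" for f g S T
  proof -
    obtain f' g' where fg: "f = (S, f', T)" "g = (S, g', T)"
      and f': "module_map C Alg S f' T" and g': "module_map C Alg S g' T"
      using hyps by (auto simp: Mod_cat_hom_iff)
    note ST = C.module_mapD(1,2)[OF f']
    note [simp] = proj(1-4)[OF ST(1)] proj(1-4)[OF ST(2)] Gmap(1-3)[OF f'] Gmap(1-3)[OF g']
    note [simp] = C.module_mapD(3-5)[OF f'] C.module_mapD(3-5)[OF g']
    have eq: "Add_arr \<M> (Gmap S f' T) (Gmap S g' T) \<cdot>\<^sub>M proj S = proj T \<cdot>\<^sub>M R (Add_arr C f' g')"
      using Gmap(4)[OF f'] Gmap(4)[OF g'] by (simp add: R_Add M.Comp_Add)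
    have "module_map C Alg S (Add_arr C f' g') T"
      by (rule C.module_map_Add[OF _ f' g']) simp
    then show ?thesis
      unfolding fg Mod_cat_simps by (rule Gmap_unique[OF _ _ _ _ eq]) auto
  qed
  show "FArr G (Smult_arr ModA c f) = Smult_arr \<M> c (FArr G f)"
    if c: "c \<in> carrier K" and hyps: "f \<in> hom_set ModA S T" for c f S T
  proof -
    obtain f' where fg: "f = (S, f', T)" and f': "module_map C Alg S f' T"
      using hyps by (auto simp: Mod_cat_hom_iff)
    note ST = C.module_mapD(1,2)[OF f']
    note [simp] = proj(1-4)[OF ST(1)] proj(1-4)[OF ST(2)] Gmap(1-3)[OF f'] c
    note [simp] = C.module_mapD(3-5)[OF f']
    have eq: "Smult_arr \<M> c (Gmap S f' T) \<cdot>\<^sub>M proj S = proj T \<cdot>\<^sub>M R (Smult_arr C c f')"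
      using Gmap(4)[OF f'] by (simp add: R_Smult M.Comp_Smult)
    have "module_map C Alg S (Smult_arr C c f') T"
      by (rule C.module_map_Smult[OF _ f' c]) simp
    then show ?thesis
      unfolding fg Mod_cat_simps by (rule Gmap_unique[OF _ _ _ _ eq]) auto
  qed
qed

text \<open>The counit: both \<open>ev V\<close> and the projection onto \<open>H V \<otimes>\<^sub>A M\<close> are cokernels of the same arrow.\<close>

lemma counit_exists:
  assumes V [simp]: "V \<in> Obj \<M>"
  shows "\<exists>v. v \<in> hom_set \<M> (quot (hm V)) V \<and> iso_arrow \<M> v \<and> v \<cdot>\<^sub>M proj (hm V) = ev V"
proof -
  note hmV = right_module_hm[OF V]
  note [simp] = proj(1-4)[OF hmV]
  obtain v where "v \<in> hom_set \<M> (quot (hm V)) V" and v_proj: "v \<cdot>\<^sub>M proj (hm V) = ev V"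
    using proj_factor[OF hmV, of "ev V" V] mu(4)[OF V] by (auto simp: in_hom_iff)
  then have [simp]: "v \<in> Arr \<M>" "Dom \<M> v = quot (hm V)" "Cod \<M> v = V"
    by (auto simp: in_hom_iff)
  obtain w where [simp]: "w \<in> Arr \<M>" "Dom \<M> w = V" "Cod \<M> w = quot (hm V)"
    and w_ev: "w \<cdot>\<^sub>M ev V = proj (hm V)"
    using ev_coequalizer[OF V, of "proj (hm V)"] proj(5)[OF hmV] by auto
  have "v \<cdot>\<^sub>M w = Id \<M> V"
    by (rule ev_right_cancel[OF V]) (simp_all add: w_ev v_proj)
  moreover have "w \<cdot>\<^sub>M v = Id \<M> (quot (hm V))"
    by (rule proj_cancel[OF hmV]) (simp_all add: w_ev v_proj)
  ultimately have "iso_arrow \<M> v"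
    by (intro M.iso_arrowI[of v w]) auto
  then show ?thesis
    using v_proj by (intro exI[of _ v]) (simp add: in_hom_iff)
qed

abbreviation eta :: "'o \<times> 'a \<Rightarrow> 'a" where
  "eta S \<equiv> tr (quot S) (fst S) (proj S)"

lemma eta:
  assumes S: "right_module C Alg S"
  shows "eta S \<in> Arr C" "Dom C (eta S) = fst S" "Cod C (eta S) = H (quot S)"
    "ev (quot S) \<cdot>\<^sub>M R (eta S) = proj S"
  using transpose[of "quot S" "fst S" "proj S"] proj[OF S] C.right_module_simps[OF S]
  by (auto simp: in_hom_iff)

lemma eta_module_map:
  assumes S: "right_module C Alg S"
  shows "module_map C Alg S (eta S) (hm (quot S))"
proof (rule module_map_hmI[OF S])
  note [simp] = eta(1-3)[OF S] proj(1-4)[OF S] C.right_module_simps[OF S]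
  have "ev (quot S) \<cdot>\<^sub>M R (eta S) \<cdot>\<^sub>M k = proj S \<cdot>\<^sub>M k"
    if "k \<in> Arr \<M>" "Cod \<M> k = fst S \<rhd>\<^sub>O M" for k
    using M.Comp_eq_prefix1[OF eta(4)[OF S]] that by simp
  then show "ev (quot S) \<cdot>\<^sub>M R (eta S) \<cdot>\<^sub>M R (snd S) = ev (quot S) \<cdot>\<^sub>M R (eta S) \<cdot>\<^sub>M act (fst S)"
    using proj(5)[OF S] by simp
qed (use eta[OF S] proj[OF S] in simp_all)

text \<open>
  The unit \<open>\<eta>\<close> is the transpose of the projection \<open>U \<otimes> M \<rightarrow> U \<otimes>\<^sub>A M\<close>. By regularity the projection has
  a section \<open>s\<close> with \<open>s \<pi> = 1 - d g\<close>, where \<open>d\<close> is the difference of the two actions. Lifting \<open>s\<close> and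
  \<open>g\<close> along the universal arrows \<open>act\<close> yields \<open>t\<close> and \<open>t'\<close>; the composite \<open>q t\<close> inverts \<open>\<eta>\<close>.
\<close>

lemma eta_iso:
  assumes S: "right_module C Alg S"
  shows "iso_arrow C (eta S)"
proof -
  define U q N \<pi> \<eta> d where "U = fst S" and "q = snd S" and "N = quot S" and "\<pi> = proj S"
    and "\<eta> = eta S" and "d = action_difference S"
  have q: "U \<in> Obj C" "q \<in> Arr C" "Dom C q = U \<otimes>\<^sub>O A" "Cod C q = U"
    using C.right_module_simps[OF S] by (simp_all add: U_def q_def)
  have \<pi>: "\<pi> \<in> Arr \<M>" "Dom \<M> \<pi> = U \<rhd>\<^sub>O M" "Cod \<M> \<pi> = N" "N \<in> Obj \<M>"
    "\<pi> \<cdot>\<^sub>M R q = \<pi> \<cdot>\<^sub>M act U"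
    using proj[OF S] by (simp_all add: U_def q_def N_def \<pi>_def)
  have \<eta>: "\<eta> \<in> Arr C" "Dom C \<eta> = U" "Cod C \<eta> = H N" "ev N \<cdot>\<^sub>M R \<eta> = \<pi>"
    using eta[OF S] by (simp_all add: U_def \<eta>_def N_def \<pi>_def)
  have d: "d \<in> Arr \<M>" "Dom \<M> d = (U \<otimes>\<^sub>O A) \<rhd>\<^sub>O M" "Cod \<M> d = U \<rhd>\<^sub>O M"
    "Add_arr \<M> d (act U) = R q"
    using action_difference[OF S] by (simp_all add: U_def q_def d_def)
  have q_assoc: "q \<cdot>\<^sub>C (q \<otimes>\<^sub>C Id C A) = q \<cdot>\<^sub>C (Id C U \<otimes>\<^sub>C \<mu> M) \<cdot>\<^sub>C Assoc C U A A"
    and q_unit: "q \<cdot>\<^sub>C (Id C U \<otimes>\<^sub>C u) = RUnit C U"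
    using S by (auto simp: right_module_def U_def q_def split: prod.splits)
  note [simp] = q \<pi>(1-4) \<eta>(1-3) d(1-3)
  obtain g where "g \<in> hom_set \<M> (U \<rhd>\<^sub>O M) ((U \<otimes>\<^sub>O A) \<rhd>\<^sub>O M)" and dgd: "d \<cdot>\<^sub>M g \<cdot>\<^sub>M d = d"
    using S.semisimple_von_neumann_regular d unfolding von_neumann_regular_def by metis
  then have g [simp]: "g \<in> Arr \<M>" "Dom \<M> g = U \<rhd>\<^sub>O M" "Cod \<M> g = (U \<otimes>\<^sub>O A) \<rhd>\<^sub>O M"
    by (auto simp: in_hom_iff)
  \<comment> \<open>\<open>b = 1 - d g\<close> annihilates \<open>d\<close> and therefore factors through the cokernel \<open>\<pi>\<close>\<close>
  have dg: "d \<cdot>\<^sub>M g \<in> hom_set \<M> (U \<rhd>\<^sub>O M) (U \<rhd>\<^sub>O M)" "(d \<cdot>\<^sub>M g) \<cdot>\<^sub>M d \<cdot>\<^sub>M g = d \<cdot>\<^sub>M g"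
    using M.Comp_eq_prefix1[OF dgd, of g] by (simp_all add: in_hom_iff)
  obtain b where b_hom: "b \<in> hom_set \<M> (U \<rhd>\<^sub>O M) (U \<rhd>\<^sub>O M)"
    and b_sum: "Add_arr \<M> b (d \<cdot>\<^sub>M g) = Id \<M> (U \<rhd>\<^sub>O M)"
    and bdg: "b \<cdot>\<^sub>M d \<cdot>\<^sub>M g = Zero_arr \<M> (U \<rhd>\<^sub>O M) (U \<rhd>\<^sub>O M)"
    by (rule M.complement_idempotent[OF dg])
  then have b [simp]: "b \<in> Arr \<M>" "Dom \<M> b = U \<rhd>\<^sub>O M" "Cod \<M> b = U \<rhd>\<^sub>O M"
    by (auto simp: in_hom_iff)
  have "b \<cdot>\<^sub>M d = (b \<cdot>\<^sub>M d \<cdot>\<^sub>M g) \<cdot>\<^sub>M d"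
    by (simp add: dgd)
  then have "b \<cdot>\<^sub>M d = Zero_arr \<M> ((U \<otimes>\<^sub>O A) \<rhd>\<^sub>O M) (U \<rhd>\<^sub>O M)"
    by (simp only: bdg) simp
  then have b_eq: "b \<cdot>\<^sub>M R q = b \<cdot>\<^sub>M act U"
    using action_difference_eq_Zero_iff[OF S, of b "U \<rhd>\<^sub>O M"] b_hom by (simp add: U_def q_def d_def)
  then obtain s where "s \<in> hom_set \<M> N (U \<rhd>\<^sub>O M)" and s\<pi>: "s \<cdot>\<^sub>M \<pi> = b"
    using proj_factor[OF S, of b "U \<rhd>\<^sub>O M"] b_hom by (auto simp: U_def q_def N_def \<pi>_def)
  then have s [simp]: "s \<in> Arr \<M>" "Dom \<M> s = N" "Cod \<M> s = U \<rhd>\<^sub>O M"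
    by (auto simp: in_hom_iff)
  have \<pi>s: "\<pi> \<cdot>\<^sub>M s = Id \<M> N"
  proof (rule proj_cancel[OF S])
    have \<pi>d: "\<pi> \<cdot>\<^sub>M d = Zero_arr \<M> ((U \<otimes>\<^sub>O A) \<rhd>\<^sub>O M) N"
      using action_difference_eq_Zero_iff[OF S, of \<pi> N] \<pi> by (simp add: U_def q_def d_def in_hom_iff)
    have "\<pi> \<cdot>\<^sub>M d \<cdot>\<^sub>M g = (\<pi> \<cdot>\<^sub>M d) \<cdot>\<^sub>M g"
      by simp
    also have "\<dots> = Zero_arr \<M> (U \<rhd>\<^sub>O M) N"
      unfolding \<pi>d by simp
    finally have "\<pi> \<cdot>\<^sub>M b = \<pi> \<cdot>\<^sub>M Add_arr \<M> b (d \<cdot>\<^sub>M g)"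
      by (simp add: M.Comp_Add)
    then show "(\<pi> \<cdot>\<^sub>M s) \<cdot>\<^sub>M proj S = Id \<M> N \<cdot>\<^sub>M proj S"
      unfolding b_sum \<pi>_def[symmetric] by (simp add: s\<pi>)
  qed (simp_all add: N_def[symmetric])
  have sum: "Add_arr \<M> b (R q \<cdot>\<^sub>M g) = Add_arr \<M> (Id \<M> (U \<rhd>\<^sub>O M)) (act U \<cdot>\<^sub>M g)"
  proof -
    have "R q \<cdot>\<^sub>M g = Add_arr \<M> (d \<cdot>\<^sub>M g) (act U \<cdot>\<^sub>M g)"
      unfolding d(4)[symmetric] by (simp add: M.Comp_Add)
    then have "Add_arr \<M> b (R q \<cdot>\<^sub>M g) = Add_arr \<M> (Add_arr \<M> b (d \<cdot>\<^sub>M g)) (act U \<cdot>\<^sub>M g)"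
      using abelian_groupE(3)[OF M.hom_abelian_group[of "U \<rhd>\<^sub>O M" "U \<rhd>\<^sub>O M"],
          of b "d \<cdot>\<^sub>M g" "act U \<cdot>\<^sub>M g"] by (simp add: in_hom_iff)
    then show ?thesis
      unfolding b_sum .
  qed
  obtain t where t [simp]: "t \<in> Arr C" "Dom C t = H N" "Cod C t = U \<otimes>\<^sub>O A" and act_t: "act U \<cdot>\<^sub>M R t = s \<cdot>\<^sub>M ev N"
    by (rule obtain_act_preimage[of U "H N" "s \<cdot>\<^sub>M ev N"]) (auto simp: in_hom_iff)
  obtain t' where t' [simp]: "t' \<in> Arr C" "Dom C t' = U" "Cod C t' = (U \<otimes>\<^sub>O A) \<otimes>\<^sub>O A"
    and act_t': "act (U \<otimes>\<^sub>O A) \<cdot>\<^sub>M R t' = g"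
    by (rule obtain_act_preimage[of "U \<otimes>\<^sub>O A" U g]) (auto simp: in_hom_iff)
  define r where "r = (Id C U \<otimes>\<^sub>C u) \<cdot>\<^sub>C inverse_arrow C (RUnit C U)"
  define m where "m = (Id C U \<otimes>\<^sub>C \<mu> M) \<cdot>\<^sub>C Assoc C U A A"
  have r [simp]: "r \<in> Arr C" "Dom C r = U" "Cod C r = U \<otimes>\<^sub>O A"
    and m [simp]: "m \<in> Arr C" "Dom C m = (U \<otimes>\<^sub>O A) \<otimes>\<^sub>O A" "Cod C m = U \<otimes>\<^sub>O A"
    by (auto simp: r_def m_def)
  \<comment> \<open>the four terms of the equation \<open>s \<pi> + R q g = 1 + act g\<close> as images under \<open>act U\<close>\<close>
  have 1: "act U \<cdot>\<^sub>M R (t \<cdot>\<^sub>C \<eta>) = b"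
  proof -
    have "act U \<cdot>\<^sub>M R (t \<cdot>\<^sub>C \<eta>) = (act U \<cdot>\<^sub>M R t) \<cdot>\<^sub>M R \<eta>"
      by simp
    then show ?thesis
      unfolding act_t by (simp add: \<eta>(4) s\<pi>)
  qed
  have 2: "act U \<cdot>\<^sub>M R ((q \<otimes>\<^sub>C Id C A) \<cdot>\<^sub>C t') = R q \<cdot>\<^sub>M g"
  proof -
    have "act U \<cdot>\<^sub>M R ((q \<otimes>\<^sub>C Id C A) \<cdot>\<^sub>C t') = (act U \<cdot>\<^sub>M R (q \<otimes>\<^sub>C Id C A)) \<cdot>\<^sub>M R t'"
      by simp
    also have "act U \<cdot>\<^sub>M R (q \<otimes>\<^sub>C Id C A) = R q \<cdot>\<^sub>M act (U \<otimes>\<^sub>O A)"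
      by (rule act_natural) auto
    finally show ?thesis
      by (simp add: act_t')
  qed
  have 3: "act U \<cdot>\<^sub>M R r = Id \<M> (U \<rhd>\<^sub>O M)"
  proof -
    have "act U \<cdot>\<^sub>M R r = (act U \<cdot>\<^sub>M R (Id C U \<otimes>\<^sub>C u)) \<cdot>\<^sub>M R (inverse_arrow C (RUnit C U))"
      by (simp add: r_def)
    also have "act U \<cdot>\<^sub>M R (Id C U \<otimes>\<^sub>C u) = R (RUnit C U)"
      by (rule act_unit) simp
    finally show ?thesis
      by (simp add: ActA_Comp_fuse)
  qed
  have 4: "act U \<cdot>\<^sub>M R (m \<cdot>\<^sub>C t') = act U \<cdot>\<^sub>M g"
  proof -
    have "act U \<cdot>\<^sub>M R (m \<cdot>\<^sub>C t') = (act U \<cdot>\<^sub>M R m) \<cdot>\<^sub>M R t'"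
      by simp
    also have "act U \<cdot>\<^sub>M R m = act U \<cdot>\<^sub>M act (U \<otimes>\<^sub>O A)"
      unfolding m_def by (rule act_assoc) simp
    finally show ?thesis
      by (simp add: act_t')
  qed
  have "act U \<cdot>\<^sub>M R (Add_arr C (t \<cdot>\<^sub>C \<eta>) ((q \<otimes>\<^sub>C Id C A) \<cdot>\<^sub>C t')) =
      Add_arr \<M> (act U \<cdot>\<^sub>M R (t \<cdot>\<^sub>C \<eta>)) (act U \<cdot>\<^sub>M R ((q \<otimes>\<^sub>C Id C A) \<cdot>\<^sub>C t'))"
    by (simp add: R_Add M.Comp_Add)
  also have "\<dots> = Add_arr \<M> (act U \<cdot>\<^sub>M R r) (act U \<cdot>\<^sub>M R (m \<cdot>\<^sub>C t'))"
    unfolding 1 2 3 4 by (rule sum)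
  also have "\<dots> = act U \<cdot>\<^sub>M R (Add_arr C r (m \<cdot>\<^sub>C t'))"
    by (simp add: R_Add M.Comp_Add)
  finally have lift: "Add_arr C (t \<cdot>\<^sub>C \<eta>) ((q \<otimes>\<^sub>C Id C A) \<cdot>\<^sub>C t') = Add_arr C r (m \<cdot>\<^sub>C t')"
    by (rule act_cancel) auto
  have qm: "q \<cdot>\<^sub>C (q \<otimes>\<^sub>C Id C A) \<cdot>\<^sub>C t' = q \<cdot>\<^sub>C m \<cdot>\<^sub>C t'"
    using C.Comp_eq_prefix[OF q_assoc[folded m_def], of t'] by simp
  have qr: "q \<cdot>\<^sub>C r = Id C U"
    using C.Comp_eq_prefix1[OF q_unit, of "inverse_arrow C (RUnit C U)"] by (simp add: r_def)
  have "Add_arr C (q \<cdot>\<^sub>C t \<cdot>\<^sub>C \<eta>) (q \<cdot>\<^sub>C m \<cdot>\<^sub>C t') =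
      q \<cdot>\<^sub>C Add_arr C (t \<cdot>\<^sub>C \<eta>) ((q \<otimes>\<^sub>C Id C A) \<cdot>\<^sub>C t')"
    by (simp add: C.Comp_Add qm)
  also have "\<dots> = Add_arr C (Id C U) (q \<cdot>\<^sub>C m \<cdot>\<^sub>C t')"
    unfolding lift by (simp add: C.Comp_Add qr)
  finally have left: "q \<cdot>\<^sub>C t \<cdot>\<^sub>C \<eta> = Id C U"
    by (rule C.Add_cancel_right) (auto simp: in_hom_iff)
  have right: "\<eta> \<cdot>\<^sub>C q \<cdot>\<^sub>C t = Id C (H N)"
  proof (rule ev_cancel)
    have "ev N \<cdot>\<^sub>M R (\<eta> \<cdot>\<^sub>C q \<cdot>\<^sub>C t) = ((ev N \<cdot>\<^sub>M R \<eta>) \<cdot>\<^sub>M R q) \<cdot>\<^sub>M R t"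
      by simp
    also have "\<dots> = \<pi> \<cdot>\<^sub>M (act U \<cdot>\<^sub>M R t)"
      unfolding \<eta>(4) \<pi>(5) by simp
    also have "\<dots> = (\<pi> \<cdot>\<^sub>M s) \<cdot>\<^sub>M ev N"
      unfolding act_t by simp
    also have "\<dots> = ev N \<cdot>\<^sub>M R (Id C (H N))"
      unfolding \<pi>s by simp
    finally show "ev N \<cdot>\<^sub>M R (\<eta> \<cdot>\<^sub>C q \<cdot>\<^sub>C t) = ev N \<cdot>\<^sub>M R (Id C (H N))" .
  qed auto
  show ?thesis
    unfolding \<eta>_def[symmetric] using left right by (intro C.iso_arrowI[of \<eta> "q \<cdot>\<^sub>C t"]) auto
qed

lemma counit_natural_iso: "naturally_isomorphic \<M> \<M> (comp_funct G F) id_funct"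
proof -
  have "\<forall>V \<in> Obj \<M>. \<exists>v. v \<in> hom_set \<M> (quot (hm V)) V \<and> iso_arrow \<M> v \<and> v \<cdot>\<^sub>M proj (hm V) = ev V"
    using counit_exists by blast
  then obtain \<epsilon> where \<epsilon>: "\<And>V. V \<in> Obj \<M> \<Longrightarrow>
      \<epsilon> V \<in> hom_set \<M> (quot (hm V)) V \<and> iso_arrow \<M> (\<epsilon> V) \<and> \<epsilon> V \<cdot>\<^sub>M proj (hm V) = ev V"
    by metis
  have nat: "h \<cdot>\<^sub>M \<epsilon> (Dom \<M> h) = \<epsilon> (Cod \<M> h) \<cdot>\<^sub>M Gmap (hm (Dom \<M> h)) (Hmap h) (hm (Cod \<M> h))"
    if h: "h \<in> Arr \<M>" for h
  proof -
    define V W where "V = Dom \<M> h" and "W = Cod \<M> h"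
    have [simp]: "h \<in> Arr \<M>" "Dom \<M> h = V" "Cod \<M> h = W" "V \<in> Obj \<M>" "W \<in> Obj \<M>"
      using h by (auto simp: V_def W_def)
    note m = Hmap_module_map[OF h, folded V_def W_def]
    note V = right_module_hm[OF \<open>V \<in> Obj \<M>\<close>] and W = right_module_hm[OF \<open>W \<in> Obj \<M>\<close>]
    note H = Hmap[OF h, folded V_def W_def]
    note [simp] = proj(1-4)[OF V] proj(1-4)[OF W] Gmap(1-3)[OF m] H(1-3)
    have [simp]: "\<epsilon> V \<in> Arr \<M>" "Dom \<M> (\<epsilon> V) = quot (hm V)" "Cod \<M> (\<epsilon> V) = V"
      "\<epsilon> W \<in> Arr \<M>" "Dom \<M> (\<epsilon> W) = quot (hm W)" "Cod \<M> (\<epsilon> W) = W"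
      using \<epsilon>[of V] \<epsilon>[of W] by (auto simp: in_hom_iff)
    have \<epsilon>_proj: "\<epsilon> V \<cdot>\<^sub>M proj (hm V) = ev V" "\<epsilon> W \<cdot>\<^sub>M proj (hm W) = ev W"
      using \<epsilon>[of V] \<epsilon>[of W] by auto
    let ?k = "tr W (H V) (h \<cdot>\<^sub>M ev V)"
    let ?g = "Gmap (hm V) ?k (hm W)"
    have "h \<cdot>\<^sub>M \<epsilon> V = \<epsilon> W \<cdot>\<^sub>M ?g"
    proof (rule proj_cancel[OF V])
      have "(h \<cdot>\<^sub>M \<epsilon> V) \<cdot>\<^sub>M proj (hm V) = h \<cdot>\<^sub>M ev V"
        by (simp add: \<epsilon>_proj)
      also have "\<dots> = (\<epsilon> W \<cdot>\<^sub>M proj (hm W)) \<cdot>\<^sub>M R ?k"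
        unfolding \<epsilon>_proj(2) using H(4) by simp
      also have "\<dots> = \<epsilon> W \<cdot>\<^sub>M (?g \<cdot>\<^sub>M proj (hm V))"
        unfolding Gmap(4)[OF m] by simp
      finally show "(h \<cdot>\<^sub>M \<epsilon> V) \<cdot>\<^sub>M proj (hm V) = (\<epsilon> W \<cdot>\<^sub>M ?g) \<cdot>\<^sub>M proj (hm V)"
        by simp
    qed simp_all
    then show ?thesis
      by simp
  qed
  have "natural_iso \<M> \<M> (comp_funct G F) id_funct \<epsilon>"
    using \<epsilon> nat by (simp add: natural_iso_def comp_funct_def id_funct_def F_simps)
  then show ?thesis
    by (auto simp: naturally_isomorphic_def)
qed

lemma unit_natural_iso: "naturally_isomorphic ModA ModA (comp_funct F G) id_funct"
proof -
  interpret D: linear_category K ModA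
    by (rule Mod_linear)
  define \<eta> where "\<eta> S = (S, eta S, hm (quot S))" for S
  have \<eta>: "\<eta> S \<in> Arr ModA" "Dom ModA (\<eta> S) = S" "Cod ModA (\<eta> S) = hm (quot S)" "iso_arrow ModA (\<eta> S)"
    if "right_module C Alg S" for S
    using eta_module_map[OF that] C.Mod_cat_iso[OF _ eta_module_map[OF that] eta_iso[OF that]]
    by (simp_all add: \<eta>_def)
  have nat: "f \<cdot>\<^bsub>ModA\<^esub> inverse_arrow ModA (\<eta> S) = inverse_arrow ModA (\<eta> T) \<cdot>\<^bsub>ModA\<^esub> FArr F (FArr G f)"
    if f: "f \<in> Arr ModA" "Dom ModA f = S" "Cod ModA f = T" for f S T
  proof -
    obtain f' where f': "f = (S, f', T)" "module_map C Alg S f' T"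
      using f by (cases f) auto
    note ST = C.module_mapD(1,2)[OF f'(2)]
    note [simp] = C.module_mapD(3-5)[OF f'(2)]
    let ?g = "Gmap S f' T"
    note g = Gmap[OF f'(2)]
    note Hg = Hmap[OF g(1), unfolded g(2,3)]
    note [simp] = proj(1-4)[OF ST(1)] proj(1-4)[OF ST(2)] g(1-3) Hg(1-3) eta(1-3)[OF ST(1)] eta(1-3)[OF ST(2)]
      C.right_module_simps[OF ST(1)] C.right_module_simps[OF ST(2)]
    let ?h = "tr (quot T) (H (quot S)) (?g \<cdot>\<^sub>M ev (quot S))"
    have "?h \<cdot>\<^sub>C eta S = eta T \<cdot>\<^sub>C f'"
    proof (rule ev_cancel)
      have "ev (quot T) \<cdot>\<^sub>M R (?h \<cdot>\<^sub>C eta S) = (ev (quot T) \<cdot>\<^sub>M R ?h) \<cdot>\<^sub>M R (eta S)"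
        by simp
      also have "\<dots> = ?g \<cdot>\<^sub>M (ev (quot S) \<cdot>\<^sub>M R (eta S))"
        unfolding Hg(4) by simp
      also have "\<dots> = (ev (quot T) \<cdot>\<^sub>M R (eta T)) \<cdot>\<^sub>M R f'"
        unfolding eta(4)[OF ST(1)] eta(4)[OF ST(2)] by (rule g(4))
      finally show "ev (quot T) \<cdot>\<^sub>M R (?h \<cdot>\<^sub>C eta S) = ev (quot T) \<cdot>\<^sub>M R (eta T \<cdot>\<^sub>C f')"
        by simp
    qed simp_all
    then have "FArr F (FArr G f) \<cdot>\<^bsub>ModA\<^esub> \<eta> S = \<eta> T \<cdot>\<^bsub>ModA\<^esub> f"
      by (simp add: f'(1) F_simps \<eta>_def)
    moreover have "FArr F (FArr G f) \<in> Arr ModA" "Dom ModA (FArr F (FArr G f)) = hm (quot S)"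
      "Cod ModA (FArr F (FArr G f)) = hm (quot T)"
      using Hmap_module_map[OF g(1)] by (simp_all add: f'(1) F_simps)
    ultimately show ?thesis
      using \<eta>[OF ST(1)] \<eta>[OF ST(2)] f by (intro D.inverse_square) auto
  qed
  have "natural_iso ModA ModA (comp_funct F G) id_funct (\<lambda>S. inverse_arrow ModA (\<eta> S))"
    unfolding natural_iso_def
  proof (intro conjI ballI)
    fix S
    assume "S \<in> Obj ModA"
    then show "inverse_arrow ModA (\<eta> S) \<in> hom_set ModA (FObj (comp_funct F G) S) (FObj id_funct S)"
      and "iso_arrow ModA (inverse_arrow ModA (\<eta> S))"
      using \<eta>[of S] by (simp_all add: comp_funct_def id_funct_def F_simps in_hom_iff)
  next
    fix f
    assume "f \<in> Arr ModA"
    then show "FArr id_funct f \<cdot>\<^bsub>ModA\<^esub> inverse_arrow ModA (\<eta> (Dom ModA f)) =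
        inverse_arrow ModA (\<eta> (Cod ModA f)) \<cdot>\<^bsub>ModA\<^esub> FArr (comp_funct F G) f"
      using nat by (simp add: comp_funct_def id_funct_def)
  qed
  then show ?thesis
    by (auto simp: naturally_isomorphic_def)
qed

theorem quasi_inverse_F_G: "quasi_inverse K \<M> ModA F G"
  using linear_functor_F linear_functor_G counit_natural_iso unit_natural_iso
  by (simp add: quasi_inverse_def)

end

theorem theorem4p3:
  fixes K :: "('k, 'r) ring_scheme"
    and C :: "('k, 'o, 'a, 'z) mon_cat_scheme"
    and \<M> :: "('k, 'o, 'a, 'p, 'b, 'y) mod_cat_scheme"
    and I :: "('o, 'a, 'p, 'b) ihoms"
    and M :: 'p
  assumes "field K"
    and "fusion_category K C"
    and "module_category K C \<M>"
    and "semisimple_category K \<M>"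
    and "internal_homs C \<M> I"
    and "generates C \<M> M"
  shows
    "let A = ihom_alg C \<M> I M;
         ModA = Mod_cat C A;
         L = (M, ihom_ev C I M M);
         F = ihom_funct C \<M> I M;
         G = rel_tensor_funct \<M> C A L
     in semisimple_algebra K C A \<and>
        cat_equivalence K \<M> ModA F \<and>
        quasi_inverse K \<M> ModA F G \<and>
        (\<forall>V \<in> Obj \<M>. isomorphic \<M> (rel_tensor \<M> C A L (ihom_module C \<M> I M V)) V) \<and>
        (\<forall>U \<in> Obj ModA. isomorphic ModA U (ihom_module C \<M> I M (rel_tensor \<M> C A L U))) \<and>
        (\<forall>V \<in> Obj \<M>. simple_object \<M> V \<longleftrightarrow> simple_object ModA (ihom_module C \<M> I M V)) \<and>
        (\<forall>U \<in> Obj ModA. simple_object ModA U \<longleftrightarrow> simple_object \<M> (rel_tensor \<M> C A L U))"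
proof -
  interpret C: fusion_category K C
    by fact
  interpret internal_hom_generator K C \<M> I M
  proof (intro internal_hom_generator.intro internal_hom_source.intro
      internal_hom_source_axioms.intro internal_hom_generator_axioms.intro)
    show "M \<in> Obj \<M>"
      using assms(6) by (simp add: generates_def)
  qed (fact assms C.left_dual)+
  note qi = quasi_inverse_F_G and regular = S.semisimple_von_neumann_regular
    and split = S.abelian_idempotents_split
  interpret D: semisimple_category K ModA
    by (rule quasi_inverse_semisimple[OF qi assms(4)])
  have "isomorphic \<M> (quot (hm V)) V" if "V \<in> Obj \<M>" for V
    using counit_exists[OF that] M.isomorphicI by blast
  moreover have "isomorphic ModA U (hm (quot U))" if "U \<in> Obj ModA" for U
  proof -
    have U: "right_module C Alg U"
      using that by simp
    show ?thesis
      using eta_module_map[OF U] C.Mod_cat_iso[OF _ eta_module_map[OF U] eta_iso[OF U]]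
      by (intro D.isomorphicI[of "(U, eta U, hm (quot U))"]) (simp_all add: Mod_cat_hom_iff)
  qed
  moreover have "simple_object \<M> V \<longleftrightarrow> simple_object ModA (hm V)" if "V \<in> Obj \<M>" for V
    using quasi_inverse_simple_iff[OF qi regular split that] by (simp add: F_simps)
  moreover have "simple_object ModA U \<longleftrightarrow> simple_object \<M> (quot U)" if "U \<in> Obj ModA" for U
    using quasi_inverse_simple_iff[OF quasi_inverse_sym[OF qi] D.semisimple_von_neumann_regular
        D.abelian_idempotents_split that] by simp
  moreover have "semisimple_algebra K C Alg"
    using algebra_Alg D.semisimple_category_axioms by (simp add: semisimple_algebra_def)
  moreover have "cat_equivalence K \<M> ModA F"
    using qi by (auto simp: cat_equivalence_def)
  ultimately show ?thesis
    using qi unfolding Let_def by blast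
qed

end
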